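(* Let $\gamma\in[0,\frac12]$ and $Q\in\mathcal{L}(H_\gamma,Y)$. (1) Let $\mu\ge0$ and suppose the control estimate holds for $P$ and $Q$: there are $\lambda_0\ge0$, $N>0$, $C>0$ and positive continuous functions $M,m$ on $[0,\infty)$, each bounded below by a positive constant, such that $$\|u\|_H\le M(\lambda)\langle\lambda\rangle^{-1}\|(P-\lambda^2)\Lambda^{\mu-\gamma}u\|_H+m(\lambda)\|Q\Lambda^\mu u\|_Y+C\|\Lambda^{-N}u\|_H$$ for all $u\in H_{1+\mu-\gamma}$ and all $\lambda\ge\lambda_0$. Then there exist $\lambda_0'>0$ and $C'>0$ such that, for all $\lambda\in\mathbb{R}$ with $|\lambda|\ge\lambda_0'$, $\mathcal{A}+i\lambda$ is invertible and $$\|(\mathcal{A}+i\lambda)^{-1}\|_{\mathcal{L}(\mathcal{H})}\le C'|\lambda|^{4\mu}\left(M(|\lambda|)^2+m(|\lambda|)^2\right).$$ (2) Suppose there are $\lambda_0\ge0$ and a function $K$ with $K(|\lambda|)\ge C'>0$ such that $\mathcal{A}+i\lambda$ is invertible with $\|(\mathcal{A}+i\lambda)^{-1}\|_{\mathcal{L}(\mathcal{H})}\le K(|\lambda|)$ for all $\lambda\in\mathbb{R}$ with $|\lambda|\ge\lambda_0$. Then for any $\mu\in[0,\frac12+\gamma]$ there exists $C>0$ such that $$\|u\|_H\le C\langle\lambda\rangle^{2(\gamma-\mu)}K(|\lambda|)\left(\langle\lambda\rangle^{-1}\|(P-\lambda^2)\Lambda^{\mu-\gamma}u\|_H+\|Q\Lambda^\mu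 u\|_Y\right)$$ for all $\lambda\ge\lambda_0$ and all $u\in H_{\frac12+\mu}$.
   Context: Let $H=H_0$ be a Hilbert space and let $P$ be a nonnegative self-adjoint operator on $H$ with compact resolvent, defined on a dense subspace $H_1\subset H$. Write its spectral resolution as $P=\int_0^\infty\rho^2\,dE_\rho$. For $s\in\mathbb{R}$ put $\Lambda^s=\int_0^\infty(1+\rho^2)^s\,dE_\rho=(1+P)^s$ and $H_s=\Lambda^{-s}(H)$ with norm $\|u\|_s=\|\Lambda^su\|_H$; $H_{-s}$ is identified with the dual of $H_s$ with respect to $H$, and $P$ extends to $P:H_{1/2}\to H_{-1/2}$. Let $Y$ be a Hilbert space, and let $Q^*\in\mathcal{L}(Y,H_{-\gamma})$ be the adjoint of $Q\in\mathcal{L}(H_\gamma,Y)$. Let $\mathcal{H}=H_{1/2}\times H$, with norm $\|(u,v)\|_{\mathcal{H}}^2=\|\Lambda^{1/2}u\|_H^2+\|v\|_H^2$, $\mathcal{D}=\{(u,v)\in H_{1/2}\times H_{1/2}:Pu+Q^*Qv\in H\}$, and $\mathcal{A}:\mathcal{D}\to\mathcal{H}$, $\mathcal{A}(u,v)=(v,-Pu-Q^*Qv)$. Notation: $\langle\lambda\rangle=(1+\lambda^2)^{1/2}$. The norm $\|w\|_H$ of an element $w$ of some $H_s$ not lying in $H$ is understood as $+\infty$. *)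

theory Defs
  imports "HOL-Analysis.Analysis"
begin

section \<open>Complex Hilbert spaces\<close>

text \<open>
  The inner product is linear in the first argument and antilinear in the second.
  Positivity and the relation to the norm come from the underlying real inner product,
  which is the real part of the complex one.
\<close>

class complex_hilbert = real_inner + complete_space +
  fixes scaleC :: "complex \<Rightarrow> 'a \<Rightarrow> 'a" (infixr "*\<^sub>C" 75)
    and cinner :: "'a \<Rightarrow> 'a \<Rightarrow> complex"
  assumes scaleC_add_right: "a *\<^sub>C (x + y) = a *\<^sub>C x + a *\<^sub>C y"
    and scaleC_add_left: "(a + b) *\<^sub>C x = a *\<^sub>C x + b *\<^sub>C x"
    and scaleC_scaleC: "a *\<^sub>C b *\<^sub>C x = (a * b) *\<^sub>C x"
    and scaleR_scaleC: "r *\<^sub>R x = complex_of_real r *\<^sub>C x"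
    and cinner_add_left: "cinner (x + y) z = cinner x z + cinner y z"
    and cinner_scaleC_left: "cinner (a *\<^sub>C x) y = a * cinner x y"
    and cinner_commute: "cinner x y = cnj (cinner y x)"
    and inner_eq_Re_cinner: "inner x y = Re (cinner x y)"

instantiation complex :: complex_hilbert
begin

definition scaleC_complex :: "complex \<Rightarrow> complex \<Rightarrow> complex" where
  "scaleC_complex a x = a * x"

definition cinner_complex :: "complex \<Rightarrow> complex \<Rightarrow> complex" where
  "cinner_complex x y = x * cnj y"

instance
  by standard
    (auto simp: scaleC_complex_def cinner_complex_def algebra_simps scaleR_conv_of_real
      inner_complex_def)

end

section \<open>Unbounded operators\<close>

text \<open>An operator in \<open>H\<close> is given by its domain \<open>D\<close> and a function that matters only on \<open>D\<close>.\<close>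

definition csubspace :: "'a::complex_hilbert set \<Rightarrow> bool" where
  "csubspace S \<longleftrightarrow> 0 \<in> S \<and> (\<forall>x\<in>S. \<forall>y\<in>S. x + y \<in> S) \<and> (\<forall>a. \<forall>x\<in>S. a *\<^sub>C x \<in> S)"

definition clinear_on :: "'a::complex_hilbert set \<Rightarrow> ('a \<Rightarrow> 'b::complex_hilbert) \<Rightarrow> bool" where
  "clinear_on S T \<longleftrightarrow> csubspace S \<and> (\<forall>x\<in>S. \<forall>y\<in>S. T (x + y) = T x + T y)
     \<and> (\<forall>a. \<forall>x\<in>S. T (a *\<^sub>C x) = a *\<^sub>C T x)"

definition adjoint_graph :: "'a::complex_hilbert set \<Rightarrow> ('a \<Rightarrow> 'a) \<Rightarrow> ('a \<times> 'a) set" where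
  "adjoint_graph D P = {(w, z). \<forall>u\<in>D. cinner (P u) w = cinner u z}"

definition selfadjoint :: "'a::complex_hilbert set \<Rightarrow> ('a \<Rightarrow> 'a) \<Rightarrow> bool" where
  "selfadjoint D P \<longleftrightarrow> clinear_on D P \<and> closure D = UNIV
     \<and> adjoint_graph D P = {(w, P w) |w. w \<in> D}"

definition nonnegative_op :: "'a::complex_hilbert set \<Rightarrow> ('a \<Rightarrow> 'a) \<Rightarrow> bool" where
  "nonnegative_op D P \<longleftrightarrow> (\<forall>u\<in>D. 0 \<le> Re (cinner (P u) u))"

text \<open>For some \<open>z\<close>, the operator \<open>P - z\<close> has an everywhere defined compact inverse.\<close>

definition compact_resolvent :: "'a::complex_hilbert set \<Rightarrow> ('a \<Rightarrow> 'a) \<Rightarrow> bool" where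
  "compact_resolvent D P \<longleftrightarrow> (\<exists>z. bij_betw (\<lambda>u. P u - z *\<^sub>C u) D UNIV
     \<and> compact (closure (inv_into D (\<lambda>u. P u - z *\<^sub>C u) ` cball 0 1)))"

section \<open>Spectral resolutions and functional calculus\<close>

definition spectral_family :: "(real \<Rightarrow> 'a::complex_hilbert \<Rightarrow> 'a) \<Rightarrow> bool" where
  "spectral_family E \<longleftrightarrow>
     (\<forall>r. clinear_on UNIV (E r)) \<and>
     (\<forall>r u w. cinner (E r u) w = cinner u (E r w)) \<and>
     (\<forall>r s u. E r (E s u) = E (min r s) u) \<and>
     (\<forall>r u. ((\<lambda>s. E s u) \<longlongrightarrow> E r u) (at_right r)) \<and>
     (\<forall>r<0. \<forall>u. E r u = 0) \<and>
     (\<forall>u. ((\<lambda>r. E r u) \<longlongrightarrow> u) at_top)"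

text \<open>The measure \<open>d(\<parallel>E\<^sub>\<rho> u\<parallel>\<^sup>2)\<close>. It charges \<open>{0}\<close> if \<open>E\<^sub>0 u \<noteq> 0\<close>.\<close>

definition spectral_measure :: "(real \<Rightarrow> 'a::complex_hilbert \<Rightarrow> 'a) \<Rightarrow> 'a \<Rightarrow> real measure" where
  "spectral_measure E u = interval_measure (\<lambda>\<rho>. (norm (E \<rho> u))\<^sup>2)"

definition calc_dom :: "(real \<Rightarrow> 'a::complex_hilbert \<Rightarrow> 'a) \<Rightarrow> (real \<Rightarrow> real) \<Rightarrow> 'a set" where
  "calc_dom E f = {u. integrable (spectral_measure E u) (\<lambda>\<rho>. (f \<rho>)\<^sup>2)}"

text \<open>\<open>\<integral> f(\<rho>) d\<langle>E\<^sub>\<rho> u, w\<rangle>\<close> by polarization; meaningful for \<open>u\<close> and \<open>w\<close> in \<open>calc_dom E f\<close>.\<close>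

definition calc_form ::
  "(real \<Rightarrow> 'a::complex_hilbert \<Rightarrow> 'a) \<Rightarrow> (real \<Rightarrow> real) \<Rightarrow> 'a \<Rightarrow> 'a \<Rightarrow> complex" where
  "calc_form E f u w =
     (1 / 4) * (\<Sum>k<4. \<i> ^ k * complex_of_real
        (integral\<^sup>L (spectral_measure E (u + \<i> ^ k *\<^sub>C w)) f))"

text \<open>
  The operator \<open>\<integral> f dE\<^sub>\<rho>\<close> with domain \<open>calc_dom E f\<close>. Testing against \<open>w\<close> in \<open>calc_dom E f\<close>
  determines the value, since that subspace is dense for continuous \<open>f\<close>.
\<close>

definition spectral_calc ::
  "(real \<Rightarrow> 'a::complex_hilbert \<Rightarrow> 'a) \<Rightarrow> (real \<Rightarrow> real) \<Rightarrow> 'a \<Rightarrow> 'a" where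
  "spectral_calc E f u = (THE v. \<forall>w\<in>calc_dom E f. cinner v w = calc_form E f u w)"

text \<open>\<open>P = \<integral> \<rho>\<^sup>2 dE\<^sub>\<rho>\<close>, including equality of domains.\<close>

definition spectral_resolution ::
  "'a::complex_hilbert set \<Rightarrow> ('a \<Rightarrow> 'a) \<Rightarrow> (real \<Rightarrow> 'a \<Rightarrow> 'a) \<Rightarrow> bool" where
  "spectral_resolution D P E \<longleftrightarrow> spectral_family E \<and> D = calc_dom E (\<lambda>\<rho>. \<rho>\<^sup>2)
     \<and> (\<forall>u\<in>D. P u = spectral_calc E (\<lambda>\<rho>. \<rho>\<^sup>2) u)"

section \<open>The scale of spaces\<close>

definition Lambda_pow :: "(real \<Rightarrow> 'a::complex_hilbert \<Rightarrow> 'a) \<Rightarrow> real \<Rightarrow> 'a \<Rightarrow> 'a" where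
  "Lambda_pow E s = spectral_calc E (\<lambda>\<rho>. (1 + \<rho>\<^sup>2) powr s)"

text \<open>
  \<open>Hs E s\<close> is the space \<open>H\<^sub>s\<close> for \<open>s \<ge> 0\<close> only. The spaces of negative order do not consist of
  elements of \<open>H\<close>: \<open>H\<^sub>-\<^sub>s\<close> is the antidual \<open>Hs_dual E s\<close> of \<open>H\<^sub>s\<close>, in which \<open>h \<in> H\<close> is the functional
  \<open>w \<mapsto> \<langle>h, w\<rangle>\<close>. Functionals are extended by \<open>0\<close> outside \<open>H\<^sub>s\<close>.
\<close>

definition Hs :: "(real \<Rightarrow> 'a::complex_hilbert \<Rightarrow> 'a) \<Rightarrow> real \<Rightarrow> 'a set" where
  "Hs E s = range (Lambda_pow E (- s))"

definition Hs_norm :: "(real \<Rightarrow> 'a::complex_hilbert \<Rightarrow> 'a) \<Rightarrow> real \<Rightarrow> 'a \<Rightarrow> real" where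
  "Hs_norm E s u = norm (Lambda_pow E s u)"

definition Hs_dual :: "(real \<Rightarrow> 'a::complex_hilbert \<Rightarrow> 'a) \<Rightarrow> real \<Rightarrow> ('a \<Rightarrow> complex) set" where
  "Hs_dual E s = {f. (\<forall>w. w \<notin> Hs E s \<longrightarrow> f w = 0)
     \<and> (\<forall>w\<in>Hs E s. \<forall>z\<in>Hs E s. f (w + z) = f w + f z)
     \<and> (\<forall>a. \<forall>w\<in>Hs E s. f (a *\<^sub>C w) = cnj a * f w)
     \<and> (\<exists>C. \<forall>w\<in>Hs E s. cmod (f w) \<le> C * Hs_norm E s w)}"

definition Hs_dual_norm ::
  "(real \<Rightarrow> 'a::complex_hilbert \<Rightarrow> 'a) \<Rightarrow> real \<Rightarrow> ('a \<Rightarrow> complex) \<Rightarrow> real" where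
  "Hs_dual_norm E s f = Sup {cmod (f w) |w. w \<in> Hs E s \<and> Hs_norm E s w \<le> 1}"

definition embed_dual ::
  "(real \<Rightarrow> 'a::complex_hilbert \<Rightarrow> 'a) \<Rightarrow> real \<Rightarrow> 'a \<Rightarrow> 'a \<Rightarrow> complex" where
  "embed_dual E s h = (\<lambda>w. if w \<in> Hs E s then cinner h w else 0)"

text \<open>The inclusion of \<open>H\<^sub>-\<^sub>r\<close> into \<open>H\<^sub>-\<^sub>s\<close> for \<open>r \<le> s\<close>.\<close>

definition restrict_dual ::
  "(real \<Rightarrow> 'a::complex_hilbert \<Rightarrow> 'a) \<Rightarrow> real \<Rightarrow> ('a \<Rightarrow> complex) \<Rightarrow> 'a \<Rightarrow> complex" where
  "restrict_dual E s f = (\<lambda>w. if w \<in> Hs E s then f w else 0)"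

definition dual_in_H ::
  "(real \<Rightarrow> 'a::complex_hilbert \<Rightarrow> 'a) \<Rightarrow> real \<Rightarrow> ('a \<Rightarrow> complex) \<Rightarrow> bool" where
  "dual_in_H E s f \<longleftrightarrow> (\<exists>h. f = embed_dual E s h)"

definition dual_to_H ::
  "(real \<Rightarrow> 'a::complex_hilbert \<Rightarrow> 'a) \<Rightarrow> real \<Rightarrow> ('a \<Rightarrow> complex) \<Rightarrow> 'a" where
  "dual_to_H E s f = (THE h. f = embed_dual E s h)"

definition dual_H_norm ::
  "(real \<Rightarrow> 'a::complex_hilbert \<Rightarrow> 'a) \<Rightarrow> real \<Rightarrow> ('a \<Rightarrow> complex) \<Rightarrow> ennreal" where
  "dual_H_norm E s f = (if dual_in_H E s f then ennreal (norm (dual_to_H E s f)) else \<infinity>)"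

text \<open>The extension \<open>P : H\<^sub>1\<^sub>/\<^sub>2 \<rightarrow> H\<^sub>-\<^sub>1\<^sub>/\<^sub>2\<close> by continuity from \<open>H\<^sub>1\<close>.\<close>

definition P_ext ::
  "(real \<Rightarrow> 'a::complex_hilbert \<Rightarrow> 'a) \<Rightarrow> ('a \<Rightarrow> 'a) \<Rightarrow> 'a \<Rightarrow> 'a \<Rightarrow> complex" where
  "P_ext E P u = (THE f. f \<in> Hs_dual E (1/2) \<and>
     (\<forall>X. (\<forall>n. X n \<in> Hs E 1) \<longrightarrow> (\<lambda>n. Hs_norm E (1/2) (X n - u)) \<longlonglongrightarrow> 0 \<longrightarrow>
        (\<lambda>n. Hs_dual_norm E (1/2) (\<lambda>w. embed_dual E (1/2) (P (X n)) w - f w)) \<longlonglongrightarrow> 0))"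

section \<open>The damping operator and the generator\<close>

definition bounded_Hs ::
  "(real \<Rightarrow> 'a::complex_hilbert \<Rightarrow> 'a) \<Rightarrow> real \<Rightarrow> ('a \<Rightarrow> 'b::complex_hilbert) \<Rightarrow> bool" where
  "bounded_Hs E s Q \<longleftrightarrow> clinear_on (Hs E s) Q
     \<and> (\<exists>C. \<forall>u\<in>Hs E s. norm (Q u) \<le> C * Hs_norm E s u)"

text \<open>The adjoint \<open>Q\<^sup>* : Y \<rightarrow> H\<^sub>-\<^sub>s\<close> of \<open>Q : H\<^sub>s \<rightarrow> Y\<close>.\<close>

definition Q_adj ::
  "(real \<Rightarrow> 'a::complex_hilbert \<Rightarrow> 'a) \<Rightarrow> real \<Rightarrow> ('a \<Rightarrow> 'b::complex_hilbert) \<Rightarrow> 'b \<Rightarrow> 'a \<Rightarrow> complex"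
  where "Q_adj E s Q y = (\<lambda>w. if w \<in> Hs E s then cinner y (Q w) else 0)"

definition energy_space :: "(real \<Rightarrow> 'a::complex_hilbert \<Rightarrow> 'a) \<Rightarrow> ('a \<times> 'a) set" where
  "energy_space E = Hs E (1/2) \<times> UNIV"

definition energy_norm :: "(real \<Rightarrow> 'a::complex_hilbert \<Rightarrow> 'a) \<Rightarrow> 'a \<times> 'a \<Rightarrow> real" where
  "energy_norm E x = sqrt ((norm (Lambda_pow E (1/2) (fst x)))\<^sup>2 + (norm (snd x))\<^sup>2)"

text \<open>\<open>Pu + Q\<^sup>*Qv\<close> as an element of \<open>H\<^sub>-\<^sub>1\<^sub>/\<^sub>2\<close>.\<close>

definition damped_part ::
  "(real \<Rightarrow> 'a::complex_hilbert \<Rightarrow> 'a) \<Rightarrow> ('a \<Rightarrow> 'a) \<Rightarrow> real \<Rightarrow> ('a \<Rightarrow> 'b::complex_hilbert)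
     \<Rightarrow> 'a \<Rightarrow> 'a \<Rightarrow> 'a \<Rightarrow> complex" where
  "damped_part E P \<gamma> Q u v =
     (\<lambda>w. P_ext E P u w + restrict_dual E (1/2) (Q_adj E \<gamma> Q (Q v)) w)"

definition gen_dom ::
  "(real \<Rightarrow> 'a::complex_hilbert \<Rightarrow> 'a) \<Rightarrow> ('a \<Rightarrow> 'a) \<Rightarrow> real \<Rightarrow> ('a \<Rightarrow> 'b::complex_hilbert)
     \<Rightarrow> ('a \<times> 'a) set" where
  "gen_dom E P \<gamma> Q =
     {(u, v). u \<in> Hs E (1/2) \<and> v \<in> Hs E (1/2) \<and> dual_in_H E (1/2) (damped_part E P \<gamma> Q u v)}"

definition gen ::
  "(real \<Rightarrow> 'a::complex_hilbert \<Rightarrow> 'a) \<Rightarrow> ('a \<Rightarrow> 'a) \<Rightarrow> real \<Rightarrow> ('a \<Rightarrow> 'b::complex_hilbert)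
     \<Rightarrow> 'a \<times> 'a \<Rightarrow> 'a \<times> 'a" where
  "gen E P \<gamma> Q = (\<lambda>(u, v). (v, - dual_to_H E (1/2) (damped_part E P \<gamma> Q u v)))"

definition gen_shift ::
  "(real \<Rightarrow> 'a::complex_hilbert \<Rightarrow> 'a) \<Rightarrow> ('a \<Rightarrow> 'a) \<Rightarrow> real \<Rightarrow> ('a \<Rightarrow> 'b::complex_hilbert)
     \<Rightarrow> real \<Rightarrow> 'a \<times> 'a \<Rightarrow> 'a \<times> 'a" where
  "gen_shift E P \<gamma> Q l x =
     (fst (gen E P \<gamma> Q x) + (\<i> * complex_of_real l) *\<^sub>C fst x,
      snd (gen E P \<gamma> Q x) + (\<i> * complex_of_real l) *\<^sub>C snd x)"

definition gen_resolvent ::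
  "(real \<Rightarrow> 'a::complex_hilbert \<Rightarrow> 'a) \<Rightarrow> ('a \<Rightarrow> 'a) \<Rightarrow> real \<Rightarrow> ('a \<Rightarrow> 'b::complex_hilbert)
     \<Rightarrow> real \<Rightarrow> 'a \<times> 'a \<Rightarrow> 'a \<times> 'a" where
  "gen_resolvent E P \<gamma> Q l = inv_into (gen_dom E P \<gamma> Q) (gen_shift E P \<gamma> Q l)"

text \<open>\<open>A + i l\<close> is a bijection of its domain onto the energy space, with bounded inverse.\<close>

definition gen_invertible ::
  "(real \<Rightarrow> 'a::complex_hilbert \<Rightarrow> 'a) \<Rightarrow> ('a \<Rightarrow> 'a) \<Rightarrow> real \<Rightarrow> ('a \<Rightarrow> 'b::complex_hilbert)
     \<Rightarrow> real \<Rightarrow> bool" where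
  "gen_invertible E P \<gamma> Q l \<longleftrightarrow>
     bij_betw (gen_shift E P \<gamma> Q l) (gen_dom E P \<gamma> Q) (energy_space E) \<and>
     (\<exists>B. \<forall>x\<in>energy_space E. energy_norm E (gen_resolvent E P \<gamma> Q l x) \<le> B * energy_norm E x)"

definition energy_opnorm ::
  "(real \<Rightarrow> 'a::complex_hilbert \<Rightarrow> 'a) \<Rightarrow> ('a \<times> 'a \<Rightarrow> 'a \<times> 'a) \<Rightarrow> real" where
  "energy_opnorm E T = Sup {energy_norm E (T x) |x. x \<in> energy_space E \<and> energy_norm E x \<le> 1}"

section \<open>The control estimate\<close>

definition japanese :: "real \<Rightarrow> real" where
  "japanese l = sqrt (1 + l\<^sup>2)"

definition control_estimate ::
  "(real \<Rightarrow> 'a::complex_hilbert \<Rightarrow> 'a) \<Rightarrow> ('a \<Rightarrow> 'a) \<Rightarrow> real \<Rightarrow> ('a \<Rightarrow> 'b::complex_hilbert)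
     \<Rightarrow> real \<Rightarrow> real \<Rightarrow> real \<Rightarrow> real \<Rightarrow> (real \<Rightarrow> real) \<Rightarrow> (real \<Rightarrow> real) \<Rightarrow> bool" where
  "control_estimate E P \<gamma> Q \<mu> l0 N C M m \<longleftrightarrow>
     (\<forall>u\<in>Hs E (1 + \<mu> - \<gamma>). \<forall>l\<ge>l0.
        norm u \<le> M l * inverse (japanese l)
                   * norm (P (Lambda_pow E (\<mu> - \<gamma>) u) - l\<^sup>2 *\<^sub>R Lambda_pow E (\<mu> - \<gamma>) u)
                 + m l * norm (Q (Lambda_pow E \<mu> u))
                 + C * norm (Lambda_pow E (- N) u))"

definition gain_function :: "(real \<Rightarrow> real) \<Rightarrow> bool" where
  "gain_function M \<longleftrightarrow>
     continuous_on {0..} M \<and> (\<forall>x\<ge>0. 0 < M x) \<and> (\<exists>c>0. \<forall>x\<ge>0. c \<le> M x)"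

text \<open>\<open>(P - l\<^sup>2) v\<close> as an element of \<open>H\<^sub>-\<^sub>1\<^sub>/\<^sub>2\<close>, for \<open>v\<close> in \<open>H\<^sub>1\<^sub>/\<^sub>2\<close>.\<close>

definition P_ext_shift ::
  "(real \<Rightarrow> 'a::complex_hilbert \<Rightarrow> 'a) \<Rightarrow> ('a \<Rightarrow> 'a) \<Rightarrow> real \<Rightarrow> 'a \<Rightarrow> 'a \<Rightarrow> complex" where
  "P_ext_shift E P l v = (\<lambda>w. P_ext E P v w - complex_of_real (l\<^sup>2) * embed_dual E (1/2) v w)"

end

theory Submission
  imports Defs
begin

text \<open>
  Operators \<open>f(P)\<close> are strong limits of Riemann sums over the
  spectral family, so an inequality between functions of \<open>\<rho>\<close> becomes an inequality between the
  norms of \<open>f(P) x\<close>.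

  (1) Let \<open>(P - l\<^sup>2 - i l Q\<^sup>*Q) u = F \<in> H\<close>. Pairing with \<open>u\<close> gives \<open>\<bar>l\<bar> \<parallel>Q u\<parallel>\<^sup>2 \<le> \<parallel>F\<parallel> \<parallel>u\<parallel>\<close>. With
  \<open>x = \<Lambda>\<^sup>-\<^sup>\<gamma> u\<close>, the vector \<open>(P - l\<^sup>2) x\<close> has norm at most \<open>\<parallel>F\<parallel> + c \<bar>l\<bar> \<parallel>Q u\<parallel>\<close>, and the control estimate for
  \<open>\<Lambda>\<^sup>-\<^sup>\<mu> u\<close> bounds \<open>\<Lambda>\<^sup>-\<^sup>\<mu> u\<close>. Away from the frequency \<open>\<bar>l\<bar>\<close> the operator \<open>P - l\<^sup>2\<close> is elliptic, which absorbs the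
  error term and costs a factor \<open>\<bar>l\<bar> powr (2 \<mu>)\<close> in passing from \<open>\<Lambda>\<^sup>-\<^sup>\<mu> u\<close> to \<open>u\<close>. The bound holds for \<open>l\<close> and
  \<open>- l\<close>, that is, for the operator and its adjoint, hence both are invertible and duality gives the bound from
  \<open>H\<^sub>-\<^sub>1\<^sub>/\<^sub>2\<close> to \<open>H\<close> that controls the energy norm.

  (2) For \<open>v = \<Lambda>\<^sup>\<mu> u\<close> one solves \<open>(P - l\<^sup>2 - i l Q\<^sup>*Q) z = - v\<close> by the resolvent and pairs with \<open>v\<close>; the bounds of
  \<open>z\<close> in \<open>H\<close> and \<open>H\<^sub>1\<^sub>/\<^sub>2\<close> interpolate to one in \<open>H\<^sub>\<gamma>\<close>.
\<close>

section \<open>Complex Hilbert spaces\<close>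

text \<open>The values of \<open>spectral_calc\<close> and \<open>P_ext\<close> are given by
  descriptions, so nothing can be computed with them until one vector or functional is shown to be
  the only one that fits; for \<open>spectral_calc\<close> the candidates are limits of linear
  combinations of the projections \<open>E r\<close>. Since 1 + \<rho>^2 is of size l^2 at the
  frequency l, the power \<Lambda>^\<mu> costs |l|^(2 \<mu>) there. In part (1) the norm of u is
  bounded partly by that of Q u, and ||Q u||^2 by ||F|| ||u|| / |l|; eliminating ||Q u|| squares all
  factors, whence |l|^(4 \<mu>) and M^2 + m^2. Two gaps shape the argument. The term Q^* Q u lies
  only in H_(-\<gamma>), so u need not belong to H_1, and \<Lambda>^(-\<gamma>) has to be applied to
  the equation before the control estimate can be used. The data (f, g) of the resolvent produce P f
  in H_(-1/2), where the control estimate says nothing; a factor 1/l won by a change of the unknown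
  compensates for what the dual bound lacks.\<close>

lemma cinner_add_right: "cinner x (y + z) = cinner x y + cinner x z"
  by (metis cinner_add_left cinner_commute complex_cnj_add)

lemma cinner_scaleC_right: "cinner x (a *\<^sub>C y) = cnj a * cinner x y"
  by (metis cinner_commute cinner_scaleC_left complex_cnj_mult)

lemma scaleC_one [simp]: "1 *\<^sub>C x = x"
  using scaleR_scaleC[of 1 x] by simp

lemma scaleC_zero_left [simp]: "0 *\<^sub>C x = 0"
  using scaleR_scaleC[of 0 x] by simp

lemma scaleC_zero_right [simp]: "a *\<^sub>C 0 = 0"
  using scaleC_add_right[of a 0 0] by simp

lemma uminus_scaleC: "- x = (- 1) *\<^sub>C x"
  using scaleR_scaleC[of "-1" x] by simp

lemma scaleC_minus_left: "(- a) *\<^sub>C x = - (a *\<^sub>C x)"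
  by (simp add: uminus_scaleC[of "a *\<^sub>C x"] scaleC_scaleC)

lemma cinner_scaleR_left: "cinner (a *\<^sub>R x) y = a *\<^sub>R cinner x y"
  by (simp add: scaleR_scaleC cinner_scaleC_left scaleC_complex_def)

lemma cinner_scaleR_right: "cinner x (a *\<^sub>R y) = a *\<^sub>R cinner x y"
  by (simp add: scaleR_scaleC cinner_scaleC_right scaleC_complex_def)

lemma scaleC_scaleR: "a *\<^sub>C (r *\<^sub>R x) = r *\<^sub>R (a *\<^sub>C x)"
  by (simp add: scaleR_scaleC scaleC_scaleC mult.commute)

lemma cinner_self: "cinner x x = complex_of_real ((norm x)\<^sup>2)"
proof -
  have "Im (cinner x x) = 0"
    using cinner_commute[of x x] by (metis Im_complex_of_real Reals_cnj_iff Reals_cases)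
  moreover have "Re (cinner x x) = (norm x)\<^sup>2"
    by (simp add: inner_eq_Re_cinner[symmetric] power2_norm_eq_inner)
  ultimately show ?thesis by (simp add: complex_eq_iff)
qed

lemma norm_scaleC: "norm (a *\<^sub>C x) = cmod a * norm x"
proof -
  have "complex_of_real ((norm (a *\<^sub>C x))\<^sup>2) = complex_of_real ((cmod a * norm x)\<^sup>2)"
    using complex_norm_square[of a]
    by (simp add: cinner_self[symmetric] cinner_scaleC_left cinner_scaleC_right
        power_mult_distrib mult.assoc del: of_real_power)
  then have "(norm (a *\<^sub>C x))\<^sup>2 = (cmod a * norm x)\<^sup>2" by (simp only: of_real_eq_iff)
  then show ?thesis by simp
qed

lemma norm_cinner_le: "cmod (cinner x y) \<le> norm x * norm y"
proof (cases "cinner x y = 0")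
  case False
  \<comment> \<open>The phase that turns \<open>cinner x y\<close> into its modulus, so that the
    Cauchy-Schwarz inequality of the underlying real inner product applies.\<close>
  define a where "a = cnj (cinner x y) / complex_of_real (cmod (cinner x y))"
  have a: "cmod a = 1" using False by (simp add: a_def norm_divide)
  have "a * cinner x y = complex_of_real (cmod (cinner x y))"
    using False by (simp add: a_def complex_norm_square[symmetric] mult.commute power2_eq_square)
  then have "cmod (cinner x y) = inner (a *\<^sub>C x) y"
    by (simp add: inner_eq_Re_cinner cinner_scaleC_left)
  also have "\<dots> \<le> norm (a *\<^sub>C x) * norm y" by (rule norm_cauchy_schwarz)
  finally show ?thesis by (simp add: norm_scaleC a)
qed simp

lemma bounded_bilinear_cinner: "bounded_bilinear cinner"
proof
  show "\<exists>K. \<forall>a b. norm (cinner a b) \<le> norm a * norm b * K"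
    by (intro exI[of _ 1] allI) (simp add: norm_cinner_le)
qed (simp_all add: cinner_add_left cinner_add_right cinner_scaleR_left cinner_scaleR_right)

lemmas tendsto_cinner = bounded_bilinear.tendsto[OF bounded_bilinear_cinner]
lemmas cinner_zero_left [simp] = bounded_bilinear.zero_left[OF bounded_bilinear_cinner]
lemmas cinner_zero_right [simp] = bounded_bilinear.zero_right[OF bounded_bilinear_cinner]
lemmas cinner_diff_left = bounded_bilinear.diff_left[OF bounded_bilinear_cinner]
lemmas cinner_diff_right = bounded_bilinear.diff_right[OF bounded_bilinear_cinner]
lemmas cinner_minus_left = bounded_bilinear.minus_left[OF bounded_bilinear_cinner]

text \<open>Identifies vectors whose defining equations are known only for test vectors from a dense
  domain. The difference x - y is a limit of test vectors orthogonal to it, hence orthogonal to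
  itself.\<close>

lemma cinner_eq_dense:
  assumes "closure S = UNIV" and eq: "\<And>w. w \<in> S \<Longrightarrow> cinner x w = cinner y w"
  shows "x = y"
proof -
  have "x - y \<in> closure S" using assms by simp
  then obtain w where w: "\<And>n. w n \<in> S" "w \<longlonglongrightarrow> x - y" by (auto simp: closure_sequential)
  have "(\<lambda>n. cinner (x - y) (w n)) \<longlonglongrightarrow> cinner (x - y) (x - y)"
    by (intro tendsto_cinner tendsto_const w)
  moreover have "cinner (x - y) (w n) = 0" for n by (simp add: cinner_diff_left eq w)
  ultimately have "cinner (x - y) (x - y) = 0" by (simp add: LIMSEQ_const_iff)
  then show ?thesis by (simp add: cinner_self)
qed

lemma cinner_eqI: "(\<And>w. cinner x w = cinner y w) \<Longrightarrow> x = y"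
  using cinner_eq_dense[of UNIV x y] by simp

lemma cinner_eqI2: "(\<And>w. cinner w x = cinner w y) \<Longrightarrow> x = y"
  by (rule cinner_eqI) (metis cinner_commute)

lemma clinear_on_add: "clinear_on S T \<Longrightarrow> x \<in> S \<Longrightarrow> y \<in> S \<Longrightarrow> T (x + y) = T x + T y"
  by (simp add: clinear_on_def)

lemma clinear_on_scaleC: "clinear_on S T \<Longrightarrow> x \<in> S \<Longrightarrow> T (a *\<^sub>C x) = a *\<^sub>C T x"
  by (simp add: clinear_on_def)

lemma clinear_on_subspace: "clinear_on S T \<Longrightarrow> csubspace S"
  by (simp add: clinear_on_def)

lemma csubspace_add: "csubspace S \<Longrightarrow> x \<in> S \<Longrightarrow> y \<in> S \<Longrightarrow> x + y \<in> S"
  and csubspace_scaleC: "csubspace S \<Longrightarrow> x \<in> S \<Longrightarrow> a *\<^sub>C x \<in> S"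
  and csubspace_zero: "csubspace S \<Longrightarrow> 0 \<in> S"
  by (auto simp: csubspace_def)

lemma csubspace_scaleR: "csubspace S \<Longrightarrow> x \<in> S \<Longrightarrow> r *\<^sub>R x \<in> S"
  by (simp add: scaleR_scaleC csubspace_scaleC)

lemma csubspace_diff: "csubspace S \<Longrightarrow> x \<in> S \<Longrightarrow> y \<in> S \<Longrightarrow> x - y \<in> S"
  by (metis csubspace_add csubspace_scaleC diff_conv_add_uminus uminus_scaleC)

lemma csubspace_UNIV: "csubspace UNIV"
  by (simp add: csubspace_def)

lemma clinear_on_scaleR: "clinear_on S T \<Longrightarrow> x \<in> S \<Longrightarrow> T (r *\<^sub>R x) = r *\<^sub>R T x"
  by (simp add: scaleR_scaleC clinear_on_scaleC)

lemma clinear_on_diff: "clinear_on S T \<Longrightarrow> x \<in> S \<Longrightarrow> y \<in> S \<Longrightarrow> T (x - y) = T x - T y"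
  using clinear_on_add[of S T x "(-1) *\<^sub>R y"] clinear_on_scaleR[of S T y "-1"]
    csubspace_scaleR[of S y "-1"] clinear_on_subspace[of S T] by simp

lemma clinear_on_zero: "clinear_on S T \<Longrightarrow> T 0 = 0"
  by (metis clinear_on_scaleC clinear_on_subspace csubspace_zero scaleC_zero_left)

subsection \<open>Riesz representation and adjoints\<close>

text \<open>The representing vector is found as the minimiser of J x = ||x||^2 - 2 g x. The
  parallelogram identity bounds the distance of two points by the excess of J over its infimum, so
  minimising sequences are Cauchy; the vanishing first variation of J at the limit is the
  claim.\<close>

lemma riesz_real:
  fixes g :: "'a::{real_inner, complete_space} \<Rightarrow> real"
  assumes "bounded_linear g"
  shows "\<exists>z. \<forall>x. g x = inner x z"
proof -
  interpret bounded_linear g by fact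
  obtain K where K: "\<And>x. \<bar>g x\<bar> \<le> norm x * K" "K \<ge> 0" using nonneg_bounded by auto
  define J where "J x = (norm x)\<^sup>2 - 2 * g x" for x
  have Jlow: "- (K\<^sup>2) \<le> J x" for x
  proof -
    have "0 \<le> (norm x - K)\<^sup>2" by simp
    then show ?thesis using K(1)[of x] unfolding J_def power2_diff by (simp add: abs_le_iff)
  qed
  define d where "d = Inf (range J)"
  have bdd: "bdd_below (range J)" using Jlow by (auto intro!: bdd_belowI)
  have dle: "d \<le> J x" for x unfolding d_def by (intro cInf_lower bdd) auto
  have par: "(norm (x - y))\<^sup>2 \<le> 2 * (J x - d) + 2 * (J y - d)" for x y
  proof -
    have "(norm (x - y))\<^sup>2 = 2 * J x + 2 * J y - 4 * J ((1/2) *\<^sub>R (x + y))"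
      unfolding J_def
      by (simp add: power2_norm_eq_inner inner_add_left inner_add_right inner_diff_left
          inner_diff_right inner_commute add scale algebra_simps)
    then show ?thesis using dle[of "(1/2) *\<^sub>R (x + y)"] by simp
  qed
  have "\<exists>x. J x < d + 1 / Suc n" for n
    using cInf_lessD[of "range J" "d + 1 / Suc n"] by (auto simp: d_def)
  then obtain X where X: "\<And>n. J (X n) < d + 1 / Suc n" by metis
  have "Cauchy X"
  proof (rule metric_CauchyI)
    fix e :: real assume e: "0 < e"
    obtain M where "inverse (real (Suc M)) < e\<^sup>2 / 4"
      using reals_Archimedean[of "e\<^sup>2 / 4"] e by auto
    then have M: "4 * (1 / Suc M) < e\<^sup>2" by (simp add: inverse_eq_divide)
    show "\<exists>M. \<forall>m\<ge>M. \<forall>n\<ge>M. dist (X m) (X n) < e"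
    proof (intro exI allI impI)
      fix m n assume mn: "M \<le> m" "M \<le> n"
      have *: "1 / real (Suc k) \<le> 1 / real (Suc M)" if "M \<le> k" for k
        using that by (intro divide_left_mono) auto
      have "(norm (X m - X n))\<^sup>2 \<le> 4 * (1 / Suc M)"
      proof -
        have "J (X m) - d \<le> 1 / Suc M" "J (X n) - d \<le> 1 / Suc M"
          using X[of m] X[of n] *[OF mn(1)] *[OF mn(2)] by argo+
        then show ?thesis using par[of "X m" "X n"] by argo
      qed
      with M have "(norm (X m - X n))\<^sup>2 < e\<^sup>2" by simp
      then show "dist (X m) (X n) < e"
        using e by (simp add: dist_norm power_less_imp_less_base)
    qed
  qed
  then obtain z where z: "X \<longlonglongrightarrow> z" using Cauchy_convergent_iff convergent_def by blast
  have "(\<lambda>n. J (X n)) \<longlonglongrightarrow> J z"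
    unfolding J_def by (intro tendsto_intros tendsto z)
  moreover have "(\<lambda>n. J (X n)) \<longlonglongrightarrow> d"
  proof (rule tendsto_sandwich[where f = "\<lambda>_. d" and h = "\<lambda>n. d + 1 / real (Suc n)"])
    show "(\<lambda>n. d + 1 / real (Suc n)) \<longlonglongrightarrow> d"
      using tendsto_add[OF tendsto_const[of d] LIMSEQ_inverse_real_of_nat]
      by (simp add: inverse_eq_divide)
    show "\<forall>\<^sub>F n in sequentially. J (X n) \<le> d + 1 / real (Suc n)" using X by (simp add: less_imp_le)
  qed (use dle in auto)
  ultimately have Jz: "J z = d" by (rule LIMSEQ_unique)
  have "g x = inner x z" for x
  proof -
    define b where "b = inner x z - g x"
    have "0 \<le> J (z + t *\<^sub>R x) - J z" for t using dle Jz by simp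
    moreover have "J (z + t *\<^sub>R x) - J z = 2 * t * b + t\<^sup>2 * (norm x)\<^sup>2" for t
      unfolding J_def b_def power2_norm_eq_inner
      by (simp add: inner_add_left inner_add_right inner_commute add scale
          algebra_simps power2_eq_square)
    ultimately have *: "0 \<le> 2 * t * b + t\<^sup>2 * (norm x)\<^sup>2" for t by metis
    \<comment> \<open>The increment t = - b / ||x||^2 would minimise the quadratic polynomial in t;
      the 1 added to the denominator covers x = 0.\<close>
    define N where "N = (norm x)\<^sup>2 + 1"
    have N: "N > 0" "(norm x)\<^sup>2 \<le> N" unfolding N_def by (auto intro: add_nonneg_pos)
    have "(- b / N)\<^sup>2 * (norm x)\<^sup>2 \<le> (- b / N)\<^sup>2 * N"
      by (rule mult_left_mono[OF N(2)]) simp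
    also have "\<dots> = b * b / N" using N(1) by (simp add: power2_eq_square)
    finally have "0 \<le> 2 * (- b / N) * b + b * b / N"
      using *[of "- b / N"] by linarith
    also have "\<dots> = - (b * b / N)" by simp
    finally have "b * b \<le> 0" using N(1) by (simp add: divide_le_0_iff)
    then have "b = 0" using zero_le_square[of b] by (metis antisym mult_eq_0_iff)
    then show ?thesis by (simp add: b_def)
  qed
  then show ?thesis by blast
qed

lemma adjoint_exists:
  fixes T :: "'a::complex_hilbert \<Rightarrow> 'b::complex_hilbert"
  assumes T: "clinear_on UNIV T" and b: "\<And>x. norm (T x) \<le> C * norm x"
  shows "\<exists>T'. \<forall>x y. cinner (T x) y = cinner x (T' y)"
proof -
  have "\<exists>z. \<forall>x. cinner (T x) y = cinner x z" for y
  proof -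
    have "bounded_linear (\<lambda>x. inner (T x) y)"
    proof (rule bounded_linear_intro)
      show "norm (inner (T x) y) \<le> norm x * (C * norm y)" for x
        using Cauchy_Schwarz_ineq2[of "T x" y] mult_right_mono[OF b[of x], of "norm y"]
        by (simp add: mult_ac)
    qed (simp_all add: clinear_on_add[OF T] clinear_on_scaleR[OF T] inner_add_left)
    then obtain z where z: "\<And>x. inner (T x) y = inner x z" using riesz_real by metis
    have "cinner (T x) y = cinner x z" for x
    proof -
      \<comment> \<open>The real Riesz vector matches real parts only; testing with i x matches the
        imaginary parts.\<close>
      have "Re (\<i> * cinner (T x) y) = Re (\<i> * cinner x z)"
        using z[of "\<i> *\<^sub>C x"]
        by (simp only: inner_eq_Re_cinner cinner_scaleC_left clinear_on_scaleC[OF T] UNIV_I)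
      then show ?thesis using z[of x] by (simp add: complex_eq_iff inner_eq_Re_cinner)
    qed
    then show ?thesis by blast
  qed
  then show ?thesis by metis
qed

lemma adjoint_clinear:
  assumes "\<And>x y. cinner (T x) y = cinner x (T' y)"
  shows "clinear_on UNIV T'"
  unfolding clinear_on_def
proof (intro conjI ballI allI csubspace_UNIV)
  show "T' (x + y) = T' x + T' y" for x y
    by (rule cinner_eqI2) (simp only: cinner_add_right flip: assms)
  show "T' (a *\<^sub>C x) = a *\<^sub>C T' x" for a x
    by (rule cinner_eqI2) (simp only: cinner_scaleC_right flip: assms)
qed

lemma adjoint_bounded:
  assumes adj: "\<And>x y. cinner (T x) y = cinner x (T' y)" and b: "\<And>x. norm (T x) \<le> C * norm x"
    and C: "0 \<le> C"
  shows "norm (T' y) \<le> C * norm y"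
proof (cases "T' y = 0")
  case True
  then show ?thesis using C by simp
next
  case False
  have "(norm (T' y))\<^sup>2 = cmod (cinner (T (T' y)) y)"
    by (simp only: adj cinner_self norm_of_real) simp
  also have "\<dots> \<le> norm (T (T' y)) * norm y" by (rule norm_cinner_le)
  also have "\<dots> \<le> C * norm (T' y) * norm y" by (intro mult_right_mono b) simp
  finally have "norm (T' y) * norm (T' y) \<le> norm (T' y) * (C * norm y)" 
    by (simp add: power2_eq_square mult_ac)
  then show ?thesis using False by simp
qed

text \<open>A bound from below for the adjoint makes \<open>A A'\<close> coercive, and then
  \<open>x \<mapsto> x - t (A A' x - y)\<close> is a contraction for small \<open>t > 0\<close>.\<close>

lemma surj_of_adjoint_bounded_below:
  fixes A :: "'a::complex_hilbert \<Rightarrow> 'a"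
  assumes adj: "\<And>x y. cinner (A x) y = cinner x (A' y)"
    and A: "clinear_on UNIV A" and b: "\<And>x. norm (A x) \<le> K * norm x" 
    and c: "c > 0" and lower: "\<And>x. c * norm x \<le> norm (A' x)"
  shows "\<exists>x. A x = y"
proof -
  define K' where "K' = max K 1"
  have K': "K' > 0" "norm (A x) \<le> K' * norm x" for x
    using b[of x] mult_right_mono[of K K' "norm x"] by (auto simp: K'_def)
  have A': "clinear_on UNIV A'" by (rule adjoint_clinear) (rule adj)
  define N where "N = (\<lambda>x. A (A' x))"
  \<comment> \<open>Bounds the norm of \<open>N\<close>; the summand c^2 guarantees c^2 \<le> L
    without comparing c with K', and this makes q nonnegative.\<close>
  define L where "L = K'\<^sup>2 + c\<^sup>2"
  have L: "L > 0" "c\<^sup>2 \<le> L" using K' by (auto simp: L_def intro: add_pos_nonneg)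
  have Nb: "norm (N x) \<le> L * norm x" for x
  proof -
    have "norm (N x) \<le> K' * (K' * norm x)" unfolding N_def
      by (rule order_trans[OF K'(2)]) (use K' in \<open>auto intro!: mult_left_mono adjoint_bounded[OF adj]\<close>)
    also have "\<dots> = K'\<^sup>2 * norm x" by (simp add: power2_eq_square)
    also have "\<dots> \<le> L * norm x" by (intro mult_right_mono) (simp_all add: L_def)
    finally show ?thesis .
  qed
  have Nc: "c\<^sup>2 * (norm x)\<^sup>2 \<le> inner (N x) x" for x
  proof -
    have "inner (N x) x = (norm (A' x))\<^sup>2"
      by (simp add: N_def inner_eq_Re_cinner adj cinner_self)
    moreover have "(c * norm x)\<^sup>2 \<le> (norm (A' x))\<^sup>2" using lower c by (intro power_mono) auto
    ultimately show ?thesis by (simp add: power_mult_distrib)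
  qed
  \<comment> \<open>Minimises 1 - 2 c^2 t + L^2 t^2, the bound for the squared contraction factor; q
    is the minimum.\<close>
  define t where "t = c\<^sup>2 / L\<^sup>2"
  have t: "t > 0" using c L by (simp add: t_def)
  define q where "q = 1 - c\<^sup>2 * t"
  have q: "0 \<le> q" "q < 1"
  proof -
    have "(c\<^sup>2)\<^sup>2 \<le> L\<^sup>2" using L by (intro power_mono) auto
    then show "0 \<le> q" using L by (simp add: q_def t_def power2_eq_square)
    show "q < 1" using t c by (simp add: q_def)
  qed
  define \<Phi> where "\<Phi> x = x - t *\<^sub>R (N x - y)" for x
  have "dist (\<Phi> u) (\<Phi> v) \<le> sqrt q * dist u v" for u v
  proof -
    define d where "d = u - v"
    have \<Phi>: "\<Phi> u - \<Phi> v = d - t *\<^sub>R N d"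
      by (simp add: \<Phi>_def d_def N_def clinear_on_diff[OF A] clinear_on_diff[OF A'] algebra_simps)
    have "(norm (\<Phi> u - \<Phi> v))\<^sup>2 = (norm d)\<^sup>2 - 2 * t * inner (N d) d + t\<^sup>2 * (norm (N d))\<^sup>2"
      unfolding power2_norm_eq_inner \<Phi>
      by (simp add: inner_diff_left inner_diff_right inner_commute power2_eq_square)
    also have "\<dots> \<le> (norm d)\<^sup>2 - 2 * t * (c\<^sup>2 * (norm d)\<^sup>2) + t\<^sup>2 * (L * norm d)\<^sup>2"
      using t Nc[of d] Nb[of d] by (intro add_mono diff_mono mult_left_mono power_mono) auto
    also have "\<dots> = (1 - 2 * (c\<^sup>2 * t) + t * (t * L\<^sup>2)) * (norm d)\<^sup>2"
      by algebra
    also have "t * L\<^sup>2 = c\<^sup>2" using L by (simp add: t_def)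
    also have "1 - 2 * (c\<^sup>2 * t) + t * c\<^sup>2 = q" by (simp add: q_def mult.commute)
    finally have "norm (\<Phi> u - \<Phi> v) \<le> sqrt (q * (norm d)\<^sup>2)" by (rule real_le_rsqrt)
    then show ?thesis by (simp add: dist_norm d_def real_sqrt_mult)
  qed
  then have "\<exists>!x. \<Phi> x = x" using q by (intro banach_fix_type[of "sqrt q"]) auto
  then obtain x where "\<Phi> x = x" by blast
  then have "N x = y" using t by (simp add: \<Phi>_def)
  then show ?thesis by (auto simp: N_def)
qed

section \<open>The functional calculus\<close>

text \<open>Couples a step function with the operator it defines, so that one induction treats both.
  It is a relation because a function has many representations; \<open>step_unique\<close> shows
  that they give the same operator.\<close>

inductive step_pair :: "(real \<Rightarrow> 'a::complex_hilbert \<Rightarrow> 'a) \<Rightarrow> (real \<Rightarrow> real) \<Rightarrow> ('a \<Rightarrow> 'a) \<Rightarrow> bool" for E where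
  step_zero: "step_pair E (\<lambda>_. 0) (\<lambda>_. 0)"
| step_insert: "step_pair E g G \<Longrightarrow>
    step_pair E (\<lambda>\<rho>. g \<rho> + c * indicator {..a} \<rho>) (\<lambda>u. G u + c *\<^sub>R E a u)"

locale spectral =
  fixes E :: "real \<Rightarrow> 'a::complex_hilbert \<Rightarrow> 'a"
  assumes spectral_family: "spectral_family E"
begin

lemma E_clinear: "clinear_on UNIV (E r)"
  and E_sym: "cinner (E r u) w = cinner u (E r w)"
  and E_comp: "E r (E s u) = E (min r s) u"
  and E_right: "((\<lambda>s. E s u) \<longlongrightarrow> E r u) (at_right r)"
  and E_neg: "r < 0 \<Longrightarrow> E r u = 0"
  and E_top: "((\<lambda>r. E r u) \<longlongrightarrow> u) at_top"
  using spectral_family by (auto simp: spectral_family_def)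

lemma cinner_E: "cinner (E r u) u = complex_of_real ((norm (E r u))\<^sup>2)"
  by (metis E_comp E_sym cinner_self min.idem)

lemma norm_E_le: "norm (E r u) \<le> norm u"
proof -
  have "(norm (E r u))\<^sup>2 = cmod (cinner (E r u) u)" by (simp only: cinner_E norm_of_real) simp
  also have "\<dots> \<le> norm (E r u) * norm u" by (rule norm_cinner_le)
  finally show ?thesis by (cases "E r u = 0") (auto simp: power2_eq_square)
qed

lemma norm_E_mono: "r \<le> s \<Longrightarrow> norm (E r u) \<le> norm (E s u)"
  using norm_E_le[of r "E s u"] by (simp add: E_comp min_def)

subsection \<open>The spectral measure\<close>

abbreviation mu :: "'a \<Rightarrow> real measure" where "mu \<equiv> spectral_measure E"

lemma sets_mu [simp, measurable_cong]: "sets (mu u) = sets borel"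
  and space_mu [simp]: "space (mu u) = UNIV"
  by (simp_all add: spectral_measure_def)

lemma emeasure_mu_Ioc: "a \<le> b \<Longrightarrow> emeasure (mu u) {a<..b} = (norm (E b u))\<^sup>2 - (norm (E a u))\<^sup>2"
  unfolding spectral_measure_def
proof (rule emeasure_interval_measure_Ioc)
  show "continuous (at_right a) (\<lambda>\<rho>. (norm (E \<rho> u))\<^sup>2)" for a
    unfolding continuous_within by (intro tendsto_intros E_right)
qed (auto intro: power_mono norm_E_mono)

lemma emeasure_mu_atMost: "emeasure (mu u) {..a} = (norm (E a u))\<^sup>2"
proof -
  \<comment> \<open>All left ends are negative, where E vanishes, so every interval in this
    increasing sequence has the same mass.\<close>
  have "(\<lambda>n. emeasure (mu u) {min a (- 1) - real n<..a}) \<longlonglongrightarrow> emeasure (mu u) (\<Union>n. {min a (- 1) - real n<..a})"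
  proof (rule Lim_emeasure_incseq)
    show "incseq (\<lambda>n. {min a (- 1) - real n<..a})" by (auto simp: incseq_def)
  qed auto
  moreover have "emeasure (mu u) {min a (- 1) - real n<..a} = (norm (E a u))\<^sup>2" for n
    by (subst emeasure_mu_Ioc) (auto simp: E_neg min_def)
  moreover have "(\<Union>n. {min a (- 1) - real n<..a}) = {..a}"
  proof -
    have "\<exists>n. min a (- 1) - real n < x" for x
      using reals_Archimedean2[of "min a (- 1) - x"] by (auto simp: algebra_simps)
    then show ?thesis by auto
  qed
  ultimately show ?thesis by (simp add: LIMSEQ_const_iff)
qed

lemma measure_mu_atMost: "measure (mu u) {..a} = (norm (E a u))\<^sup>2"
  by (simp add: measure_def emeasure_mu_atMost)

lemma emeasure_mu_UNIV_le: "emeasure (mu u) UNIV \<le> (norm u)\<^sup>2"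
proof -
  have "(\<lambda>n. emeasure (mu u) {..real n}) \<longlonglongrightarrow> emeasure (mu u) (\<Union>n. {..real n})"
    by (rule Lim_emeasure_incseq) (auto simp: incseq_def)
  moreover have "(\<Union>n. {..real n}) = UNIV" using real_arch_simple by auto
  ultimately show ?thesis
    by (auto intro!: LIMSEQ_le_const2 ennreal_leI power_mono norm_E_le simp: emeasure_mu_atMost)
qed

lemma finite_measure_mu: "finite_measure (mu u)"
  using emeasure_mu_UNIV_le[of u] by (intro finite_measureI) (auto simp: top_unique)

lemma measure_mu_UNIV_le: "measure (mu u) UNIV \<le> (norm u)\<^sup>2"
  using emeasure_mu_UNIV_le[of u] by (simp add: measure_def enn2real_leI)

text \<open>The negative axis is exhausted by half-lines that end at -1/(n+1). The half-line ending
  at 0 would not do, since 0 is an atom when \<open>E 0 u\<close> is not zero.\<close>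

lemma AE_mu_nonneg: "AE \<rho> in mu u. 0 \<le> \<rho>"
proof -
  have "emeasure (mu u) {..- (1 / real (Suc n))} = 0" for n
    by (simp add: emeasure_mu_atMost E_neg)
  then have "AE \<rho> in mu u. \<not> \<rho> \<le> - (1 / real (Suc n))" for n
    by (intro AE_I[where N = "{..- (1 / real (Suc n))}"]) auto
  then have "AE \<rho> in mu u. \<forall>n. \<not> \<rho> \<le> - (1 / real (Suc n))" by (simp add: AE_all_countable)
  then show ?thesis
  proof eventually_elim
    case (elim \<rho>)
    show ?case
    proof (rule ccontr)
      assume "\<not> 0 \<le> \<rho>"
      then obtain n where "inverse (real (Suc n)) < - \<rho>" using reals_Archimedean[of "- \<rho>"] by auto
      then show False using elim[rule_format, of n] by (simp add: inverse_eq_divide)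
    qed
  qed
qed

subsection \<open>Step functions\<close>

abbreviation step :: "(real \<Rightarrow> real) \<Rightarrow> ('a \<Rightarrow> 'a) \<Rightarrow> bool" where "step \<equiv> step_pair E"

lemma step_clinear: "step g G \<Longrightarrow> clinear_on UNIV G"
proof (induction rule: step_pair.induct)
  case (step_insert g G c a)
  then show ?case
    using E_clinear[of a]
    by (auto simp: clinear_on_def csubspace_UNIV scaleC_add_right scaleR_add_right scaleC_scaleR)
qed (simp add: clinear_on_def csubspace_UNIV)

lemma step_sym: "step g G \<Longrightarrow> cinner (G u) w = cinner u (G w)"
  by (induction rule: step_pair.induct)
    (simp_all add: cinner_add_left cinner_add_right cinner_scaleR_left cinner_scaleR_right E_sym)

lemma step_measurable: "step g G \<Longrightarrow> g \<in> borel_measurable borel"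
  by (induction rule: step_pair.induct) auto

lemma step_bounded: "step g G \<Longrightarrow> \<exists>B. \<forall>\<rho>. \<bar>g \<rho>\<bar> \<le> B"
proof (induction rule: step_pair.induct)
  case (step_insert g G c a)
  then obtain B where B: "\<And>\<rho>. \<bar>g \<rho>\<bar> \<le> B" by blast
  have "\<bar>g \<rho> + c * indicator {..a} \<rho>\<bar> \<le> B + \<bar>c\<bar>" for \<rho>
    using B[of \<rho>] by (auto simp: indicator_def)
  then show ?case by blast
qed auto

lemma integrable_bounded:
  assumes "f \<in> borel_measurable borel" and "\<And>\<rho>::real. \<bar>f \<rho> :: real\<bar> \<le> B"
  shows "integrable (mu u) f"
  using assms finite_measure_mu[of u]
  by (intro finite_measure.integrable_const_bound[where B = B]) (auto cong: measurable_cong_sets)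

lemma step_integrable: "step g G \<Longrightarrow> integrable (mu u) g"
  using step_measurable step_bounded integrable_bounded by metis

lemma step_form: "step g G \<Longrightarrow> cinner (G u) u = complex_of_real (\<integral>\<rho>. g \<rho> \<partial>mu u)"
proof (induction rule: step_pair.induct)
  case (step_insert g G c a)
  have "integrable (mu u) (indicator {..a} :: real \<Rightarrow> real)"
    by (rule integrable_bounded[where B = 1]) (auto simp: indicator_def)
  then show ?case
    using step_insert step_integrable[of g G u]
    by (simp add: cinner_add_left cinner_scaleR_left cinner_E measure_mu_atMost scaleR_conv_of_real)
qed simp

lemma step_add: "step h K \<Longrightarrow> step g G \<Longrightarrow> step (\<lambda>\<rho>. g \<rho> + h \<rho>) (\<lambda>u. G u + K u)"
  by (induction rule: step_pair.induct) (auto simp: add.assoc[symmetric] intro: step_insert)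

lemma step_E: "step (indicator {..a}) (E a)"
  using step_insert[OF step_zero, of E 1 a] by simp

lemma step_scale: "step g G \<Longrightarrow> step (\<lambda>\<rho>. c * g \<rho>) (\<lambda>u. c *\<^sub>R G u)"
proof (induction rule: step_pair.induct)
  case (step_insert g G d a)
  from step_pair.step_insert[OF step_insert.IH, of "c * d" a]
  show ?case by (simp add: algebra_simps)
qed (auto intro: step_zero)

lemma step_diff: "step g G \<Longrightarrow> step h K \<Longrightarrow> step (\<lambda>\<rho>. g \<rho> - h \<rho>) (\<lambda>u. G u - K u)"
  using step_add[OF step_scale[of h K "-1"], of g G] by simp

text \<open>The source of multiplicativity: the product of the indicators of \<open>{..a}\<close>
  and \<open>{..b}\<close> is that of \<open>{..min a b}\<close>, and \<open>E_comp\<close> says the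
  same of the projections.\<close>

lemma step_cut: "step g G \<Longrightarrow> step (\<lambda>\<rho>. g \<rho> * indicator {..b} \<rho>) (\<lambda>u. G (E b u))"
proof (induction rule: step_pair.induct)
  case (step_insert g G c a)
  have "(\<lambda>\<rho>. (g \<rho> + c * indicator {..a} \<rho>) * indicator {..b} \<rho>)
    = (\<lambda>\<rho>. g \<rho> * indicator {..b} \<rho> + c * indicator {..min a b} \<rho>)"
    by (auto simp: indicator_def)
  then show ?case using step_pair.step_insert[OF step_insert.IH, of c "min a b"] by (simp add: E_comp)
qed (auto intro: step_zero)

lemma step_mult: "step h K \<Longrightarrow> step g G \<Longrightarrow> step (\<lambda>\<rho>. g \<rho> * h \<rho>) (\<lambda>u. G (K u))"
proof (induction rule: step_pair.induct)
  case step_zero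
  then show ?case by (simp add: clinear_on_zero[OF step_clinear] step_pair.step_zero)
next
  case (step_insert h K c a)
  have "step (\<lambda>\<rho>. g \<rho> * h \<rho> + c * (g \<rho> * indicator {..a} \<rho>)) (\<lambda>u. G (K u) + c *\<^sub>R G (E a u))"
    using step_insert by (intro step_add step_scale step_cut) auto
  then show ?case
    using clinear_on_add[OF step_clinear[OF step_insert.prems]]
      clinear_on_scaleR[OF step_clinear[OF step_insert.prems]]
    by (simp add: algebra_simps)
qed

lemma step_sum:
  assumes "finite I" and "\<And>i. i \<in> I \<Longrightarrow> step (g i) (G i)"
  shows "step (\<lambda>\<rho>. \<Sum>i\<in>I. g i \<rho>) (\<lambda>u. \<Sum>i\<in>I. G i u)"
  using assms
proof (induction rule: finite_induct)
  case (insert i I)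
  then show ?case using step_add[of "\<lambda>\<rho>. \<Sum>i\<in>I. g i \<rho>" "\<lambda>u. \<Sum>i\<in>I. G i u" "g i" "G i"] by simp
qed (auto intro: step_zero)

lemma step_square_integrable: "step g G \<Longrightarrow> integrable (mu u) (\<lambda>\<rho>. (g \<rho>)\<^sup>2)"
  using step_integrable[OF step_mult[of g G g G]] by (simp add: power2_eq_square)

lemma step_norm: "step g G \<Longrightarrow> (norm (G u))\<^sup>2 = (\<integral>\<rho>. (g \<rho>)\<^sup>2 \<partial>mu u)"
proof -
  assume s: "step g G"
  have "complex_of_real ((norm (G u))\<^sup>2) = cinner (G (G u)) u"
    by (simp only: cinner_self[symmetric] step_sym[OF s])
  also have "\<dots> = complex_of_real (\<integral>\<rho>. g \<rho> * g \<rho> \<partial>mu u)"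
    by (rule step_form[OF step_mult[OF s s]])
  finally show ?thesis by (simp only: of_real_eq_iff power2_eq_square)
qed

text \<open>All three squared norms are integrals against the same measure, which is why squares are
  compared. Two terms on the right suffice for multiplier estimates that split the frequencies into
  two regions.\<close>

lemma step_norm_le:
  assumes g: "step g G" and h: "step h H" and k: "step k K"
    and le: "\<And>\<rho>. 0 \<le> \<rho> \<Longrightarrow> (g \<rho>)\<^sup>2 \<le> A * (h \<rho>)\<^sup>2 + B * (k \<rho>)\<^sup>2"
  shows "(norm (G u))\<^sup>2 \<le> A * (norm (H u))\<^sup>2 + B * (norm (K u))\<^sup>2"
proof -
  have "(\<integral>\<rho>. (g \<rho>)\<^sup>2 \<partial>mu u) \<le> (\<integral>\<rho>. A * (h \<rho>)\<^sup>2 + B * (k \<rho>)\<^sup>2 \<partial>mu u)"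
    using AE_mu_nonneg[of u] le g h k
    by (intro integral_mono_AE) (auto intro!: step_square_integrable)
  also have "\<dots> = A * (\<integral>\<rho>. (h \<rho>)\<^sup>2 \<partial>mu u) + B * (\<integral>\<rho>. (k \<rho>)\<^sup>2 \<partial>mu u)"
    using h k by (subst Bochner_Integration.integral_add) (auto intro!: step_square_integrable)
  finally show ?thesis by (simp add: step_norm[OF g] step_norm[OF h] step_norm[OF k])
qed

lemma step_norm_bound:
  assumes g: "step g G" and b: "\<And>\<rho>. 0 \<le> \<rho> \<Longrightarrow> \<bar>g \<rho>\<bar> \<le> c" and c: "0 \<le> c"
  shows "norm (G u) \<le> c * norm u"
proof -
  have "(norm (G u))\<^sup>2 \<le> (\<integral>\<rho>. c\<^sup>2 \<partial>mu u)"
    unfolding step_norm[OF g]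
  proof (rule integral_mono_AE)
    show "AE \<rho> in mu u. (g \<rho>)\<^sup>2 \<le> c\<^sup>2"
      using AE_mu_nonneg[of u] by eventually_elim (use b c in \<open>simp add: abs_le_square_iff[symmetric]\<close>)
    show "integrable (mu u) (\<lambda>\<rho>. c\<^sup>2)"
      using finite_measure_mu by (intro finite_measure.integrable_const)
  qed (rule step_square_integrable[OF g])
  also have "\<dots> \<le> c\<^sup>2 * (norm u)\<^sup>2"
    using measure_mu_UNIV_le[of u] by (simp add: mult.commute mult_left_mono)
  finally have "(norm (G u))\<^sup>2 \<le> (c * norm u)\<^sup>2" by (simp add: power_mult_distrib)
  then show ?thesis by (rule power2_le_imp_le) (use c in simp)
qed

text \<open>The difference is a step function that vanishes for \<rho> \<ge> 0, so
  \<open>step_norm_bound\<close> applies to it with c = 0.\<close>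

lemma step_unique:
  assumes g: "step g G" and h: "step h H" and eq: "\<And>\<rho>. 0 \<le> \<rho> \<Longrightarrow> g \<rho> = h \<rho>"
  shows "G u = H u"
  using step_norm_bound[OF step_diff[OF g h], of 0 u] eq by simp


subsection \<open>Riemann sums\<close>

text \<open>Samples f at the right ends of cells of width 1/(n+1) that reach up to n+1. The cell
  with j = 0 lies left of 0 except for its right end; it is there to catch the mass at 0.\<close>

definition grid_fun :: "nat \<Rightarrow> (real \<Rightarrow> real) \<Rightarrow> real \<Rightarrow> real" where
  "grid_fun n f \<rho> = (\<Sum>j\<le>(Suc n)\<^sup>2. f (real j / Suc n) *
     (indicator {..real j / Suc n} \<rho> - indicator {..(real j - 1) / Suc n} \<rho>))"

definition grid_op :: "nat \<Rightarrow> (real \<Rightarrow> real) \<Rightarrow> 'a \<Rightarrow> 'a" where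
  "grid_op n f u = (\<Sum>j\<le>(Suc n)\<^sup>2. f (real j / Suc n) *\<^sub>R
     (E (real j / Suc n) u - E ((real j - 1) / Suc n) u))"

lemma step_grid: "step (grid_fun n f) (grid_op n f)"
  unfolding grid_fun_def[abs_def] grid_op_def[abs_def]
  by (intro step_sum step_scale step_diff step_E) simp

lemma grid_fun_eq:
  fixes \<rho> :: real
  assumes "0 \<le> \<rho>"
  shows "grid_fun n f \<rho> = (if \<rho> \<le> Suc n then f (of_int \<lceil>Suc n * \<rho>\<rceil> / Suc n) else 0)"
proof -
  define k where "k = nat \<lceil>Suc n * \<rho>\<rceil>"
  have k: "real k = of_int \<lceil>Suc n * \<rho>\<rceil>" using assms by (simp add: k_def)
  have ind: "indicator {..real j / Suc n} \<rho> - indicator {..(real j - 1) / Suc n} \<rho>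
      = (if j = k then 1 else (0::real))" for j
  proof -
    have "\<rho> \<le> real j / Suc n \<longleftrightarrow> Suc n * \<rho> \<le> real j" by (simp add: field_simps)
    also have "\<dots> \<longleftrightarrow> k \<le> j" unfolding k_def by (simp add: ceiling_le_iff nat_le_iff)
    finally have 1: "\<rho> \<le> real j / Suc n \<longleftrightarrow> k \<le> j" .
    have "\<rho> \<le> (real j - 1) / Suc n \<longleftrightarrow> Suc n * \<rho> \<le> real_of_int (int j - 1)"
      by (simp add: field_simps)
    also have "\<dots> \<longleftrightarrow> \<lceil>Suc n * \<rho>\<rceil> \<le> int j - 1" by (rule ceiling_le_iff[symmetric])
    also have "\<dots> \<longleftrightarrow> k < j"
    proof -
      have "0 \<le> real (Suc n) * \<rho>" using assms by simp
      then have "0 \<le> \<lceil>Suc n * \<rho>\<rceil>" using ceiling_mono[of 0 "real (Suc n) * \<rho>"] by linarith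
      then show ?thesis unfolding k_def nat_less_iff[OF \<open>0 \<le> \<lceil>Suc n * \<rho>\<rceil>\<close>] by linarith
    qed
    finally show ?thesis using 1 by (auto simp: indicator_def)
  qed
  have "grid_fun n f \<rho> = (\<Sum>j\<le>(Suc n)\<^sup>2. if j = k then f (real j / Suc n) else 0)"
    unfolding grid_fun_def ind by (intro sum.cong) auto
  also have "\<dots> = (if k \<le> (Suc n)\<^sup>2 then f (real k / Suc n) else 0)" by simp
  also have "k \<le> (Suc n)\<^sup>2 \<longleftrightarrow> \<rho> \<le> Suc n"
  proof -
    have "k \<le> (Suc n)\<^sup>2 \<longleftrightarrow> real (Suc n) * \<rho> \<le> real ((Suc n)\<^sup>2)"
      unfolding k_def nat_le_iff ceiling_le_iff by (simp only: of_int_of_nat_eq)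
    also have "real ((Suc n)\<^sup>2) = real (Suc n) * real (Suc n)" by (simp only: power2_eq_square of_nat_mult)
    also have "real (Suc n) * \<rho> \<le> real (Suc n) * real (Suc n) \<longleftrightarrow> \<rho> \<le> real (Suc n)"
      by (rule mult_le_cancel_left_pos) simp
    finally show ?thesis .
  qed
  finally show ?thesis by (simp add: k)
qed

lemma ceiling_grid:
  fixes \<rho> :: real
  assumes "0 \<le> \<rho>"
  shows "\<rho> \<le> of_int \<lceil>real (Suc n) * \<rho>\<rceil> / real (Suc n)"
    and "of_int \<lceil>real (Suc n) * \<rho>\<rceil> / real (Suc n) \<le> \<rho> + 1 / Suc n"
proof -
  have pos: "0 < real (Suc n)" by simp
  show "\<rho> \<le> of_int \<lceil>real (Suc n) * \<rho>\<rceil> / real (Suc n)"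
    unfolding le_divide_eq using pos le_of_int_ceiling[of "real (Suc n) * \<rho>"] by (simp add: mult.commute)
  have "\<rho> + 1 / Suc n = (real (Suc n) * \<rho> + 1) / real (Suc n)" using pos by (simp add: add_divide_distrib)
  then show "of_int \<lceil>real (Suc n) * \<rho>\<rceil> / real (Suc n) \<le> \<rho> + 1 / Suc n"
    using of_int_ceiling_le_add_one[of "real (Suc n) * \<rho>"] pos
    by (simp only:) (intro divide_right_mono, auto)
qed

text \<open>One sample point r serves all f at once. Therefore any pointwise identity or homogeneous
  inequality between several functions passes to their grid functions; beyond the grid everything is
  0.\<close>

lemma grid_fun_cases:
  fixes \<rho> :: real
  assumes "0 \<le> \<rho>"
  obtains r where "0 \<le> r" "\<rho> \<le> r" "\<And>f. grid_fun n f \<rho> = f r" | "\<And>f. grid_fun n f \<rho> = 0"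
proof (cases "\<rho> \<le> Suc n")
  case True
  then show thesis
    using that(1)[OF order_trans[OF assms ceiling_grid(1)[OF assms, of n]] ceiling_grid(1)[OF assms]] assms
    by (simp add: grid_fun_eq)
qed (use that(2) assms in \<open>simp add: grid_fun_eq\<close>)

text \<open>Sampling commutes with products, so the Riemann sums are multiplicative on a fixed grid
  without any error term.\<close>

lemma grid_op_mult: "grid_op n f (grid_op n g u) = grid_op n (\<lambda>\<rho>. f \<rho> * g \<rho>) u"
  by (rule step_unique[OF step_mult[OF step_grid step_grid] step_grid]) (simp add: grid_fun_eq)

lemma grid_op_clinear: "clinear_on UNIV (grid_op n f)"
  by (rule step_clinear[OF step_grid])

lemma grid_op_sym: "cinner (grid_op n f u) w = cinner u (grid_op n f w)"
  by (rule step_sym[OF step_grid])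

lemma grid_op_lin: "grid_op n (\<lambda>\<rho>. f \<rho> + c * g \<rho>) u = grid_op n f u + c *\<^sub>R grid_op n g u"
  by (rule step_unique[OF step_grid step_add[OF step_scale[OF step_grid] step_grid]])
    (simp add: grid_fun_eq)

lemma grid_op_one: "grid_op n (\<lambda>_. 1) u = E (Suc n) u"
  by (rule step_unique[OF step_grid step_E]) (simp add: grid_fun_eq)

lemma grid_op_one_tendsto: "(\<lambda>n. grid_op n (\<lambda>_. 1) u) \<longlonglongrightarrow> u"
proof -
  have "filterlim (\<lambda>n. real (Suc n)) at_top sequentially"
    by (rule filterlim_compose[OF filterlim_real_sequentially filterlim_Suc])
  then show ?thesis unfolding grid_op_one by (rule filterlim_compose[OF E_top])
qed

lemma grid_op_norm_bound:
  assumes "\<And>r. 0 \<le> r \<Longrightarrow> \<bar>f r\<bar> \<le> c" and "0 \<le> c"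
  shows "norm (grid_op n f u) \<le> c * norm u"
proof (rule step_norm_bound[OF step_grid])
  show "\<bar>grid_fun n f \<rho>\<bar> \<le> c" if "0 \<le> \<rho>" for \<rho>
    by (rule grid_fun_cases[OF that, of n]) (simp_all add: assms)
qed (rule assms)

lemma grid_op_norm_le:
  assumes "\<And>r. 0 \<le> r \<Longrightarrow> (f r)\<^sup>2 \<le> A * (g r)\<^sup>2 + B * (h r)\<^sup>2"
  shows "(norm (grid_op n f u))\<^sup>2 \<le> A * (norm (grid_op n g u))\<^sup>2 + B * (norm (grid_op n h u))\<^sup>2"
proof (rule step_norm_le[OF step_grid step_grid step_grid])
  show "(grid_fun n f \<rho>)\<^sup>2 \<le> A * (grid_fun n g \<rho>)\<^sup>2 + B * (grid_fun n h \<rho>)\<^sup>2" if "0 \<le> \<rho>" for \<rho>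
    by (rule grid_fun_cases[OF that, of n]) (simp_all add: assms)
qed

text \<open>The growth bound makes the grid functions of \<open>f\<close> dominated by \<open>f\<close> itself.\<close>

definition admissible :: "(real \<Rightarrow> real) \<Rightarrow> bool" where
  "admissible f \<longleftrightarrow> continuous_on UNIV f \<and>
     (\<exists>C\<ge>0. \<forall>r s. 0 \<le> r \<longrightarrow> r \<le> s \<longrightarrow> s \<le> r + 1 \<longrightarrow> \<bar>f s\<bar> \<le> C * (1 + \<bar>f r\<bar>))"

lemma admissible_measurable: "admissible f \<Longrightarrow> f \<in> borel_measurable borel"
  by (simp add: admissible_def borel_measurable_continuous_onI)

lemma grid_fun_tendsto:
  assumes f: "admissible f" and \<rho>: "0 \<le> \<rho>"
  shows "(\<lambda>n. grid_fun n f \<rho>) \<longlonglongrightarrow> f \<rho>"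
proof -
  have inv: "(\<lambda>n. 1 / real (Suc n)) \<longlonglongrightarrow> 0"
    using LIMSEQ_inverse_real_of_nat by (simp add: inverse_eq_divide)
  have "(\<lambda>n. of_int \<lceil>real (Suc n) * \<rho>\<rceil> / real (Suc n)) \<longlonglongrightarrow> \<rho>"
  proof (rule tendsto_sandwich[where f = "\<lambda>_. \<rho>" and h = "\<lambda>n. \<rho> + 1 / real (Suc n)"])
    show "(\<lambda>n. \<rho> + 1 / real (Suc n)) \<longlonglongrightarrow> \<rho>" using tendsto_add[OF tendsto_const inv, of \<rho>] by simp
  qed (use ceiling_grid[OF \<rho>] in \<open>auto simp del: of_nat_Suc\<close>)
  then have "(\<lambda>n. f (of_int \<lceil>real (Suc n) * \<rho>\<rceil> / real (Suc n))) \<longlonglongrightarrow> f \<rho>"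
    using f by (intro continuous_on_tendsto_compose[of UNIV f]) (auto simp: admissible_def)
  moreover have "\<forall>\<^sub>F n in sequentially. grid_fun n f \<rho> = f (of_int \<lceil>real (Suc n) * \<rho>\<rceil> / real (Suc n))"
    using eventually_ge_at_top[of "nat \<lceil>\<rho>\<rceil>"]
    by eventually_elim (use \<rho> in \<open>auto simp: grid_fun_eq nat_le_iff ceiling_le_iff\<close>)
  ultimately show ?thesis by (simp add: tendsto_cong)
qed

lemma grid_fun_bound:
  assumes "admissible f"
  obtains C where "0 \<le> C" "\<And>n \<rho>. 0 \<le> \<rho> \<Longrightarrow> \<bar>grid_fun n f \<rho>\<bar> \<le> C * (1 + \<bar>f \<rho>\<bar>)"
proof -
  obtain C where C: "0 \<le> C" "\<And>r s. 0 \<le> r \<Longrightarrow> r \<le> s \<Longrightarrow> s \<le> r + 1 \<Longrightarrow> \<bar>f s\<bar> \<le> C * (1 + \<bar>f r\<bar>)"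
    using assms by (auto simp: admissible_def)
  have "\<bar>grid_fun n f \<rho>\<bar> \<le> C * (1 + \<bar>f \<rho>\<bar>)" if \<rho>: "0 \<le> \<rho>" for n \<rho>
  proof -
    have "1 / real (Suc n) \<le> 1" by simp
    then have "of_int \<lceil>real (Suc n) * \<rho>\<rceil> / real (Suc n) \<le> \<rho> + 1"
      using ceiling_grid(2)[OF \<rho>, of n] by linarith
    then show ?thesis using C(2)[OF \<rho> ceiling_grid(1)[OF \<rho>, of n]] C(1) \<rho> by (simp add: grid_fun_eq)
  qed
  then show thesis using C(1) that by blast
qed

subsection \<open>Riemann sums converge to the functional calculus\<close>

lemma grid_L2_tendsto:
  assumes f: "admissible f" and u: "u \<in> calc_dom E f"
  shows "(\<lambda>n. \<integral>\<rho>. (grid_fun n f \<rho> - f \<rho>)\<^sup>2 \<partial>mu u) \<longlonglongrightarrow> 0"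
    and "integrable (mu u) (\<lambda>\<rho>. (grid_fun n f \<rho> - f \<rho>)\<^sup>2)"
proof -
  obtain C where C: "0 \<le> C" "\<And>n \<rho>. 0 \<le> \<rho> \<Longrightarrow> \<bar>grid_fun n f \<rho>\<bar> \<le> C * (1 + \<bar>f \<rho>\<bar>)"
    by (rule grid_fun_bound[OF f]) blast
  \<comment> \<open>The dominating function: (C (1 + |f|) + |f|)^2 \<le> (C + 1)^2 (1 + |f|)^2, and
    (1 + |f|)^2 \<le> 2 (1 + f^2).\<close>
  let ?w = "\<lambda>\<rho>. 2 * (C + 1)\<^sup>2 * (1 + (f \<rho>)\<^sup>2)"
  have w: "integrable (mu u) ?w"
    using u unfolding calc_dom_def
    by (intro integrable_mult_right Bochner_Integration.integrable_add
        finite_measure.integrable_const finite_measure_mu) simp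
  have "(grid_fun n f \<rho> - f \<rho>)\<^sup>2 \<le> ?w \<rho>" if "0 \<le> \<rho>" for n \<rho>
  proof -
    have "\<bar>grid_fun n f \<rho> - f \<rho>\<bar> \<le> C * (1 + \<bar>f \<rho>\<bar>) + \<bar>f \<rho>\<bar>" using C(2)[OF that, of n] by linarith
    also have "\<dots> \<le> (C + 1) * (1 + \<bar>f \<rho>\<bar>)" by (simp add: algebra_simps)
    finally have "(grid_fun n f \<rho> - f \<rho>)\<^sup>2 \<le> ((C + 1) * (1 + \<bar>f \<rho>\<bar>))\<^sup>2"
      using C(1) by (metis abs_le_square_iff abs_of_nonneg abs_ge_zero order_trans)
    also have "\<dots> \<le> (C + 1)\<^sup>2 * (2 * (1 + (f \<rho>)\<^sup>2))"
    proof -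
      have "(1 + \<bar>f \<rho>\<bar>)\<^sup>2 \<le> 2 * (1 + (f \<rho>)\<^sup>2)"
        using sum_squares_bound[of 1 "\<bar>f \<rho>\<bar>"] by (simp add: power2_sum)
      then show ?thesis unfolding power_mult_distrib by (intro mult_left_mono) auto
    qed
    finally show ?thesis by (simp only: mult_ac)
  qed
  then have bound: "AE \<rho> in mu u. norm ((grid_fun n f \<rho> - f \<rho>)\<^sup>2) \<le> ?w \<rho>" for n
    using AE_mu_nonneg[of u] by auto
  have meas: "(\<lambda>\<rho>. (grid_fun n f \<rho> - f \<rho>)\<^sup>2) \<in> borel_measurable (mu u)" for n
    using step_measurable[OF step_grid, of n f] admissible_measurable[OF f]
    by (simp cong: measurable_cong_sets)
  have lim: "AE \<rho> in mu u. (\<lambda>n. (grid_fun n f \<rho> - f \<rho>)\<^sup>2) \<longlonglongrightarrow> 0"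
    using AE_mu_nonneg[of u]
  proof eventually_elim
    case (elim \<rho>)
    from tendsto_power[OF tendsto_diff[OF grid_fun_tendsto[OF f elim] tendsto_const[of "f \<rho>"]], of 2]
    show ?case by simp
  qed
  show "(\<lambda>n. \<integral>\<rho>. (grid_fun n f \<rho> - f \<rho>)\<^sup>2 \<partial>mu u) \<longlonglongrightarrow> 0"
    using integral_dominated_convergence[OF _ meas w lim bound] by simp
  show "integrable (mu u) (\<lambda>\<rho>. (grid_fun n f \<rho> - f \<rho>)\<^sup>2)"
    by (rule Bochner_Integration.integrable_bound[OF w meas]) (use bound in auto)
qed

text \<open>By \<open>step_norm\<close> the distance of two Riemann sums is the L2 distance of their
  grid functions for the spectral measure of u, and these converge to f in L2.\<close>

lemma grid_op_convergent:
  assumes f: "admissible f" and u: "u \<in> calc_dom E f"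
  shows "convergent (\<lambda>n. grid_op n f u)"
proof -
  define a where "a n = (\<integral>\<rho>. (grid_fun n f \<rho> - f \<rho>)\<^sup>2 \<partial>mu u)" for n
  have a: "a \<longlonglongrightarrow> 0" unfolding a_def by (rule grid_L2_tendsto(1)[OF f u])
  have diff: "(norm (grid_op m f u - grid_op n f u))\<^sup>2 \<le> 2 * a m + 2 * a n" for m n
  proof -
    have "(norm (grid_op m f u - grid_op n f u))\<^sup>2 = (\<integral>\<rho>. (grid_fun m f \<rho> - grid_fun n f \<rho>)\<^sup>2 \<partial>mu u)"
      by (rule step_norm[OF step_diff[OF step_grid step_grid]])
    also have "\<dots> \<le> (\<integral>\<rho>. 2 * (grid_fun m f \<rho> - f \<rho>)\<^sup>2 + 2 * (grid_fun n f \<rho> - f \<rho>)\<^sup>2 \<partial>mu u)"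
    proof (rule integral_mono)
      show "integrable (mu u) (\<lambda>\<rho>. (grid_fun m f \<rho> - grid_fun n f \<rho>)\<^sup>2)"
        by (rule step_square_integrable[OF step_diff[OF step_grid step_grid]])
      show "(grid_fun m f \<rho> - grid_fun n f \<rho>)\<^sup>2 \<le> 2 * (grid_fun m f \<rho> - f \<rho>)\<^sup>2 + 2 * (grid_fun n f \<rho> - f \<rho>)\<^sup>2" for \<rho>
        using zero_le_power2[of "(grid_fun m f \<rho> - f \<rho>) + (grid_fun n f \<rho> - f \<rho>)"]
        by (simp add: power2_eq_square algebra_simps)
    qed (use grid_L2_tendsto(2)[OF f u] in auto)
    also have "\<dots> = 2 * a m + 2 * a n"
      unfolding a_def using grid_L2_tendsto(2)[OF f u] by simp
    finally show ?thesis .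
  qed
  have "Cauchy (\<lambda>n. grid_op n f u)"
  proof (rule metric_CauchyI)
    fix e :: real assume e: "0 < e"
    then obtain M where M: "\<And>n. n \<ge> M \<Longrightarrow> \<bar>a n\<bar> < e\<^sup>2 / 4"
      using LIMSEQ_D[OF a, of "e\<^sup>2 / 4"] by auto
    show "\<exists>M. \<forall>m\<ge>M. \<forall>n\<ge>M. dist (grid_op m f u) (grid_op n f u) < e"
    proof (intro exI allI impI)
      fix m n assume "M \<le> m" "M \<le> n"
      then have "(norm (grid_op m f u - grid_op n f u))\<^sup>2 < e\<^sup>2"
        using diff[of m n] M[of m] M[of n] by linarith
      then show "dist (grid_op m f u) (grid_op n f u) < e"
        using e by (simp add: dist_norm power_less_imp_less_base)
    qed
  qed
  then show ?thesis by (simp add: Cauchy_convergent_iff)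
qed

text \<open>Fatou's lemma: the squared norms of the Riemann sums are the integrals of the squared
  grid functions, and these functions converge to f pointwise.\<close>

lemma calc_dom_if_bounded:
  assumes f: "admissible f" and b: "\<And>n. norm (grid_op n f u) \<le> B"
  shows "u \<in> calc_dom E f"
proof -
  have meas [measurable]: "grid_fun n f \<in> borel_measurable borel" "f \<in> borel_measurable borel" for n
    by (rule step_measurable[OF step_grid]) (rule admissible_measurable[OF f])
  have "(\<integral>\<^sup>+\<rho>. ennreal ((f \<rho>)\<^sup>2) \<partial>mu u) = (\<integral>\<^sup>+\<rho>. liminf (\<lambda>n. ennreal ((grid_fun n f \<rho>)\<^sup>2)) \<partial>mu u)"
  proof (rule nn_integral_cong_AE)
    show "AE \<rho> in mu u. ennreal ((f \<rho>)\<^sup>2) = liminf (\<lambda>n. ennreal ((grid_fun n f \<rho>)\<^sup>2))"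
      using AE_mu_nonneg[of u]
    proof eventually_elim
      case (elim \<rho>)
      have "(\<lambda>n. ennreal ((grid_fun n f \<rho>)\<^sup>2)) \<longlonglongrightarrow> ennreal ((f \<rho>)\<^sup>2)"
        by (intro tendsto_ennrealI tendsto_power grid_fun_tendsto f elim)
      then show ?case by (simp add: lim_imp_Liminf[symmetric])
    qed
  qed
  also have "\<dots> \<le> liminf (\<lambda>n. \<integral>\<^sup>+\<rho>. ennreal ((grid_fun n f \<rho>)\<^sup>2) \<partial>mu u)"
    by (rule nn_integral_liminf) simp
  also have "\<dots> \<le> ennreal (B\<^sup>2)"
  proof (rule Liminf_le)
    have "(\<integral>\<^sup>+\<rho>. ennreal ((grid_fun n f \<rho>)\<^sup>2) \<partial>mu u) \<le> ennreal (B\<^sup>2)" for n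
      using power_mono[OF b[of n], of 2]
      by (subst nn_integral_eq_integral[OF step_square_integrable[OF step_grid]])
        (auto simp: step_norm[OF step_grid] intro: ennreal_leI)
    then show "\<forall>\<^sub>F n in sequentially. (\<integral>\<^sup>+\<rho>. ennreal ((grid_fun n f \<rho>)\<^sup>2) \<partial>mu u) \<le> ennreal (B\<^sup>2)" by simp
  qed simp
  finally have "(\<integral>\<^sup>+\<rho>. ennreal ((f \<rho>)\<^sup>2) \<partial>mu u) < \<infinity>"
    by (rule le_less_trans) simp
  then show ?thesis
    unfolding calc_dom_def by (auto intro!: integrableI_bounded)
qed

text \<open>The spectral measure does not depend linearly on u, so the definition of the domain does
  not show that it is a subspace; convergence of the linear Riemann sums does.\<close>

lemma calc_dom_iff:
  assumes f: "admissible f"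
  shows "u \<in> calc_dom E f \<longleftrightarrow> convergent (\<lambda>n. grid_op n f u)"
  using grid_op_convergent[OF f] calc_dom_if_bounded[OF f]
  by (metis BseqE convergent_imp_Bseq)

lemma calc_dom_subspace:
  assumes f: "admissible f"
  shows "csubspace (calc_dom E f)"
  unfolding csubspace_def
proof (intro conjI ballI allI)
  note l = grid_op_clinear[of _ f]
  show "0 \<in> calc_dom E f" by (simp add: calc_dom_iff[OF f] clinear_on_zero[OF l] convergent_const)
  show "x + y \<in> calc_dom E f" if "x \<in> calc_dom E f" "y \<in> calc_dom E f" for x y
    using that by (simp add: calc_dom_iff[OF f] clinear_on_add[OF l] convergent_add)
  show "a *\<^sub>C x \<in> calc_dom E f" if "x \<in> calc_dom E f" for a x
  proof -
    have "bounded_linear (\<lambda>v::'a. a *\<^sub>C v)"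
      by (rule bounded_linear_intro[where K = "cmod a"])
        (simp_all add: scaleC_add_right scaleC_scaleR norm_scaleC)
    with that show ?thesis
      by (auto simp: calc_dom_iff[OF f] clinear_on_scaleC[OF l] convergent_def
          intro: bounded_linear.tendsto)
  qed
qed

text \<open>The vectors \<open>E r u\<close> belong to the domain because f is bounded on the
  compact interval from 0 to r, and they tend to u.\<close>

lemma calc_dom_dense:
  assumes f: "admissible f"
  shows "closure (calc_dom E f) = UNIV"
proof -
  have "E r u \<in> calc_dom E f" for r u
  proof -
    obtain C where C: "0 \<le> C" "\<And>n \<rho>. 0 \<le> \<rho> \<Longrightarrow> \<bar>grid_fun n f \<rho>\<bar> \<le> C * (1 + \<bar>f \<rho>\<bar>)"
      by (rule grid_fun_bound[OF f]) blast
    have "compact (f ` {0..r})"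
      using f by (intro compact_continuous_image) (auto simp: admissible_def intro: continuous_on_subset)
    then obtain B where B: "\<And>\<rho>. \<rho> \<in> {0..r} \<Longrightarrow> \<bar>f \<rho>\<bar> \<le> B"
      using compact_imp_bounded bounded_iff by (metis image_eqI real_norm_def)
    define B' where "B' = max B 0"
    have B': "0 \<le> B'" "\<And>\<rho>. \<rho> \<in> {0..r} \<Longrightarrow> \<bar>f \<rho>\<bar> \<le> B'" using B by (auto simp: B'_def le_max_iff_disj)
    have "norm (grid_op n f (E r u)) \<le> (C * (1 + B')) * norm u" for n
    proof (rule step_norm_bound[OF step_cut[OF step_grid]])
      fix \<rho> :: real assume \<rho>: "0 \<le> \<rho>"
      show "\<bar>grid_fun n f \<rho> * indicator {..r} \<rho>\<bar> \<le> C * (1 + B')"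
      proof (cases "\<rho> \<le> r")
        case True
        then have "C * (1 + \<bar>f \<rho>\<bar>) \<le> C * (1 + B')" using C B' \<rho> by (intro mult_left_mono) auto
        then show ?thesis using C(2)[OF \<rho>, of n] True by simp
      qed (use C B' in simp)
    qed (use C B' in simp)
    then show ?thesis by (rule calc_dom_if_bounded[OF f])
  qed
  moreover have "(\<lambda>n. E (Suc n) u) \<longlonglongrightarrow> u" for u
    using grid_op_one_tendsto[of u] by (simp add: grid_op_one)
  ultimately have "u \<in> closure (calc_dom E f)" for u
    unfolding closure_sequential by (intro exI[of _ "\<lambda>n. E (Suc n) u"]) blast
  then show ?thesis by blast
qed

text \<open>Expanding in z = i^k leaves only the term with \<open>cnj z\<close>: the sums of z and
  of z^2 over the fourth roots of unity vanish, and that of z * cnj z is 4.\<close>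

lemma cinner_polarization_step:
  assumes s: "step g G"
  shows "(1 / 4) * (\<Sum>k<4. \<i> ^ k * complex_of_real (\<integral>\<rho>. g \<rho> \<partial>mu (u + \<i> ^ k *\<^sub>C w))) = cinner (G u) w"
proof -
  note l = step_clinear[OF s]
  have F: "complex_of_real (\<integral>\<rho>. g \<rho> \<partial>mu (u + z *\<^sub>C w))
      = cinner (G u) u + cnj z * cinner (G u) w + z * (cinner (G w) u + cnj z * cinner (G w) w)" for z
    unfolding step_form[OF s, symmetric]
    by (simp add: cinner_add_left cinner_add_right cinner_scaleC_left
        cinner_scaleC_right clinear_on_add[OF l] clinear_on_scaleC[OF l] distrib_left)
  have S: "(\<Sum>k<4. h k) = h 0 + h 1 + h 2 + h 3" for h :: "nat \<Rightarrow> complex"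
    by (simp add: numeral_eq_Suc)
  have i: "\<i> ^ 2 = - 1" "\<i> ^ 3 = - \<i>" by (simp_all add: power3_eq_cube)
  show ?thesis unfolding S F i by (simp add: algebra_simps)
qed

lemma calc_form_tendsto:
  assumes f: "admissible f" and u: "u \<in> calc_dom E f" and w: "w \<in> calc_dom E f"
  shows "(\<lambda>n. cinner (grid_op n f u) w) \<longlonglongrightarrow> calc_form E f u w"
proof -
  have int: "(\<lambda>n. \<integral>\<rho>. grid_fun n f \<rho> \<partial>mu y) \<longlonglongrightarrow> (\<integral>\<rho>. f \<rho> \<partial>mu y)" if y: "y \<in> calc_dom E f" for y
  proof -
    obtain C where C: "0 \<le> C" "\<And>n \<rho>. 0 \<le> \<rho> \<Longrightarrow> \<bar>grid_fun n f \<rho>\<bar> \<le> C * (1 + \<bar>f \<rho>\<bar>)"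
      by (rule grid_fun_bound[OF f]) blast
    let ?w = "\<lambda>\<rho>. C * (2 + (f \<rho>)\<^sup>2)"
    show ?thesis
    proof (rule integral_dominated_convergence[where w = ?w])
      show "integrable (mu y) ?w"
        using y unfolding calc_dom_def
        by (intro integrable_mult_right Bochner_Integration.integrable_add
            finite_measure.integrable_const finite_measure_mu) simp
      show "AE \<rho> in mu y. (\<lambda>n. grid_fun n f \<rho>) \<longlonglongrightarrow> f \<rho>"
        using AE_mu_nonneg[of y] by eventually_elim (rule grid_fun_tendsto[OF f])
      have le: "C * (1 + \<bar>f \<rho>\<bar>) \<le> ?w \<rho>" for \<rho>
      proof -
        have "\<bar>f \<rho>\<bar> \<le> 1 + (f \<rho>)\<^sup>2"
          using sum_squares_bound[of 1 "\<bar>f \<rho>\<bar>"] by simp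
        then show ?thesis using C(1) by (intro mult_left_mono) auto
      qed
      show "AE \<rho> in mu y. norm (grid_fun n f \<rho>) \<le> ?w \<rho>" for n
        using AE_mu_nonneg[of y]
      proof eventually_elim
        case (elim \<rho>)
        from C(2)[OF elim, of n] le[of \<rho>] show ?case by simp
      qed
    qed (use step_measurable[OF step_grid] admissible_measurable[OF f] in \<open>auto cong: measurable_cong_sets\<close>)
  qed
  note sub = calc_dom_subspace[OF f]
  have "(\<lambda>n. (1 / 4) * (\<Sum>k<4. \<i> ^ k * complex_of_real (\<integral>\<rho>. grid_fun n f \<rho> \<partial>mu (u + \<i> ^ k *\<^sub>C w))))
      \<longlonglongrightarrow> calc_form E f u w"
    unfolding calc_form_def
    by (intro tendsto_intros int csubspace_add[OF sub] csubspace_scaleC[OF sub] u w)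
  then show ?thesis by (simp only: cinner_polarization_step[OF step_grid])
qed

text \<open>The limit of the Riemann sums has the right inner product with every w in the domain. As
  the domain is dense, no other vector fits the description that defines
  \<open>spectral_calc\<close>.\<close>

lemma spectral_calc_tendsto:
  assumes f: "admissible f" and u: "u \<in> calc_dom E f"
  shows "(\<lambda>n. grid_op n f u) \<longlonglongrightarrow> spectral_calc E f u"
proof -
  obtain v where v: "(\<lambda>n. grid_op n f u) \<longlonglongrightarrow> v"
    using grid_op_convergent[OF f u] by (auto simp: convergent_def)
  have eq: "cinner v w = calc_form E f u w" if "w \<in> calc_dom E f" for w
    by (rule LIMSEQ_unique[OF tendsto_cinner[OF v tendsto_const] calc_form_tendsto[OF f u that]])
  have "spectral_calc E f u = v"
    unfolding spectral_calc_def
  proof (rule the_equality)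
    show "v' = v" if "\<forall>w\<in>calc_dom E f. cinner v' w = calc_form E f u w" for v'
      by (rule cinner_eq_dense[OF calc_dom_dense[OF f]]) (use that eq in auto)
  qed (use eq in auto)
  with v show ?thesis by simp
qed

lemma spectral_calcI:
  assumes f: "admissible f" and v: "(\<lambda>n. grid_op n f u) \<longlonglongrightarrow> v"
  shows "u \<in> calc_dom E f" and "spectral_calc E f u = v"
proof -
  show u: "u \<in> calc_dom E f" using v by (auto simp: calc_dom_iff[OF f] convergent_def)
  show "spectral_calc E f u = v" by (rule LIMSEQ_unique[OF spectral_calc_tendsto[OF f u] v])
qed

end

section \<open>The scale of spaces\<close>

definition weight :: "real \<Rightarrow> real \<Rightarrow> real" where
  "weight s \<rho> = (1 + \<rho>\<^sup>2) powr s"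

lemma one_plus_square_neq_0 [simp]: "1 + \<rho>\<^sup>2 \<noteq> (0::real)"
  using zero_le_power2[of \<rho>] by (metis add_pos_nonneg less_irrefl zero_less_one)

lemma weight_pos: "0 < weight s \<rho>"
  by (simp add: weight_def)

lemma weight_0 [simp]: "weight 0 = (\<lambda>_. 1)"
  by (auto simp: weight_def)

lemma weight_add: "weight (s + t) \<rho> = weight s \<rho> * weight t \<rho>"
  by (simp add: weight_def powr_add)

lemma weight_one: "weight 1 \<rho> = 1 + \<rho>\<^sup>2"
  by (simp add: weight_def)

lemma weight_le_1: "s \<le> 0 \<Longrightarrow> weight s \<rho> \<le> 1"
  using powr_mono[of s 0 "1 + \<rho>\<^sup>2"] by (simp add: weight_def)

lemma weight_mono_exponent: "s \<le> t \<Longrightarrow> weight s \<rho> \<le> weight t \<rho>"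
  by (simp add: weight_def powr_mono)

lemma weight_mono: "0 \<le> s \<Longrightarrow> 0 \<le> r \<Longrightarrow> r \<le> \<rho> \<Longrightarrow> weight s r \<le> weight s \<rho>"
  unfolding weight_def by (intro powr_mono2) (auto intro: power_mono add_pos_nonneg)

lemma weight_squared: "(weight s \<rho>)\<^sup>2 = (1 + \<rho>\<^sup>2) powr (2 * s)"
proof -
  have "2 * s = s + s" by simp
  then show ?thesis unfolding weight_def power2_eq_square powr_add[symmetric] by simp
qed

context spectral
begin

lemma admissible_weight: "admissible (weight t)"
  unfolding admissible_def
\<comment> \<open>For 0 \<le> r \<le> s \<le> r + 1 one has 1 + s^2 \<le> 3 (1 + r^2), whose power
  gives the constant.\<close>
proof (intro conjI exI[of _ "3 powr \<bar>t\<bar>"] allI impI)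
  show "continuous_on UNIV (weight t)"
    unfolding weight_def[abs_def] by (intro continuous_intros) simp
  show "0 \<le> 3 powr \<bar>t\<bar>" by simp
  fix r s :: real assume rs: "0 \<le> r" "r \<le> s" "s \<le> r + 1"
  have "weight t s \<le> 3 powr \<bar>t\<bar> * weight t r"
  proof (cases "0 \<le> t")
    case True
    have "s\<^sup>2 \<le> (r + 1)\<^sup>2" using rs by (intro power_mono) auto
    also have "\<dots> \<le> 2 * r\<^sup>2 + 2" using sum_squares_bound[of r 1] by (simp add: power2_sum)
    also have "\<dots> \<le> 3 * r\<^sup>2 + 2" by simp
    finally have "1 + s\<^sup>2 \<le> 3 * (1 + r\<^sup>2)" by simp
    then have "(1 + s\<^sup>2) powr t \<le> (3 * (1 + r\<^sup>2)) powr t"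
      using True by (intro powr_mono2) (auto intro: add_pos_nonneg)
    also have "\<dots> = 3 powr t * (1 + r\<^sup>2) powr t" by (rule powr_mult)
    finally show ?thesis using True by (simp add: weight_def)
  next
    case False
    have "(1 + s\<^sup>2) powr t \<le> (1 + r\<^sup>2) powr t"
      using rs False by (intro powr_mono2') (auto intro: add_pos_nonneg power_mono)
    also have "\<dots> \<le> 3 powr \<bar>t\<bar> * (1 + r\<^sup>2) powr t"
      using powr_mono[of 0 "\<bar>t\<bar>" 3] by simp
    finally show ?thesis by (simp add: weight_def)
  qed
  also have "\<dots> \<le> 3 powr \<bar>t\<bar> * (1 + \<bar>weight t r\<bar>)" by (intro mult_left_mono) auto
  finally show "\<bar>weight t s\<bar> \<le> 3 powr \<bar>t\<bar> * (1 + \<bar>weight t r\<bar>)"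
    using weight_pos[of t s] by simp
qed

abbreviation Lam :: "real \<Rightarrow> 'a \<Rightarrow> 'a" where "Lam \<equiv> Lambda_pow E"

text \<open>The domain of \<Lambda>^s for exponents of either sign: it is all of H for s \<le> 0 and
  agrees with \<open>Hs E s\<close> for s \<ge> 0, so mixed exponents need no case
  distinction.\<close>

definition dm :: "real \<Rightarrow> 'a set" where "dm s = calc_dom E (weight s)"

lemma Lam_eq: "Lam s = spectral_calc E (weight s)"
  unfolding Lambda_pow_def weight_def[abs_def] ..

lemma Lam_tendsto: "u \<in> dm s \<Longrightarrow> (\<lambda>n. grid_op n (weight s) u) \<longlonglongrightarrow> Lam s u"
  unfolding dm_def Lam_eq by (rule spectral_calc_tendsto[OF admissible_weight])

lemma LamI:
  assumes "(\<lambda>n. grid_op n (weight s) u) \<longlonglongrightarrow> v"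
  shows "u \<in> dm s" and "Lam s u = v"
  unfolding dm_def Lam_eq by (rule spectral_calcI[OF admissible_weight assms])+

lemma dm_if_bounded: "(\<And>n. norm (grid_op n (weight s) u) \<le> B) \<Longrightarrow> u \<in> dm s"
  unfolding dm_def by (rule calc_dom_if_bounded[OF admissible_weight])

lemma dm_grid_bounded:
  assumes "u \<in> dm s"
  obtains B where "\<And>n. norm (grid_op n (weight s) u) \<le> B"
  using Lam_tendsto[OF assms] by (metis BseqE convergentI convergent_imp_Bseq)

lemma dm_subspace: "csubspace (dm s)"
  unfolding dm_def by (rule calc_dom_subspace[OF admissible_weight])

lemma dm_dense: "closure (dm s) = UNIV"
  unfolding dm_def by (rule calc_dom_dense[OF admissible_weight])

lemma bounded_linear_scaleC: "bounded_linear (\<lambda>v::'a. a *\<^sub>C v)"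
  by (rule bounded_linear_intro[where K = "cmod a"])
    (simp_all add: scaleC_add_right scaleC_scaleR norm_scaleC)

lemma Lam_clinear: "clinear_on (dm s) (Lam s)"
  unfolding clinear_on_def
proof (intro conjI ballI allI dm_subspace)
  note l = grid_op_clinear[of _ "weight s"]
  show "Lam s (x + y) = Lam s x + Lam s y" if "x \<in> dm s" "y \<in> dm s" for x y
    using that by (intro LamI(2)) (simp add: clinear_on_add[OF l] tendsto_add Lam_tendsto)
  show "Lam s (a *\<^sub>C x) = a *\<^sub>C Lam s x" if "x \<in> dm s" for a x
    using that
    by (intro LamI(2)) (simp add: clinear_on_scaleC[OF l] bounded_linear.tendsto[OF bounded_linear_scaleC] Lam_tendsto)
qed

lemmas Lam_add = clinear_on_add[OF Lam_clinear]
lemmas Lam_diff = clinear_on_diff[OF Lam_clinear]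
lemmas Lam_scaleC = clinear_on_scaleC[OF Lam_clinear]
lemmas Lam_scaleR = clinear_on_scaleR[OF Lam_clinear]
lemmas Lam_zero = clinear_on_zero[OF Lam_clinear]
lemmas dm_zero = csubspace_zero[OF dm_subspace]
lemmas dm_add = csubspace_add[OF dm_subspace]
lemmas dm_diff = csubspace_diff[OF dm_subspace]
lemmas dm_scaleC = csubspace_scaleC[OF dm_subspace]

lemma Lam_sym: "u \<in> dm s \<Longrightarrow> w \<in> dm s \<Longrightarrow> cinner (Lam s u) w = cinner u (Lam s w)"
proof -
  assume u: "u \<in> dm s" and w: "w \<in> dm s"
  have "(\<lambda>n. cinner (grid_op n (weight s) u) w) \<longlonglongrightarrow> cinner (Lam s u) w"
    by (intro tendsto_cinner Lam_tendsto u tendsto_const)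
  moreover have "(\<lambda>n. cinner (grid_op n (weight s) u) w) \<longlonglongrightarrow> cinner u (Lam s w)"
    unfolding grid_op_sym by (intro tendsto_cinner Lam_tendsto w tendsto_const)
  ultimately show ?thesis by (rule LIMSEQ_unique)
qed

lemma grid_weight_nonpos: "s \<le> 0 \<Longrightarrow> norm (grid_op n (weight s) u) \<le> norm u"
  using grid_op_norm_bound[of "weight s" 1 n u] by (simp add: weight_le_1 weight_pos less_imp_le)

lemma dm_nonpos: "s \<le> 0 \<Longrightarrow> u \<in> dm s"
  by (rule dm_if_bounded[OF grid_weight_nonpos])

lemma norm_Lam_nonpos: "s \<le> 0 \<Longrightarrow> norm (Lam s u) \<le> norm u"
  by (rule Lim_bounded[OF tendsto_norm[OF Lam_tendsto[OF dm_nonpos]]]) (auto intro: grid_weight_nonpos)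

lemma Lam_clinear_UNIV: "s \<le> 0 \<Longrightarrow> clinear_on UNIV (Lam s)"
  using Lam_clinear[of s] dm_nonpos[of s] by (metis UNIV_eq_I)

lemma Lam_0 [simp]: "Lam 0 u = u"
  using grid_op_one_tendsto by (intro LamI(2)) simp

lemma grid_weight_mono:
  assumes "s \<le> t"
  shows "norm (grid_op n (weight s) u) \<le> norm (grid_op n (weight t) u)"
proof -
  have "(norm (grid_op n (weight s) u))\<^sup>2 \<le> 1 * (norm (grid_op n (weight t) u))\<^sup>2 + 0 * (norm (grid_op n (weight t) u))\<^sup>2"
    using weight_mono_exponent[OF assms] less_imp_le[OF weight_pos]
    by (intro grid_op_norm_le) (simp add: power_mono)
  then have "(norm (grid_op n (weight s) u))\<^sup>2 \<le> (norm (grid_op n (weight t) u))\<^sup>2" by simp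
  then show ?thesis by (rule power2_le_imp_le) simp
qed

lemma dm_mono: "u \<in> dm t \<Longrightarrow> s \<le> t \<Longrightarrow> u \<in> dm s"
  by (erule dm_grid_bounded) (blast intro: dm_if_bounded order_trans[OF grid_weight_mono])

lemma norm_Lam_mono: "u \<in> dm t \<Longrightarrow> s \<le> t \<Longrightarrow> norm (Lam s u) \<le> norm (Lam t u)"
  by (rule LIMSEQ_le[OF tendsto_norm[OF Lam_tendsto] tendsto_norm[OF Lam_tendsto]])
    (auto intro: dm_mono grid_weight_mono)

lemma norm_le_Lam: "u \<in> dm s \<Longrightarrow> 0 \<le> s \<Longrightarrow> norm u \<le> norm (Lam s u)"
  using norm_Lam_mono[of u s 0] by simp

text \<open>For s > 0 two grids occur: \<Lambda>^t u is a limit over m, and has to be bounded on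
  each grid n. The factor sampled on grid n is at most C (1 + \<open>weight s \<rho>\<close>), and
  \<open>\<rho> \<le> r\<close> and \<open>1 \<le> weight s r\<close> at the sample point r of grid
  m turn this into 2 C \<open>weight s r\<close>. The product is thus dominated by the weight of
  order s + t on grid m, uniformly in n.\<close>

lemma Lam_mem:
  assumes u: "u \<in> dm t" and u': "u \<in> dm (s + t)"
  shows "Lam t u \<in> dm s"
proof (cases "s \<le> 0")
  case False
  then have s: "0 \<le> s" by simp
  obtain B where B: "\<And>n. norm (grid_op n (weight (s + t)) u) \<le> B" by (rule dm_grid_bounded[OF u']) blast
  obtain C where C: "0 \<le> C" "\<And>n \<rho>. 0 \<le> \<rho> \<Longrightarrow> \<bar>grid_fun n (weight s) \<rho>\<bar> \<le> C * (1 + \<bar>weight s \<rho>\<bar>)"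
    by (rule grid_fun_bound[OF admissible_weight]) blast
  have le: "norm (grid_op n (weight s) (grid_op m (weight t) u)) \<le> 2 * C * B" for m n
  proof -
    have "(norm (grid_op n (weight s) (grid_op m (weight t) u)))\<^sup>2
      \<le> (2 * C)\<^sup>2 * (norm (grid_op m (weight (s + t)) u))\<^sup>2 + 0 * (norm (grid_op m (weight (s + t)) u))\<^sup>2"
    proof (rule step_norm_le[OF step_mult[OF step_grid step_grid] step_grid step_grid])
      fix \<rho> :: real assume \<rho>: "0 \<le> \<rho>"
      show "(grid_fun n (weight s) \<rho> * grid_fun m (weight t) \<rho>)\<^sup>2
        \<le> (2 * C)\<^sup>2 * (grid_fun m (weight (s + t)) \<rho>)\<^sup>2 + 0 * (grid_fun m (weight (s + t)) \<rho>)\<^sup>2"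
      proof (rule grid_fun_cases[OF \<rho>, of m])
        fix r assume r: "\<rho> \<le> r" "\<And>f. grid_fun m f \<rho> = f r"
        have "\<bar>grid_fun n (weight s) \<rho>\<bar> \<le> C * (1 + weight s \<rho>)"
          using C(2)[OF \<rho>, of n] weight_pos[of s \<rho>] by simp
        also have "\<dots> \<le> C * (2 * weight s r)"
          using weight_mono[OF s \<rho> r(1)] weight_mono_exponent[OF s, of r] C(1)
          by (intro mult_left_mono) auto
        finally have "\<bar>grid_fun n (weight s) \<rho>\<bar> * weight t r \<le> C * (2 * weight s r) * weight t r"
          using weight_pos[of t r] by (intro mult_right_mono) auto
        then have "\<bar>grid_fun n (weight s) \<rho> * weight t r\<bar> \<le> (2 * C) * weight (s + t) r"
          using weight_pos[of t r] by (simp add: abs_mult weight_add)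
        also have "\<dots> = \<bar>(2 * C) * weight (s + t) r\<bar>" using C(1) weight_pos[of "s + t" r] by simp
        finally show ?thesis 
          unfolding abs_le_square_iff r(2) by (simp add: power_mult_distrib)
      qed simp
    qed
    then have "(norm (grid_op n (weight s) (grid_op m (weight t) u)))\<^sup>2 \<le> (2 * C * norm (grid_op m (weight (s + t)) u))\<^sup>2"
      by (simp add: power_mult_distrib)
    then have "norm (grid_op n (weight s) (grid_op m (weight t) u)) \<le> 2 * C * norm (grid_op m (weight (s + t)) u)"
      by (rule power2_le_imp_le) (use C in simp)
    also have "\<dots> \<le> 2 * C * B" using B C(1) by (intro mult_left_mono) auto
    finally show ?thesis .
  qed
  have "norm (grid_op n (weight s) (Lam t u)) \<le> 2 * C * B" for n
  proof -
    have "(\<lambda>m. grid_op n (weight s) (grid_op m (weight t) u)) \<longlonglongrightarrow> grid_op n (weight s) (Lam t u)"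
    proof -
      have "bounded_linear (grid_op n (weight s))"
      proof -
        obtain b where b: "\<And>\<rho>. \<bar>grid_fun n (weight s) \<rho>\<bar> \<le> b" using step_bounded[OF step_grid] by metis
        then have "0 \<le> b" by (metis abs_ge_zero order_trans)
        then show ?thesis
          using step_norm_bound[OF step_grid b] clinear_on_add[OF grid_op_clinear] clinear_on_scaleR[OF grid_op_clinear]
          by (intro bounded_linear_intro[where K = b]) (auto simp: mult.commute)
      qed
      then show ?thesis by (rule bounded_linear.tendsto[OF _ Lam_tendsto[OF u]])
    qed
    then show ?thesis by (intro Lim_bounded[OF tendsto_norm]) (use le in auto)
  qed
  then show ?thesis by (rule dm_if_bounded)
qed (rule dm_nonpos)

text \<open>With \<Lambda>^s moved to the test vector, both factors are approximated on the same
  grid, where the product is exact; the double limit is avoided.\<close>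

lemma Lam_comp:
  assumes u: "u \<in> dm t" and u': "u \<in> dm (s + t)"
  shows "Lam s (Lam t u) = Lam (s + t) u"
proof (rule cinner_eq_dense[OF dm_dense])
  fix w assume w: "w \<in> dm s"
  have "(\<lambda>n. cinner (grid_op n (weight t) u) (grid_op n (weight s) w)) \<longlonglongrightarrow> cinner (Lam t u) (Lam s w)"
    by (intro tendsto_cinner Lam_tendsto u w)
  moreover have "cinner (grid_op n (weight t) u) (grid_op n (weight s) w) = cinner (grid_op n (weight (s + t)) u) w" for n
    unfolding grid_op_sym[symmetric] grid_op_mult weight_add ..
  moreover have "(\<lambda>n. cinner (grid_op n (weight (s + t)) u) w) \<longlonglongrightarrow> cinner (Lam (s + t) u) w"
    by (intro tendsto_cinner Lam_tendsto u' tendsto_const)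
  ultimately have "cinner (Lam t u) (Lam s w) = cinner (Lam (s + t) u) w"
    by (auto dest: LIMSEQ_unique)
  then show "cinner (Lam s (Lam t u)) w = cinner (Lam (s + t) u) w"
    by (simp add: Lam_sym[OF Lam_mem[OF u u'] w])
qed

text \<open>\<open>Lam_mem\<close> and \<open>Lam_comp\<close> in a form in which the exponents need not be matched syntactically.\<close>

lemma Lam_memI: "u \<in> dm t \<Longrightarrow> u \<in> dm r \<Longrightarrow> s + t = r \<Longrightarrow> Lam t u \<in> dm s"
  using Lam_mem by blast

lemma Lam_compI: "u \<in> dm t \<Longrightarrow> u \<in> dm r \<Longrightarrow> s + t = r \<Longrightarrow> Lam s (Lam t u) = Lam r u"
  using Lam_comp by blast

lemma Lam_inverse: "u \<in> dm s \<Longrightarrow> Lam (- s) (Lam s u) = u"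
  using Lam_compI[of u s 0 "- s"] dm_nonpos[of 0 u] by simp

lemma Lam_inverse': "u \<in> dm (- s) \<Longrightarrow> Lam s (Lam (- s) u) = u"
  using Lam_inverse[of u "- s"] by simp

lemma Lam_mem_inverse: "u \<in> dm (- s) \<Longrightarrow> Lam (- s) u \<in> dm s"
  using Lam_memI[of u "- s" 0 s] dm_nonpos[of 0 u] by simp

lemma Hs_eq: "0 \<le> s \<Longrightarrow> Hs E s = dm s"
proof -
  assume s: "0 \<le> s"
  have "u \<in> range (Lam (- s))" if "u \<in> dm s" for u
    using Lam_inverse[OF that] by (metis rangeI)
  moreover have "Lam (- s) x \<in> dm s" for x
    using s by (intro Lam_mem_inverse dm_nonpos) simp
  ultimately show ?thesis by (auto simp: Hs_def)
qed

text \<open>Redistributes the total order between the two arguments when one of them lacks the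
  regularity for a direct shift by symmetry.\<close>

lemma Lam_cinner_split:
  assumes "u \<in> dm a" "u \<in> dm b" "w \<in> dm c" "w \<in> dm d" "a + c = b + d"
  shows "cinner (Lam a u) (Lam c w) = cinner (Lam b u) (Lam d w)"
proof -
  have "(\<lambda>n. cinner (grid_op n (weight a) u) (grid_op n (weight c) w)) \<longlonglongrightarrow> cinner (Lam a u) (Lam c w)"
    by (intro tendsto_cinner Lam_tendsto assms)
  moreover have "(\<lambda>n. cinner (grid_op n (weight b) u) (grid_op n (weight d) w)) \<longlonglongrightarrow> cinner (Lam b u) (Lam d w)"
    by (intro tendsto_cinner Lam_tendsto assms)
  moreover have "cinner (grid_op n (weight a) u) (grid_op n (weight c) w) = cinner (grid_op n (weight b) u) (grid_op n (weight d) w)" for n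
  proof -
    have "weight c \<rho> * weight a \<rho> = weight d \<rho> * weight b \<rho>" for \<rho>
      using assms(5) by (metis add.commute weight_add)
    then show ?thesis unfolding grid_op_sym[of n _ _ "grid_op n _ w", symmetric] grid_op_sym[symmetric] grid_op_mult by simp
  qed
  ultimately show ?thesis by (auto dest: LIMSEQ_unique)
qed

subsection \<open>Multiplier inequalities\<close>

text \<open>The variable r stands for 1 + \<rho>^2, hence the range r \<ge> 1; the exponents are
  doubled because norms are squared.\<close>

lemma Lam_norm_le:
  assumes x: "x \<in> dm a" "x \<in> dm b" "x \<in> dm c"
    and le: "\<And>r. 1 \<le> r \<Longrightarrow> r powr (2 * a) \<le> A * r powr (2 * b) + B * r powr (2 * c)"
  shows "(norm (Lam a x))\<^sup>2 \<le> A * (norm (Lam b x))\<^sup>2 + B * (norm (Lam c x))\<^sup>2"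
proof (rule LIMSEQ_le)
  show "(\<lambda>n. (norm (grid_op n (weight a) x))\<^sup>2) \<longlonglongrightarrow> (norm (Lam a x))\<^sup>2"
    by (intro tendsto_intros Lam_tendsto x)
  show "(\<lambda>n. A * (norm (grid_op n (weight b) x))\<^sup>2 + B * (norm (grid_op n (weight c) x))\<^sup>2)
      \<longlonglongrightarrow> A * (norm (Lam b x))\<^sup>2 + B * (norm (Lam c x))\<^sup>2"
    by (intro tendsto_intros Lam_tendsto x)
  have "(norm (grid_op n (weight a) x))\<^sup>2
      \<le> A * (norm (grid_op n (weight b) x))\<^sup>2 + B * (norm (grid_op n (weight c) x))\<^sup>2" for n
    by (rule grid_op_norm_le) (use le in \<open>simp add: weight_squared\<close>)
  then show "\<exists>N. \<forall>n\<ge>N. (norm (grid_op n (weight a) x))\<^sup>2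
      \<le> A * (norm (grid_op n (weight b) x))\<^sup>2 + B * (norm (grid_op n (weight c) x))\<^sup>2" by blast
qed

text \<open>With r = 1 + \<rho>^2, the number r - 1 - l^2 is the multiplier of P - l^2.\<close>

lemma Lam_shift_norm_le:
  assumes x: "x \<in> dm a" "x \<in> dm b" "x \<in> dm 1"
    and le: "\<And>r. 1 \<le> r \<Longrightarrow> r powr (2 * a) \<le> A * r powr (2 * b) + B * (r - 1 - l\<^sup>2)\<^sup>2"
  shows "(norm (Lam a x))\<^sup>2 \<le> A * (norm (Lam b x))\<^sup>2 + B * (norm (Lam 1 x - (1 + l\<^sup>2) *\<^sub>R x))\<^sup>2"
proof (rule LIMSEQ_le)
  let ?h = "\<lambda>\<rho>. weight 1 \<rho> + - (1 + l\<^sup>2) * weight 0 \<rho>"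
  have h: "(\<lambda>n. grid_op n ?h x) \<longlonglongrightarrow> Lam 1 x - (1 + l\<^sup>2) *\<^sub>R x"
    unfolding grid_op_lin weight_0 diff_conv_add_uminus scaleR_minus_left[symmetric]
    by (intro tendsto_add tendsto_scaleR tendsto_const Lam_tendsto x grid_op_one_tendsto)
  show "(\<lambda>n. (norm (grid_op n (weight a) x))\<^sup>2) \<longlonglongrightarrow> (norm (Lam a x))\<^sup>2"
    by (intro tendsto_intros Lam_tendsto x)
  show "(\<lambda>n. A * (norm (grid_op n (weight b) x))\<^sup>2 + B * (norm (grid_op n ?h x))\<^sup>2)
      \<longlonglongrightarrow> A * (norm (Lam b x))\<^sup>2 + B * (norm (Lam 1 x - (1 + l\<^sup>2) *\<^sub>R x))\<^sup>2"
    by (intro tendsto_intros Lam_tendsto x h)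
  have "(norm (grid_op n (weight a) x))\<^sup>2
      \<le> A * (norm (grid_op n (weight b) x))\<^sup>2 + B * (norm (grid_op n ?h x))\<^sup>2" for n
  proof (rule grid_op_norm_le)
    fix \<rho> :: real
    show "(weight a \<rho>)\<^sup>2 \<le> A * (weight b \<rho>)\<^sup>2 + B * (weight 1 \<rho> + - (1 + l\<^sup>2) * weight 0 \<rho>)\<^sup>2"
      using le[of "1 + \<rho>\<^sup>2"] by (simp add: weight_squared weight_one)
  qed
  then show "\<exists>N. \<forall>n\<ge>N. (norm (grid_op n (weight a) x))\<^sup>2
      \<le> A * (norm (grid_op n (weight b) x))\<^sup>2 + B * (norm (grid_op n ?h x))\<^sup>2" by blast
qed

subsection \<open>The operator itself\<close>

text \<open>The Riemann sums of \<rho>^2 and of 1 + \<rho>^2 differ by those of the constant 1,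
  which converge at every u; so both have the same domain and P = \<Lambda> - 1.\<close>

lemma resolution_eq:
  assumes "spectral_resolution D P E"
  shows "D = dm 1" and "\<And>u. u \<in> dm 1 \<Longrightarrow> P u = Lam 1 u - u"
proof -
  have adm: "admissible (\<lambda>\<rho>. \<rho>\<^sup>2)"
    unfolding admissible_def
  proof (intro conjI exI[of _ 2] allI impI)
    show "continuous_on UNIV (\<lambda>\<rho>::real. \<rho>\<^sup>2)" by (intro continuous_intros)
    fix r s :: real assume rs: "0 \<le> r" "r \<le> s" "s \<le> r + 1"
    have "s\<^sup>2 \<le> (r + 1)\<^sup>2" using rs by (intro power_mono) auto
    also have "\<dots> \<le> 2 * r\<^sup>2 + 2" using sum_squares_bound[of r 1] by (simp add: power2_sum)
    finally show "\<bar>s\<^sup>2\<bar> \<le> 2 * (1 + \<bar>r\<^sup>2\<bar>)" by simp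
  qed simp
  have w: "weight 1 = (\<lambda>\<rho>. \<rho>\<^sup>2 + 1 * weight 0 \<rho>)" by (auto simp: weight_one)
  have sq: "(\<lambda>\<rho>. \<rho>\<^sup>2) = (\<lambda>\<rho>. weight 1 \<rho> + (- 1) * weight 0 \<rho>)" by (auto simp: weight_one)
  have D: "D = calc_dom E (\<lambda>\<rho>. \<rho>\<^sup>2)" "\<And>u. u \<in> D \<Longrightarrow> P u = spectral_calc E (\<lambda>\<rho>. \<rho>\<^sup>2) u"
    using assms by (auto simp: spectral_resolution_def)
  have 1: "u \<in> D \<and> P u = Lam 1 u - u" if u: "u \<in> dm 1" for u
  proof -
    have "(\<lambda>n. grid_op n (\<lambda>\<rho>. \<rho>\<^sup>2) u) \<longlonglongrightarrow> Lam 1 u - u"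
      using tendsto_add[OF Lam_tendsto[OF u] tendsto_scaleR[OF tendsto_const grid_op_one_tendsto], of "- 1" u]
      unfolding sq grid_op_lin weight_0 by simp
    from spectral_calcI[OF adm this] show ?thesis using D by simp
  qed
  have "u \<in> dm 1" if "u \<in> D" for u
  proof (rule LamI(1))
    show "(\<lambda>n. grid_op n (weight 1) u) \<longlonglongrightarrow> spectral_calc E (\<lambda>\<rho>. \<rho>\<^sup>2) u + 1 *\<^sub>R u"
      using that D(1) unfolding w grid_op_lin weight_0
      by (intro tendsto_add tendsto_scaleR tendsto_const spectral_calc_tendsto adm grid_op_one_tendsto) simp
  qed
  with 1 show "D = dm 1" and "\<And>u. u \<in> dm 1 \<Longrightarrow> P u = Lam 1 u - u" by auto
qed

end

section \<open>The damped operator in weak form\<close>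

locale damped = spectral E for E :: "real \<Rightarrow> 'h::complex_hilbert \<Rightarrow> 'h" +
  fixes D :: "'h set" and P :: "'h \<Rightarrow> 'h" and Q :: "'h \<Rightarrow> 'y::complex_hilbert" and \<gamma> :: real
  assumes resolution: "spectral_resolution D P E"
    and \<gamma>_nonneg: "0 \<le> \<gamma>" and \<gamma>_le: "\<gamma> \<le> 1 / 2"
    and bounded_Q: "bounded_Hs E \<gamma> Q"
begin

section \<open>The form domain H_(1/2), the damping operator on it and the form of P\<close>

abbreviation V :: "'h set" where "V \<equiv> dm (1/2)"

lemma Hs_V: "Hs E (1/2) = V"
  by (rule Hs_eq) simp

lemma V_subset: "u \<in> V \<Longrightarrow> u \<in> dm \<gamma>"
  using dm_mono \<gamma>_le by blast

lemma Q_clinear: "clinear_on (dm \<gamma>) Q"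
  using bounded_Q Hs_eq[OF \<gamma>_nonneg] by (simp add: bounded_Hs_def)

lemma Q_bound: "\<exists>c>0. \<forall>u\<in>dm \<gamma>. norm (Q u) \<le> c * norm (Lam \<gamma> u)"
proof -
  obtain c where c: "\<forall>u\<in>dm \<gamma>. norm (Q u) \<le> c * norm (Lam \<gamma> u)"
    using bounded_Q Hs_eq[OF \<gamma>_nonneg] by (auto simp: bounded_Hs_def Hs_norm_def)
  have "c * norm (Lam \<gamma> u) \<le> max c 1 * norm (Lam \<gamma> u)" for u
    by (intro mult_right_mono) auto
  with c show ?thesis by (intro exI[of _ "max c 1"]) (auto intro: order_trans)
qed

lemma Q_add: "u \<in> V \<Longrightarrow> v \<in> V \<Longrightarrow> Q (u + v) = Q u + Q v"
  and Q_diff: "u \<in> V \<Longrightarrow> v \<in> V \<Longrightarrow> Q (u - v) = Q u - Q v"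
  and Q_scaleC: "u \<in> V \<Longrightarrow> Q (a *\<^sub>C u) = a *\<^sub>C Q u"
  using V_subset clinear_on_add[OF Q_clinear] clinear_on_diff[OF Q_clinear]
    clinear_on_scaleC[OF Q_clinear] by blast+

lemma P_eq: "u \<in> dm 1 \<Longrightarrow> P u = Lam 1 u - u"
  using resolution_eq[OF resolution] by blast

text \<open>The extension of <P u, w> to H_(1/2); the second term is subtracted because P =
  \<Lambda> - 1.\<close>

definition energy_form :: "'h \<Rightarrow> 'h \<Rightarrow> complex" where
  "energy_form u w = cinner (Lam (1/2) u) (Lam (1/2) w) - cinner u w"

lemma P_weak:
  assumes "X \<in> dm 1" and "w \<in> V"
  shows "cinner (P X) w = energy_form X w"
proof -
  have "cinner (Lam 1 X) (Lam 0 w) = cinner (Lam (1/2) X) (Lam (1/2) w)"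
    using assms by (intro Lam_cinner_split) (auto intro: dm_mono)
  then show ?thesis by (simp add: P_eq[OF assms(1)] energy_form_def cinner_diff_left)
qed

lemma energy_form_bound:
  assumes "u \<in> V" and "w \<in> V"
  shows "cmod (energy_form u w) \<le> 2 * norm (Lam (1/2) u) * norm (Lam (1/2) w)"
proof -
  have "norm u * norm w \<le> norm (Lam (1/2) u) * norm (Lam (1/2) w)"
    using assms by (intro mult_mono norm_le_Lam) auto
  then show ?thesis
    using norm_triangle_ineq4[of "cinner (Lam (1/2) u) (Lam (1/2) w)" "cinner u w"]
      norm_cinner_le[of "Lam (1/2) u" "Lam (1/2) w"] norm_cinner_le[of u w]
    unfolding energy_form_def by linarith
qed

lemma energy_form_add_left: "u \<in> V \<Longrightarrow> v \<in> V \<Longrightarrow> energy_form (u + v) w = energy_form u w + energy_form v w"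
  and energy_form_diff_left: "u \<in> V \<Longrightarrow> v \<in> V \<Longrightarrow> energy_form (u - v) w = energy_form u w - energy_form v w"
  and energy_form_scaleC_left: "u \<in> V \<Longrightarrow> energy_form (a *\<^sub>C u) w = a * energy_form u w"
  and energy_form_add_right: "w \<in> V \<Longrightarrow> v \<in> V \<Longrightarrow> energy_form u (w + v) = energy_form u w + energy_form u v"
  and energy_form_scaleC_right: "w \<in> V \<Longrightarrow> energy_form u (a *\<^sub>C w) = cnj a * energy_form u w"
  by (simp_all add: energy_form_def Lam_add Lam_diff Lam_scaleC cinner_add_left cinner_diff_left
      cinner_scaleC_left cinner_add_right cinner_scaleC_right algebra_simps)

text \<open>A real supremum is informative only for a bounded set, so a bound B is needed for the
  second claim as well. Its disjunction restricts that claim to w in the unit ball of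
  H_(1/2).\<close>

lemma Hs_dual_norm_le:
  assumes le: "\<And>w. w \<in> V \<Longrightarrow> cmod (F w) \<le> B * norm (Lam (1/2) w)" and B: "0 \<le> B"
  shows "Hs_dual_norm E (1/2) F \<le> B"
    and "w \<in> V \<Longrightarrow> cmod (F w) \<le> Hs_dual_norm E (1/2) F \<or> 1 < norm (Lam (1/2) w)"
proof -
  let ?S = "{cmod (F w) |w. w \<in> Hs E (1/2) \<and> Hs_norm E (1/2) w \<le> 1}"
  have bd: "x \<le> B" if "x \<in> ?S" for x
  proof -
    from that obtain w where w: "x = cmod (F w)" "w \<in> V" "norm (Lam (1/2) w) \<le> 1"
      by (auto simp: Hs_V Hs_norm_def)
    have "B * norm (Lam (1/2) w) \<le> B * 1" using w B by (intro mult_left_mono) auto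
    then show ?thesis using le[OF w(2)] w(1) by simp
  qed
  have "cmod (F 0) \<in> ?S" using dm_zero[of "1/2"] by (auto simp: Hs_V Hs_norm_def Lam_zero)
  then show "Hs_dual_norm E (1/2) F \<le> B"
    unfolding Hs_dual_norm_def by (intro cSup_least) (use bd in auto)
  show "cmod (F w) \<le> Hs_dual_norm E (1/2) F \<or> 1 < norm (Lam (1/2) w)" if "w \<in> V"
    unfolding Hs_dual_norm_def
    using that by (auto simp: Hs_V Hs_norm_def not_less intro!: cSup_upper bdd_aboveI[of _ B] bd)
qed

text \<open>The form satisfies the limit condition by its continuity in the first argument.
  Conversely, any other candidate is compared with it along one sequence in H_1 that tends to u in
  H_(1/2).\<close>

lemma P_ext_eq:
  assumes u: "u \<in> V"
  shows "P_ext E P u = (\<lambda>w. if w \<in> V then energy_form u w else 0)"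
  unfolding P_ext_def
proof (rule the_equality, goal_cases)
  let ?f = "\<lambda>w. if w \<in> V then energy_form u w else 0"
  case 1
  have "?f \<in> Hs_dual E (1/2)"
    unfolding Hs_dual_def Hs_V
    using energy_form_bound[OF u]
    by (auto simp: Hs_norm_def dm_add dm_scaleC energy_form_add_right energy_form_scaleC_right
        intro!: exI[of _ "2 * norm (Lam (1/2) u)"])
  moreover have "(\<lambda>n. Hs_dual_norm E (1/2) (\<lambda>w. embed_dual E (1/2) (P (X n)) w - ?f w)) \<longlonglongrightarrow> 0"
    if X: "\<And>n. X n \<in> Hs E 1" and lim: "(\<lambda>n. Hs_norm E (1/2) (X n - u)) \<longlonglongrightarrow> 0" for X
  proof (rule tendsto_sandwich[OF _ _ tendsto_const])
    have X1: "X n \<in> dm 1" for n using X Hs_eq[of 1] by auto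
    have XV: "X n \<in> V" for n using X1 by (rule dm_mono) simp
    let ?F = "\<lambda>n w. embed_dual E (1/2) (P (X n)) w - ?f w"
    have le: "cmod (?F n w) \<le> 2 * norm (Lam (1/2) (X n - u)) * norm (Lam (1/2) w)" if w: "w \<in> V" for n w
    proof -
      have "?F n w = energy_form (X n - u) w"
        using w by (simp add: embed_dual_def Hs_V P_weak[OF X1] energy_form_diff_left XV u)
      then show ?thesis using energy_form_bound[OF dm_diff[OF XV u] w] by simp
    qed
    show "(\<lambda>n. 2 * Hs_norm E (1/2) (X n - u)) \<longlonglongrightarrow> 0" using tendsto_mult_left[OF lim, of 2] by simp
    show "\<forall>\<^sub>F n in sequentially. Hs_dual_norm E (1/2) (?F n) \<le> 2 * Hs_norm E (1/2) (X n - u)"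
      unfolding Hs_norm_def by (intro always_eventually allI Hs_dual_norm_le(1) le) auto
    have "0 \<le> Hs_dual_norm E (1/2) (?F n)" for n
      using Hs_dual_norm_le(2)[of "?F n" "2 * norm (Lam (1/2) (X n - u))" 0, OF le] dm_zero[of "1/2"]
      by (auto simp: Lam_zero intro: order_trans[OF norm_ge_zero])
    then show "\<forall>\<^sub>F n in sequentially. 0 \<le> Hs_dual_norm E (1/2) (?F n)" by simp
  qed
  ultimately show ?case by auto
next
  case (2 F)
  \<comment> \<open>Approximates \<Lambda>^(1/2) u in H by elements of H_(1/2); \<Lambda>^(-1/2)
    sends them to elements of H_1 that converge to u in H_(1/2).\<close>
  obtain Y where Y: "\<And>n. Y n \<in> V" "Y \<longlonglongrightarrow> Lam (1/2) u"
    using dm_dense[of "1/2"] closure_sequential[of "Lam (1/2) u" V] by auto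
  define X where "X n = Lam (- 1/2) (Y n)" for n
  have X1: "X n \<in> dm 1" for n
    unfolding X_def by (rule Lam_memI[OF _ Y(1)]) (auto intro: dm_nonpos)
  then have XH: "X n \<in> Hs E 1" for n using Hs_eq[of 1] by auto
  have XV: "X n \<in> V" for n using X1 by (rule dm_mono) simp
  have LX: "Lam (1/2) (X n - u) = Y n - Lam (1/2) u" for n
    using Lam_inverse'[of "Y n" "1/2"] by (simp add: Lam_diff XV u) (simp add: X_def dm_nonpos)
  have F: "F \<in> Hs_dual E (1/2)" using 2 by auto
  have "(\<lambda>n. Hs_norm E (1/2) (X n - u)) \<longlonglongrightarrow> 0"
    unfolding Hs_norm_def LX using Y(2) by (simp add: LIM_zero tendsto_norm_zero)
  with 2 XH have lim: "(\<lambda>n. Hs_dual_norm E (1/2) (\<lambda>w. embed_dual E (1/2) (P (X n)) w - F w)) \<longlonglongrightarrow> 0"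
    by blast
  have "\<exists>B. \<forall>w\<in>V. cmod (F w) \<le> B * norm (Lam (1/2) w)"
    using F unfolding Hs_dual_def Hs_V Hs_norm_def by simp
  then obtain B where B: "\<And>w. w \<in> V \<Longrightarrow> cmod (F w) \<le> B * norm (Lam (1/2) w)"
    by blast
  have F0: "w \<notin> V \<Longrightarrow> F w = 0" and Fs: "w \<in> V \<Longrightarrow> F (a *\<^sub>C w) = cnj a * F w" for a w
    using F by (auto simp: Hs_dual_def Hs_V)
  have small: "F w = energy_form u w" if w: "w \<in> V" "norm (Lam (1/2) w) \<le> 1" for w
  proof -
    have le: "cmod (embed_dual E (1/2) (P (X n)) z - F z)
        \<le> (2 * norm (Lam (1/2) (X n)) + \<bar>B\<bar>) * norm (Lam (1/2) z)" if z: "z \<in> V" for z n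
    proof -
      have "B * norm (Lam (1/2) z) \<le> \<bar>B\<bar> * norm (Lam (1/2) z)" by (intro mult_right_mono) auto
      then have "cmod (energy_form (X n) z) + cmod (F z)
          \<le> 2 * norm (Lam (1/2) (X n)) * norm (Lam (1/2) z) + \<bar>B\<bar> * norm (Lam (1/2) z)"
        using energy_form_bound[OF XV z, of n] B[OF z] by linarith
      then show ?thesis
        using z norm_triangle_ineq4[of "energy_form (X n) z" "F z"]
        by (simp add: embed_dual_def Hs_V P_weak[OF X1] distrib_right)
    qed
    have "cmod (energy_form (X n) w - F w) \<le> Hs_dual_norm E (1/2) (\<lambda>w. embed_dual E (1/2) (P (X n)) w - F w)" for n
      using Hs_dual_norm_le(2)[OF le _ w(1), of n] w by (auto simp: embed_dual_def Hs_V P_weak[OF X1])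
    then have "(\<lambda>n. energy_form (X n) w - F w) \<longlonglongrightarrow> 0"
      by (intro Lim_null_comparison[OF _ lim]) auto
    then have "(\<lambda>n. energy_form (X n) w) \<longlonglongrightarrow> F w" by (simp add: LIM_zero_iff)
    moreover have "(\<lambda>n. energy_form (X n) w) \<longlonglongrightarrow> energy_form u w"
    proof -
      have lim0: "(\<lambda>n. 2 * norm (Y n - Lam (1/2) u) * norm (Lam (1/2) w)) \<longlonglongrightarrow> 0"
        using Y(2) by (intro tendsto_mult_left_zero tendsto_mult_right_zero) (simp add: LIM_zero tendsto_norm_zero)
      have "norm (energy_form (X n) w - energy_form u w) \<le> 2 * norm (Y n - Lam (1/2) u) * norm (Lam (1/2) w)" for n
        using energy_form_bound[OF dm_diff[OF XV u] w(1), of n] unfolding LX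
        by (simp add: energy_form_diff_left XV u)
      then have "(\<lambda>n. energy_form (X n) w - energy_form u w) \<longlonglongrightarrow> 0"
        by (intro Lim_null_comparison[OF _ lim0] always_eventually allI)
      then show ?thesis by (simp add: LIM_zero_iff)
    qed
    ultimately show ?thesis by (rule LIMSEQ_unique)
  qed
  show ?case
  proof
    fix w
    show "F w = (if w \<in> V then energy_form u w else 0)"
    proof (cases "w \<in> V")
      case True
      \<comment> \<open>Scales w into the unit ball, where the dual norm controls values; the 1 in
        the denominator prevents a division by 0.\<close>
      define a where "a = complex_of_real (1 / (1 + norm (Lam (1/2) w)))"
      have pos: "0 < 1 + norm (Lam (1/2) w)" by (simp add: add_pos_nonneg)
      have "a \<noteq> 0" unfolding a_def of_real_eq_0_iff using pos by simp
      have "cmod a = 1 / (1 + norm (Lam (1/2) w))" unfolding a_def norm_of_real using pos by simp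
      then have "norm (Lam (1/2) (a *\<^sub>C w)) \<le> 1" using pos True by (simp add: Lam_scaleC norm_scaleC)
      then have "F (a *\<^sub>C w) = energy_form u (a *\<^sub>C w)" by (intro small dm_scaleC True)
      then show ?thesis using True \<open>a \<noteq> 0\<close> by (simp add: Fs energy_form_scaleC_right)
    qed (simp add: F0)
  qed
qed

section \<open>The resolvent equation tested on the form domain\<close>

lemma damped_part_eq:
  assumes u: "u \<in> V"
  shows "damped_part E P \<gamma> Q u v = (\<lambda>w. if w \<in> V then energy_form u w + cinner (Q v) (Q w) else 0)"
  unfolding damped_part_def P_ext_eq[OF u] restrict_dual_def Q_adj_def Hs_V Hs_eq[OF \<gamma>_nonneg]
  using V_subset by auto

lemma embed_dual_inj:
  assumes "embed_dual E (1/2) h = embed_dual E (1/2) h'"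
  shows "h = h'"
proof (rule cinner_eq_dense[OF dm_dense])
  show "cinner h w = cinner h' w" if "w \<in> V" for w
    using fun_cong[OF assms, of w] that by (simp add: embed_dual_def Hs_V)
qed

lemma dual_to_H_embed: "dual_to_H E (1/2) (embed_dual E (1/2) h) = h"
  unfolding dual_to_H_def by (rule the_equality) (auto dest: embed_dual_inj)

text \<open>Replaces the descriptions inside \<open>gen\<close> by equations between numbers. If h
  represents P u + Q^* Q w, then the second component says - h + i l w = g, which is where the
  right-hand side i l w - g comes from.\<close>

lemma gen_shift_iff:
  "(u, w) \<in> gen_dom E P \<gamma> Q \<and> gen_shift E P \<gamma> Q l (u, w) = (f, g) \<longleftrightarrow>
     u \<in> V \<and> w \<in> V \<and> w + (\<i> * l) *\<^sub>C u = f \<and>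
     (\<forall>z\<in>V. energy_form u z + cinner (Q w) (Q z) = cinner ((\<i> * l) *\<^sub>C w - g) z)" (is "?A \<longleftrightarrow> ?B")
proof
  assume A: ?A
  then have V: "u \<in> V" "w \<in> V" by (auto simp: gen_dom_def Hs_V)
  from A obtain h where h: "damped_part E P \<gamma> Q u w = embed_dual E (1/2) h"
    by (auto simp: gen_dom_def dual_in_H_def)
  from A have fg: "w + (\<i> * l) *\<^sub>C u = f" "- h + (\<i> * l) *\<^sub>C w = g"
    by (auto simp: gen_shift_def gen_def h dual_to_H_embed)
  then have "h = (\<i> * l) *\<^sub>C w - g" by (auto simp: algebra_simps)
  moreover have "energy_form u z + cinner (Q w) (Q z) = cinner h z" if "z \<in> V" for z
    using fun_cong[OF h, of z] that by (simp add: damped_part_eq[OF V(1)] embed_dual_def Hs_V)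
  ultimately show ?B using V fg by simp
next
  assume B: ?B
  have h: "damped_part E P \<gamma> Q u w = embed_dual E (1/2) ((\<i> * l) *\<^sub>C w - g)"
    using B by (auto simp: damped_part_eq embed_dual_def Hs_V)
  show ?A
    unfolding gen_dom_def gen_shift_def gen_def
    using B by (auto simp: h dual_to_H_embed Hs_V dual_in_H_def)
qed

text \<open>The form of \<open>P - l\<^sup>2 - i l Q\<^sup>*Q\<close>; weak solutions have right-hand side \<open>\<Lambda>\<^sup>1\<^sup>/\<^sup>2 \<phi>\<close>.\<close>

definition form :: "real \<Rightarrow> 'h \<Rightarrow> 'h \<Rightarrow> complex" where
  "form l u w = energy_form u w - complex_of_real (l\<^sup>2) * cinner u w
     - (\<i> * complex_of_real l) * cinner (Q u) (Q w)"

definition weak_sol :: "real \<Rightarrow> 'h \<Rightarrow> 'h \<Rightarrow> bool" where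
  "weak_sol l u \<phi> \<longleftrightarrow> u \<in> V \<and> (\<forall>w\<in>V. form l u w = cinner \<phi> (Lam (1/2) w))"

lemma form_add_left: "u \<in> V \<Longrightarrow> v \<in> V \<Longrightarrow> form l (u + v) w = form l u w + form l v w"
  and form_diff_left: "u \<in> V \<Longrightarrow> v \<in> V \<Longrightarrow> form l (u - v) w = form l u w - form l v w"
  and form_scaleC_left: "u \<in> V \<Longrightarrow> form l (a *\<^sub>C u) w = a * form l u w"
  by (simp_all add: form_def energy_form_add_left energy_form_diff_left energy_form_scaleC_left
      Q_add Q_diff Q_scaleC cinner_add_left cinner_diff_left cinner_scaleC_left algebra_simps)

lemma energy_form_commute: "energy_form u w = cnj (energy_form w u)"
  by (simp add: energy_form_def cinner_commute[of u] cinner_commute[of "Lam (1/2) u"])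

lemma form_commute: "form l u w = cnj (form (- l) w u)"
  unfolding form_def energy_form_commute[of u] cinner_commute[of u] cinner_commute[of "Q u"] by simp

lemma cinner_half: "z \<in> V \<Longrightarrow> cinner (Lam (- (1/2)) g) (Lam (1/2) z) = cinner g z"
  using Lam_sym[of g "- (1/2)" "Lam (1/2) z"] Lam_inverse[of z "1/2"] by (simp add: dm_nonpos)

text \<open>For f = 0 the first component forces w = - i l u. Inserting this produces
  \<open>form l\<close>, since i l w = l^2 u and Q^* Q w = - i l Q^* Q u.\<close>

lemma gen_shift_zero_iff:
  "(u, w) \<in> gen_dom E P \<gamma> Q \<and> gen_shift E P \<gamma> Q l (u, w) = (0, g) \<longleftrightarrow>
     weak_sol l u (- Lam (- (1/2)) g) \<and> w = - ((\<i> * l) *\<^sub>C u)"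
proof -
  have "energy_form u z + cinner (Q (- ((\<i> * l) *\<^sub>C u))) (Q z) = cinner ((\<i> * l) *\<^sub>C (- ((\<i> * l) *\<^sub>C u)) - g) z
     \<longleftrightarrow> form l u z = cinner (- Lam (- (1/2)) g) (Lam (1/2) z)" if u: "u \<in> V" and z: "z \<in> V" for z
    unfolding form_def cinner_minus_left cinner_half[OF z] scaleC_minus_left[symmetric] Q_scaleC[OF u]
      cinner_diff_left scaleC_scaleC cinner_scaleC_left
    by (auto simp: power2_eq_square algebra_simps)
  moreover have "w + (\<i> * l) *\<^sub>C u = 0 \<longleftrightarrow> w = - ((\<i> * l) *\<^sub>C u)" by (simp add: eq_neg_iff_add_eq_0)
  moreover have "- ((\<i> * l) *\<^sub>C u) \<in> V" if "u \<in> V"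
    unfolding scaleC_minus_left[symmetric] using that by (rule dm_scaleC)
  ultimately show ?thesis unfolding gen_shift_iff weak_sol_def by auto
qed

text \<open>The substitution \<open>y = u + (i/l) f\<close> removes \<open>i l f - Q\<^sup>*Q f\<close> from the right-hand side, leaving
  \<open>(i/l) P f\<close>, which is smaller by a factor \<open>l\<close>.\<close>

definition reduced_rhs :: "real \<Rightarrow> 'h \<Rightarrow> 'h \<Rightarrow> 'h" where
  "reduced_rhs l f g = (\<i> / l) *\<^sub>C (Lam (1/2) f - Lam (- (1/2)) f) - Lam (- (1/2)) g"

text \<open>Besides improving the right-hand side, the new unknown y removes f from the second
  component of the solution: w = f - i l u = - i l y. Hence |l| ||y|| is exactly the norm of that
  component.\<close>

lemma gen_shift_reduced:
  assumes f: "f \<in> V" and l: "l \<noteq> 0"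
  shows "(u, w) \<in> gen_dom E P \<gamma> Q \<and> gen_shift E P \<gamma> Q l (u, w) = (f, g) \<longleftrightarrow>
    weak_sol l (u + (\<i> / l) *\<^sub>C f) (reduced_rhs l f g) \<and> w = - ((\<i> * l) *\<^sub>C (u + (\<i> / l) *\<^sub>C f))"
proof -
  have uV: "u \<in> V \<longleftrightarrow> u + (\<i> / l) *\<^sub>C f \<in> V"
    using dm_add[OF _ dm_scaleC[OF f], of u "\<i> / l"] dm_diff[OF _ dm_scaleC[OF f], of "u + (\<i> / l) *\<^sub>C f" "\<i> / l"]
    by auto
  have w: "w + (\<i> * l) *\<^sub>C u = f \<longleftrightarrow> w = - ((\<i> * l) *\<^sub>C (u + (\<i> / l) *\<^sub>C f))"
  proof -
    have "(\<i> * l) *\<^sub>C (\<i> / l) *\<^sub>C f = - f"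
      using l uminus_scaleC[of f] by (simp add: scaleC_scaleC)
    then have e: "- ((\<i> * l) *\<^sub>C (u + (\<i> / l) *\<^sub>C f)) = f - (\<i> * l) *\<^sub>C u" by (simp add: scaleC_add_right)
    show ?thesis unfolding e by (simp add: eq_diff_eq)
  qed
  have "energy_form u z + cinner (Q (f - (\<i> * l) *\<^sub>C u)) (Q z) = cinner ((\<i> * l) *\<^sub>C (f - (\<i> * l) *\<^sub>C u) - g) z
     \<longleftrightarrow> form l (u + (\<i> / l) *\<^sub>C f) z = cinner (reduced_rhs l f g) (Lam (1/2) z)" (is "?L \<longleftrightarrow> ?R")
    if u: "u \<in> V" and z: "z \<in> V" for z
  proof -
    have rhs: "cinner (reduced_rhs l f g) (Lam (1/2) z) = (\<i> / l) * energy_form f z - cinner g z"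
      unfolding reduced_rhs_def energy_form_def
      by (simp add: cinner_diff_left cinner_scaleC_left cinner_half[OF z])
    have 1: "form l (u + (\<i> / l) *\<^sub>C f) z = form l u z + (\<i> / l) * form l f z"
      by (simp add: form_add_left u dm_scaleC f form_scaleC_left)
    have 2: "(\<i> / l) * form l f z = (\<i> / l) * energy_form f z - (\<i> * l) * cinner f z + cinner (Q f) (Q z)"
      using l unfolding form_def by (simp add: field_simps power2_eq_square)
    have 3: "cinner (Q (f - (\<i> * l) *\<^sub>C u)) (Q z) = cinner (Q f) (Q z) - (\<i> * l) * cinner (Q u) (Q z)"
      by (simp add: Q_diff f dm_scaleC u Q_scaleC cinner_diff_left cinner_scaleC_left)
    have 4: "cinner ((\<i> * l) *\<^sub>C (f - (\<i> * l) *\<^sub>C u) - g) z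
        = (\<i> * l) * cinner f z + complex_of_real (l\<^sup>2) * cinner u z - cinner g z"
      by (simp add: cinner_diff_left cinner_scaleC_left power2_eq_square algebra_simps)
    show ?thesis unfolding rhs 1 2 3 4 unfolding form_def by (auto simp: algebra_simps)
  qed
  moreover have "f - (\<i> * l) *\<^sub>C u \<in> V" if "u \<in> V" using that by (intro dm_diff dm_scaleC f)
  moreover have "w + (\<i> * l) *\<^sub>C u = f \<longleftrightarrow> w = f - (\<i> * l) *\<^sub>C u" by (auto simp: algebra_simps)
  ultimately show ?thesis
    unfolding gen_shift_iff weak_sol_def uV[symmetric] w[symmetric] by auto
qed

lemma norm_reduced_rhs:
  assumes f: "f \<in> V" and l: "1 \<le> \<bar>l\<bar>"
  shows "norm (reduced_rhs l f g) \<le> 2 * norm (Lam (1/2) f) + norm g"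
proof -
  have "norm (Lam (1/2) f - Lam (- (1/2)) f) \<le> 2 * norm (Lam (1/2) f)"
    using norm_triangle_ineq4[of "Lam (1/2) f" "Lam (- (1/2)) f"] norm_Lam_mono[OF f, of "- (1/2)"] by simp
  moreover have "cmod (\<i> / l) \<le> 1" using l by (simp add: norm_divide)
  ultimately have "cmod (\<i> / l) * norm (Lam (1/2) f - Lam (- (1/2)) f) \<le> 1 * (2 * norm (Lam (1/2) f))"
    by (intro mult_mono) auto
  moreover have "norm (Lam (- (1/2)) g) \<le> norm g" by (rule norm_Lam_nonpos) simp
  ultimately show ?thesis
    using norm_triangle_ineq4[of "(\<i> / l) *\<^sub>C (Lam (1/2) f - Lam (- (1/2)) f)" "Lam (- (1/2)) g"]
    unfolding reduced_rhs_def norm_scaleC by linarith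
qed

end

section \<open>Solvability of bounded sesquilinear forms\<close>

lemma form_represented:
  fixes B :: "'a::complex_hilbert \<Rightarrow> 'a \<Rightarrow> complex"
  assumes add: "\<And>x y z. B x (y + z) = B x y + B x z"
    and scale: "\<And>x y a. B x (a *\<^sub>C y) = cnj a * B x y"
    and bound: "\<And>x y. cmod (B x y) \<le> K * norm x * norm y"
  shows "\<exists>A. \<forall>x y. B x y = cinner (A x) y"
proof -
  have "\<exists>v. \<forall>y. B x y = cinner v y" for x
  proof -
    have "clinear_on UNIV (\<lambda>y. cnj (B x y))"
      by (simp add: clinear_on_def csubspace_UNIV add scale scaleC_complex_def)
    moreover have "norm (cnj (B x y)) \<le> (K * norm x) * norm y" for y using bound[of x y] by simp
    ultimately obtain T' where T': "\<And>y c. cinner (cnj (B x y)) c = cinner y (T' c)"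
      using adjoint_exists[of "\<lambda>y. cnj (B x y)" "K * norm x"] by blast
    \<comment> \<open>The functional \<open>\<lambda>y. cnj (B x y)\<close> is an operator into the
      complex numbers, and its adjoint sends 1 to the Riesz vector.\<close>
    have "B x y = cinner (T' 1) y" for y
      using T'[of y 1] by (simp add: cinner_complex_def) (metis cinner_commute complex_cnj_cnj)
    then show ?thesis by blast
  qed
  then show ?thesis by metis
qed

text \<open>Takes the place of the Lax-Milgram theorem for forms that are not coercive: an a priori
  estimate for the adjoint form \<open>B'\<close> makes the operator of \<open>B\<close> surjective.
  The bound is phrased with right-hand sides \<psi> so that estimates for solutions can be inserted
  directly.\<close>

lemma form_solvable:
  fixes B B' :: "'a::complex_hilbert \<Rightarrow> 'a \<Rightarrow> complex"
  assumes add: "\<And>x y z. B (x + y) z = B x z + B y z" "\<And>x y z. B' (x + y) z = B' x z + B' y z"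
    and scale: "\<And>x y a. B (a *\<^sub>C x) y = a * B x y" "\<And>x y a. B' (a *\<^sub>C x) y = a * B' x y"
    and adj: "\<And>x y. B x y = cnj (B' y x)"
    and bound: "\<And>x y. cmod (B x y) \<le> K * norm x * norm y"
    and c: "0 < c" and lower: "\<And>y \<psi>. (\<And>z. B' y z = cinner \<psi> z) \<Longrightarrow> c * norm y \<le> norm \<psi>"
  shows "\<exists>x. \<forall>z. B x z = cinner \<phi> z"
proof -
  have adj': "B' x y = cnj (B y x)" for x y by (simp add: adj[of y x])
  have bound': "cmod (B' x y) \<le> K * norm x * norm y" for x y
    using bound[of y x] by (simp add: adj' mult_ac)
  obtain A where A: "\<And>x y. B x y = cinner (A x) y"
    using form_represented[OF _ _ bound] add(2) scale(2) by (auto simp: adj)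
  obtain A' where A': "\<And>x y. B' x y = cinner (A' x) y"
    using form_represented[OF _ _ bound'] add(1) scale(1) by (auto simp: adj')
  have AA': "cinner (A x) y = cinner x (A' y)" for x y
    using adj[of x y] A A' by (metis cinner_commute)
  have A'A: "cinner (A' x) y = cinner x (A y)" for x y
    using AA' by (metis cinner_commute)
  have "norm (A x) \<le> K * norm x" for x
  proof (cases "A x = 0")
    case True
    have "0 \<le> K * norm x * norm x" using bound[of x x] order_trans[OF norm_ge_zero] by blast
    then show ?thesis using True by (cases "x = 0") (simp_all add: zero_le_mult_iff)
  next
    case False
    have "(norm (A x))\<^sup>2 \<le> K * norm x * norm (A x)"
      using bound[of x "A x"] unfolding A cinner_self norm_of_real by simp
    then show ?thesis using False by (simp add: power2_eq_square)
  qed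
  then have "\<exists>x. A x = \<phi>"
    using A' by (intro surj_of_adjoint_bounded_below[OF AA' adjoint_clinear[OF A'A] _ c lower]) auto
  then show ?thesis using A by metis
qed

context damped
begin

subsection \<open>Weak solutions\<close>

lemma Lam_V: "Lam (- (1/2)) x \<in> V"
  by (rule Lam_mem_inverse) (simp add: dm_nonpos)

lemma Lam_half_inverse [simp]: "Lam (1/2) (Lam (- (1/2)) x) = x"
  by (rule Lam_inverse') (simp add: dm_nonpos)

lemma norm_V_le: "u \<in> V \<Longrightarrow> norm u \<le> norm (Lam (1/2) u)"
  by (rule norm_le_Lam) auto

lemma norm_Q_V: "\<exists>c>0. \<forall>u\<in>V. norm (Q u) \<le> c * norm (Lam (1/2) u)"
proof -
  obtain c where c: "c > 0" "\<forall>u\<in>dm \<gamma>. norm (Q u) \<le> c * norm (Lam \<gamma> u)" using Q_bound by blast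
  have "norm (Q u) \<le> c * norm (Lam (1/2) u)" if "u \<in> V" for u
  proof -
    have "c * norm (Lam \<gamma> u) \<le> c * norm (Lam (1/2) u)"
      using that \<gamma>_le c by (intro mult_left_mono norm_Lam_mono) auto
    then show ?thesis using c(2) V_subset[OF that] order_trans by blast
  qed
  with c show ?thesis by blast
qed

text \<open>The adjoint of the bounded operator \<open>Q \<Lambda>\<^sup>-\<^sup>\<gamma>\<close>.\<close>

lemma Q_adjoint:
  "\<exists>T'. \<exists>c>0. (\<forall>u\<in>dm \<gamma>. \<forall>y. cinner y (Q u) = cinner (T' y) (Lam \<gamma> u)) \<and> (\<forall>y. norm (T' y) \<le> c * norm y)"
proof -
  obtain c where c: "c > 0" "\<And>u. u \<in> dm \<gamma> \<Longrightarrow> norm (Q u) \<le> c * norm (Lam \<gamma> u)" using Q_bound by blast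
  define T where "T = (\<lambda>x. Q (Lam (- \<gamma>) x))"
  have mem: "Lam (- \<gamma>) x \<in> dm \<gamma>" and inv: "Lam \<gamma> (Lam (- \<gamma>) x) = x" for x
    using \<gamma>_nonneg by (simp_all add: Lam_mem_inverse Lam_inverse' dm_nonpos)
  have T: "clinear_on UNIV T"
    using Lam_clinear_UNIV[of "- \<gamma>"] \<gamma>_nonneg clinear_on_add[OF Q_clinear mem mem]
      clinear_on_scaleC[OF Q_clinear mem]
    by (simp add: clinear_on_def T_def)
  have b: "norm (T x) \<le> c * norm x" for x using c(2)[OF mem] by (simp add: T_def inv)
  obtain T' where T': "\<And>x y. cinner (T x) y = cinner x (T' y)" using adjoint_exists[OF T b] by blast
  have "cinner y (Q u) = cinner (T' y) (Lam \<gamma> u)" if "u \<in> dm \<gamma>" for u y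
  proof -
    have "Q u = T (Lam \<gamma> u)" by (simp add: T_def Lam_inverse that)
    then show ?thesis using T'[of "Lam \<gamma> u" y] by (metis cinner_commute)
  qed
  moreover have "norm (T' y) \<le> c * norm y" for y
    using adjoint_bounded[OF T' b] c by simp
  ultimately show ?thesis using c(1) by blast
qed

lemma form_bounded: "\<exists>K\<ge>0. \<forall>u\<in>V. \<forall>w\<in>V. cmod (form l u w) \<le> K * norm (Lam (1/2) u) * norm (Lam (1/2) w)"
proof -
  obtain c where c: "c > 0" "\<And>u. u \<in> V \<Longrightarrow> norm (Q u) \<le> c * norm (Lam (1/2) u)" using norm_Q_V by blast
  have "cmod (form l u w) \<le> (2 + l\<^sup>2 + \<bar>l\<bar> * (c * c)) * norm (Lam (1/2) u) * norm (Lam (1/2) w)"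
    if u: "u \<in> V" and w: "w \<in> V" for u w
  proof -
    let ?u = "norm (Lam (1/2) u)" and ?w = "norm (Lam (1/2) w)"
    have "cmod (cinner u w) \<le> ?u * ?w"
      using norm_cinner_le[of u w] mult_mono[OF norm_V_le[OF u] norm_V_le[OF w]] by simp
    then have 1: "l\<^sup>2 * cmod (cinner u w) \<le> l\<^sup>2 * (?u * ?w)" by (intro mult_left_mono) auto
    have "norm (Q u) * norm (Q w) \<le> (c * ?u) * (c * ?w)"
      using c u w by (intro mult_mono) auto
    then have "cmod (cinner (Q u) (Q w)) \<le> (c * ?u) * (c * ?w)"
      using norm_cinner_le[of "Q u" "Q w"] by simp
    then have 2: "\<bar>l\<bar> * cmod (cinner (Q u) (Q w)) \<le> \<bar>l\<bar> * ((c * ?u) * (c * ?w))" by (intro mult_left_mono) auto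
    have "cmod (form l u w) \<le> cmod (energy_form u w) + l\<^sup>2 * cmod (cinner u w) + \<bar>l\<bar> * cmod (cinner (Q u) (Q w))"
      unfolding form_def
      using norm_triangle_ineq4[of "energy_form u w - complex_of_real (l\<^sup>2) * cinner u w" "(\<i> * complex_of_real l) * cinner (Q u) (Q w)"]
        norm_triangle_ineq4[of "energy_form u w" "complex_of_real (l\<^sup>2) * cinner u w"]
      by (simp add: norm_mult norm_power)
    then have "cmod (form l u w) \<le> 2 * ?u * ?w + l\<^sup>2 * (?u * ?w) + \<bar>l\<bar> * ((c * ?u) * (c * ?w))"
      using energy_form_bound[OF u w] 1 2 by linarith
    then show ?thesis by (simp add: algebra_simps)
  qed
  then show ?thesis using c by (intro exI[of _ "2 + l\<^sup>2 + \<bar>l\<bar> * (c * c)"]) (auto intro!: add_nonneg_nonneg)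
qed

lemma energy_form_self: "u \<in> V \<Longrightarrow> energy_form u u = complex_of_real ((norm (Lam (1/2) u))\<^sup>2 - (norm u)\<^sup>2)"
  unfolding energy_form_def cinner_self of_real_diff ..

lemma form_self:
  assumes "u \<in> V"
  shows "Re (form l u u) = (norm (Lam (1/2) u))\<^sup>2 - (1 + l\<^sup>2) * (norm u)\<^sup>2"
    and "Im (form l u u) = - l * (norm (Q u))\<^sup>2"
  unfolding form_def energy_form_self[OF assms] cinner_self
  by (simp_all add: algebra_simps power2_eq_square)

text \<open>The real part of the equation tested with u; half of the squared H_(1/2) norm is
  absorbed into the left side. The factor 1 + l^2 shows that control of the energy requires control
  of |l| ||u||.\<close>

lemma weak_sol_energy:
  assumes "weak_sol l u \<phi>"
  shows "(norm (Lam (1/2) u))\<^sup>2 \<le> 2 * (1 + l\<^sup>2) * (norm u)\<^sup>2 + (norm \<phi>)\<^sup>2"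
proof -
  have u: "u \<in> V" and eq: "form l u u = cinner \<phi> (Lam (1/2) u)" using assms by (auto simp: weak_sol_def)
  let ?U = "norm (Lam (1/2) u)"
  have "?U\<^sup>2 - (1 + l\<^sup>2) * (norm u)\<^sup>2 \<le> norm \<phi> * ?U"
    using form_self(1)[OF u, of l] complex_Re_le_cmod[of "form l u u"] norm_cinner_le[of \<phi> "Lam (1/2) u"]
    unfolding eq by linarith
  moreover have "2 * (norm \<phi> * ?U) \<le> (norm \<phi>)\<^sup>2 + ?U\<^sup>2" using sum_squares_bound[of "norm \<phi>" ?U] by simp
  ultimately show ?thesis by linarith
qed

text \<open>The terms with P and l^2 are real on the diagonal, so the imaginary part of the pairing
  sees the damping alone.\<close>

lemma weak_sol_damping:
  assumes "weak_sol l u (Lam (- (1/2)) F)"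
  shows "\<bar>l\<bar> * (norm (Q u))\<^sup>2 \<le> norm F * norm u"
proof -
  have u: "u \<in> V" and eq: "form l u u = cinner F u"
    using assms cinner_half by (auto simp: weak_sol_def)
  have "\<bar>l\<bar> * (norm (Q u))\<^sup>2 = \<bar>Im (cinner F u)\<bar>"
    using form_self(2)[OF u, of l] unfolding eq by (simp add: abs_mult)
  also have "\<dots> \<le> norm F * norm u"
    using abs_Im_le_cmod[of "cinner F u"] norm_cinner_le[of F u] by simp
  finally show ?thesis .
qed

text \<open>\<open>T'\<close> is \<Lambda>^(-\<gamma>) Q^*. After multiplication by
  \<Lambda>^(-\<gamma>) every term except the leading one is an element of H, so the leading one is
  as well, and x = \<Lambda>^(-\<gamma>) u lies in the domain of P.\<close>

lemma weak_sol_regular: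
  assumes sol: "weak_sol l u (Lam (- (1/2)) F)"
    and T': "\<And>u y. u \<in> dm \<gamma> \<Longrightarrow> cinner y (Q u) = cinner (T' y) (Lam \<gamma> u)"
  shows "\<exists>x\<in>dm 1. u = Lam \<gamma> x \<and>
    Lam 1 x - (1 + l\<^sup>2) *\<^sub>R x = Lam (- \<gamma>) F + (\<i> * l) *\<^sub>C T' (Q u)"
proof -
  have u: "u \<in> V" and eq: "\<And>w. w \<in> V \<Longrightarrow> form l u w = cinner F w"
    using sol cinner_half by (auto simp: weak_sol_def)
  \<comment> \<open>The value that the equation forces upon \<Lambda> x = \<Lambda>^(1-\<gamma>)
    u.\<close>
  define h where "h = Lam (- \<gamma>) F + (1 + l\<^sup>2) *\<^sub>R Lam (- \<gamma>) u + (\<i> * l) *\<^sub>C T' (Q u)"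
  have np [simp]: "y \<in> dm (- \<gamma>)" "y \<in> dm (\<gamma> - 1/2)" "y \<in> dm (- (1/2))" "y \<in> dm (\<gamma> - 1)" "y \<in> dm (-1)" "y \<in> dm 0" for y
    using \<gamma>_nonneg \<gamma>_le by (auto intro!: dm_nonpos)
  have "Lam (1/2) u = Lam (\<gamma> - 1/2) h"
  proof (rule cinner_eqI)
    fix Y
    define w where "w = Lam (- (1/2)) Y"
    have w: "w \<in> V" "w \<in> dm \<gamma>" "Lam (1/2) w = Y" "Lam \<gamma> w = Lam (\<gamma> - 1/2) Y"
      using V_subset[OF Lam_V] by (auto simp: w_def Lam_V intro!: Lam_compI)
    have split: "cinner z w = cinner (Lam (- \<gamma>) z) (Lam \<gamma> w)" for z
      using Lam_cinner_split[of z 0 "- \<gamma>" w 0 \<gamma>] w by simp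
    have "cinner (Lam (1/2) u) Y = cinner F w + complex_of_real (1 + l\<^sup>2) * cinner u w + (\<i> * l) * cinner (Q u) (Q w)"
      using eq[OF w(1)] unfolding form_def energy_form_def w(3) by (simp add: algebra_simps)
    also have "\<dots> = cinner h (Lam \<gamma> w)"
      unfolding h_def split T'[OF w(2)] cinner_add_left cinner_scaleC_left scaleR_scaleC by simp
    also have "\<dots> = cinner (Lam (\<gamma> - 1/2) h) Y"
      unfolding w(4) by (rule Lam_sym[symmetric]) simp_all
    finally show "cinner (Lam (1/2) u) Y = cinner (Lam (\<gamma> - 1/2) h) Y" .
  qed
  then have "u = Lam (- (1/2)) (Lam (\<gamma> - 1/2) h)" using Lam_inverse[OF u] by simp
  also have "\<dots> = Lam (\<gamma> - 1) h" by (rule Lam_compI) simp_all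
  finally have uh: "u = Lam (\<gamma> - 1) h" .
  define x where "x = Lam (- 1) h"
  have x: "x \<in> dm 1" unfolding x_def by (rule Lam_mem_inverse) simp
  have "Lam \<gamma> x = u" unfolding x_def uh by (rule Lam_compI) simp_all
  moreover have "Lam (- \<gamma>) u = x" unfolding x_def uh by (rule Lam_compI) simp_all
  moreover have "Lam 1 x = h" unfolding x_def by (rule Lam_inverse') simp
  ultimately show ?thesis using x by (intro bexI[of _ x]) (auto simp: h_def)
qed

subsection \<open>Existence\<close>

text \<open>This is P + 1 - i l Q^* Q, transported to H by \<Lambda>^(-1/2). On the diagonal the
  damping is purely imaginary, so the real part is ||v||^2 for either sign of l, and the form and
  its adjoint are both bounded below by 1.\<close>

lemma coercive_solvable:
  "\<exists>v. norm v \<le> norm \<phi> \<and>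
    (\<forall>z. cinner v z - (\<i> * complex_of_real l) * cinner (Q (Lam (- (1/2)) v)) (Q (Lam (- (1/2)) z)) = cinner \<phi> z)"
proof -
  define B where "B = (\<lambda>l v z. cinner v z - (\<i> * complex_of_real l) * cinner (Q (Lam (- (1/2)) v)) (Q (Lam (- (1/2)) z)))"
  have Re_B: "Re (B k v v) = (norm v)\<^sup>2" for k v
    unfolding B_def cinner_self by simp
  have J: "clinear_on UNIV (Lam (- (1/2)))" by (rule Lam_clinear_UNIV) simp
  have lower: "norm y \<le> norm \<psi>" if "\<And>z. B k y z = cinner \<psi> z" for k y \<psi>
  proof (cases "y = 0")
    case False
    have "norm y * norm y \<le> norm \<psi> * norm y"
      using Re_B[of k y] complex_Re_le_cmod[of "B k y y"] norm_cinner_le[of \<psi> y] that[of y]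
      by (simp add: power2_eq_square)
    then show ?thesis using False by simp
  qed simp
  obtain c where c: "c > 0" "\<And>u. u \<in> V \<Longrightarrow> norm (Q u) \<le> c * norm (Lam (1/2) u)" using norm_Q_V by blast
  have "\<exists>x. \<forall>z. B l x z = cinner \<phi> z"
  proof (rule form_solvable[where B' = "B (- l)" and c = 1 and K = "1 + \<bar>l\<bar> * (c * c)"])
    show "B l x y = cnj (B (- l) y x)" for x y
      unfolding B_def cinner_commute[of x y] cinner_commute[of "Q (Lam (- (1/2)) x)"] by simp
    show "cmod (B l x y) \<le> (1 + \<bar>l\<bar> * (c * c)) * norm x * norm y" for x y
    proof -
      have "norm (Q (Lam (- (1/2)) x)) * norm (Q (Lam (- (1/2)) y)) \<le> (c * norm x) * (c * norm y)"
        using c(2)[OF Lam_V, of x] c(2)[OF Lam_V, of y] c(1) by (intro mult_mono) auto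
      then have "cmod (cinner (Q (Lam (- (1/2)) x)) (Q (Lam (- (1/2)) y))) \<le> (c * norm x) * (c * norm y)"
        using norm_cinner_le order_trans by blast
      then have "\<bar>l\<bar> * cmod (cinner (Q (Lam (- (1/2)) x)) (Q (Lam (- (1/2)) y))) \<le> \<bar>l\<bar> * ((c * norm x) * (c * norm y))"
        by (intro mult_left_mono) auto
      moreover have "cmod (B l x y) \<le> cmod (cinner x y) + \<bar>l\<bar> * cmod (cinner (Q (Lam (- (1/2)) x)) (Q (Lam (- (1/2)) y)))"
        unfolding B_def by (rule order_trans[OF norm_triangle_ineq4]) (simp add: norm_mult)
      ultimately show ?thesis using norm_cinner_le[of x y] by (simp add: algebra_simps)
    qed
    show "1 * norm y \<le> norm \<psi>" if "\<And>z. B (- l) y z = cinner \<psi> z" for y \<psi>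
      using lower[OF that] by simp
  qed (auto simp: B_def cinner_add_left cinner_scaleC_left clinear_on_add[OF J]
        clinear_on_scaleC[OF J] Q_add Q_scaleC Lam_V algebra_simps)
  then show ?thesis using lower unfolding B_def by blast
qed

text \<open>The hypothesis concerns data F in H, while \<open>form_solvable\<close> asks for a lower
  bound with all data in H_(-1/2). Subtracting the solution v of the coercive problem with the same
  data leaves an equation for u - v with right-hand side (1 + k^2) v, which is in H.\<close>

lemma weak_sol_exists:
  assumes lb: "\<And>u F. weak_sol (- l) u (Lam (- (1/2)) F) \<Longrightarrow> norm u \<le> c * norm F" and c: "0 \<le> c"
  shows "\<exists>u. weak_sol l u \<phi>"
proof -
  define k where "k = - l"
  \<comment> \<open>The energy estimate combined with ||u|| \<le> (c (1 + k^2) + 1) ||\<psi>||,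
    where c (1 + k^2) accounts for u - v and 1 for v.\<close>
  define b where "b = sqrt (2 * (1 + k\<^sup>2) * (c * (1 + k\<^sup>2) + 1)\<^sup>2 + 1)"
  have b: "0 < b" unfolding b_def by (intro real_sqrt_gt_zero add_nonneg_pos mult_nonneg_nonneg) auto
  have lower: "norm U \<le> b * norm \<psi>"
    if eq: "\<And>Z. form k (Lam (- (1/2)) U) (Lam (- (1/2)) Z) = cinner \<psi> Z" for U \<psi>
  proof -
    define u where "u = Lam (- (1/2)) U"
    have sol: "weak_sol k u \<psi>"
      unfolding weak_sol_def
    proof (intro conjI ballI)
      show "u \<in> V" by (simp add: u_def Lam_V)
      show "form k u w = cinner \<psi> (Lam (1/2) w)" if "w \<in> V" for w
        using eq[of "Lam (1/2) w"] Lam_inverse[OF that] by (simp add: u_def)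
    qed
    obtain v0 where v0: "norm v0 \<le> norm \<psi>"
      "\<And>z. cinner v0 z - (\<i> * k) * cinner (Q (Lam (- (1/2)) v0)) (Q (Lam (- (1/2)) z)) = cinner \<psi> z"
      using coercive_solvable[of \<psi> k] by blast
    define v where "v = Lam (- (1/2)) v0"
    have v: "v \<in> V" "norm v \<le> norm \<psi>"
      using norm_Lam_nonpos[of "- (1/2)" v0] v0(1) by (simp_all add: v_def Lam_V)
    have "weak_sol k (u - v) (Lam (- (1/2)) ((1 + k\<^sup>2) *\<^sub>R v))"
      unfolding weak_sol_def
    proof (intro conjI ballI)
      show "u - v \<in> V" using sol v by (simp add: weak_sol_def dm_diff)
      fix w assume w: "w \<in> V"
      have "form k v w = cinner \<psi> (Lam (1/2) w) - complex_of_real (1 + k\<^sup>2) * cinner v w"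
        using v0(2)[of "Lam (1/2) w"] Lam_inverse[OF w]
        unfolding form_def energy_form_def by (simp add: v_def algebra_simps)
      moreover have "form k u w = cinner \<psi> (Lam (1/2) w)" using sol w by (simp add: weak_sol_def)
      ultimately show "form k (u - v) w = cinner (Lam (- (1/2)) ((1 + k\<^sup>2) *\<^sub>R v)) (Lam (1/2) w)"
        unfolding cinner_half[OF w] using sol v
        by (simp add: form_diff_left weak_sol_def scaleR_scaleC cinner_scaleC_left)
    qed
    then have "norm (u - v) \<le> c * norm ((1 + k\<^sup>2) *\<^sub>R v)" unfolding k_def by (rule lb)
    also have "norm ((1 + k\<^sup>2) *\<^sub>R v) = (1 + k\<^sup>2) * norm v" by simp
    also have "c * ((1 + k\<^sup>2) * norm v) \<le> c * (1 + k\<^sup>2) * norm \<psi>"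
      using c mult_left_mono[OF v(2), of "c * (1 + k\<^sup>2)"] by (simp add: mult.assoc)
    finally have "norm u \<le> (c * (1 + k\<^sup>2) + 1) * norm \<psi>"
      using norm_triangle_sub[of u v] v(2) by (simp add: algebra_simps)
    then have "(norm u)\<^sup>2 \<le> ((c * (1 + k\<^sup>2) + 1) * norm \<psi>)\<^sup>2" by (intro power_mono) auto
    then have "2 * (1 + k\<^sup>2) * (norm u)\<^sup>2 \<le> 2 * (1 + k\<^sup>2) * ((c * (1 + k\<^sup>2) + 1) * norm \<psi>)\<^sup>2"
      by (intro mult_left_mono) auto
    then have "(norm (Lam (1/2) u))\<^sup>2 \<le> 2 * (1 + k\<^sup>2) * ((c * (1 + k\<^sup>2) + 1) * norm \<psi>)\<^sup>2 + (norm \<psi>)\<^sup>2"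
      using weak_sol_energy[OF sol] by linarith
    also have "\<dots> = (b * norm \<psi>)\<^sup>2"
      unfolding power_mult_distrib b_def by (subst real_sqrt_pow2) (auto intro!: add_nonneg_nonneg simp: algebra_simps)
    finally have "norm (Lam (1/2) u) \<le> b * norm \<psi>" by (rule power2_le_imp_le) (use b in simp)
    then show ?thesis by (simp add: u_def)
  qed
  obtain K where K: "\<And>u w. u \<in> V \<Longrightarrow> w \<in> V \<Longrightarrow> cmod (form l u w) \<le> K * norm (Lam (1/2) u) * norm (Lam (1/2) w)"
    using form_bounded by blast
  have J: "clinear_on UNIV (Lam (- (1/2)))" by (rule Lam_clinear_UNIV) simp
  have "\<exists>U. \<forall>Z. form l (Lam (- (1/2)) U) (Lam (- (1/2)) Z) = cinner \<phi> Z"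
  proof (rule form_solvable[where B' = "\<lambda>U Z. form k (Lam (- (1/2)) U) (Lam (- (1/2)) Z)" and c = "1 / b" and K = K])
    show "form l (Lam (- (1/2)) x) (Lam (- (1/2)) y) = cnj (form k (Lam (- (1/2)) y) (Lam (- (1/2)) x))" for x y
      unfolding k_def by (rule form_commute)
    show "cmod (form l (Lam (- (1/2)) x) (Lam (- (1/2)) y)) \<le> K * norm x * norm y" for x y
      using K[OF Lam_V Lam_V, of x y] by simp
    show "1 / b * norm y \<le> norm \<psi>" if "\<And>z. form k (Lam (- (1/2)) y) (Lam (- (1/2)) z) = cinner \<psi> z" for y \<psi>
      using lower[OF that] b by (simp add: divide_le_eq mult.commute)
  qed (use b in \<open>auto simp: clinear_on_add[OF J] clinear_on_scaleC[OF J] form_add_left form_scaleC_left Lam_V\<close>)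
  then obtain U where U: "\<And>Z. form l (Lam (- (1/2)) U) (Lam (- (1/2)) Z) = cinner \<phi> Z" by blast
  have "weak_sol l (Lam (- (1/2)) U) \<phi>"
    unfolding weak_sol_def
  proof (intro conjI ballI Lam_V)
    show "form l (Lam (- (1/2)) U) w = cinner \<phi> (Lam (1/2) w)" if "w \<in> V" for w
      using U[of "Lam (1/2) w"] Lam_inverse[OF that] by simp
  qed
  then show ?thesis by blast
qed

text \<open>The adjoint problem is the one at -l. Its solution z with right-hand side u satisfies
  ||u||^2 = |<\<phi>, \<Lambda>^(1/2) z>| \<le> b ||\<phi>|| ||u||.\<close>

lemma weak_sol_dual_bound:
  assumes sol: "weak_sol l u \<phi>" and dual: "\<And>z F. weak_sol (- l) z (Lam (- (1/2)) F) \<Longrightarrow> norm (Lam (1/2) z) \<le> b * norm F"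
    and ex: "\<And>\<psi>. \<exists>z. weak_sol (- l) z \<psi>"
  shows "norm u \<le> b * norm \<phi>"
proof (cases "u = 0")
  case True
  \<comment> \<open>The sign of b is not assumed; the bound for one adjoint solution shows b
    ||\<phi>|| \<ge> 0.\<close>
  obtain z where "weak_sol (- l) z (Lam (- (1/2)) \<phi>)" using ex by blast
  then have "0 \<le> b * norm \<phi>" using dual norm_ge_zero order_trans by blast
  then show ?thesis using True by simp
next
  case False
  obtain z where z: "weak_sol (- l) z (Lam (- (1/2)) u)" using ex by blast
  have uV: "u \<in> V" and zV: "z \<in> V" using sol z by (auto simp: weak_sol_def)
  have "cinner u u = form (- l) z u" using z uV by (simp add: weak_sol_def cinner_half)
  also have "\<dots> = cnj (form l u z)" using form_commute[of "- l" z u] by simp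
  also have "form l u z = cinner \<phi> (Lam (1/2) z)" using sol zV by (simp add: weak_sol_def)
  finally have "(norm u)\<^sup>2 = cmod (cinner \<phi> (Lam (1/2) z))"
    unfolding cinner_self by (metis complex_mod_cnj norm_of_real abs_of_nonneg zero_le_power2)
  also have "\<dots> \<le> norm \<phi> * (b * norm u)"
    by (rule order_trans[OF norm_cinner_le]) (intro mult_left_mono dual z, simp)
  finally show ?thesis using False by (simp add: power2_eq_square mult.commute)
qed

end

section \<open>Inequalities for multipliers\<close>

lemma sqrt_sum_le:
  fixes x y z :: real
  assumes "x\<^sup>2 \<le> y\<^sup>2 + z\<^sup>2" and "0 \<le> y" and "0 \<le> z"
  shows "x \<le> y + z"
proof (rule power2_le_imp_le)
  have "0 \<le> 2 * y * z" using assms by simp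
  then show "x\<^sup>2 \<le> (y + z)\<^sup>2" using assms(1) by (simp add: power2_sum)
qed (use assms in simp)

lemma powr_square: "0 < l \<Longrightarrow> (l\<^sup>2) powr s = l powr (2 * s)" for l :: real
  by (simp add: powr_powr flip: powr_numeral)

text \<open>Beyond r = 8 l^2 one has 1 + l^2 \<le> r/4, so r - 1 - l^2 \<ge> r/2 and the last term
  exceeds r, which is at least r^(2 \<gamma>) by \<gamma> \<le> 1/2. Below the threshold, r^(2
  \<mu>) is at most (8 l^2)^(2 \<mu>).\<close>

lemma multiplier_high_low:
  fixes r l \<gamma> \<mu> :: real
  assumes r: "1 \<le> r" and l: "1 \<le> l" and \<gamma>: "\<gamma> \<le> 1/2" and \<mu>: "0 \<le> \<mu>"
  shows "r powr (2 * \<gamma>) \<le> (8 powr \<mu> * l powr (2 * \<mu>))\<^sup>2 * r powr (2 * (\<gamma> - \<mu>)) + (1 / l)\<^sup>2 * (r - 1 - l\<^sup>2)\<^sup>2"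
proof (cases "r \<le> 8 * l\<^sup>2")
  case True
  have "r powr (2 * \<mu>) \<le> (8 * l\<^sup>2) powr (2 * \<mu>)" using True r \<mu> by (intro powr_mono2) auto
  also have "\<dots> = (8 powr \<mu> * l powr (2 * \<mu>))\<^sup>2"
  proof -
    have "(8 powr \<mu> * l powr (2 * \<mu>))\<^sup>2 = (8 powr \<mu> * 8 powr \<mu>) * (l powr (2 * \<mu>) * l powr (2 * \<mu>))"
      by (simp add: power2_eq_square)
    also have "\<dots> = 8 powr (2 * \<mu>) * l powr (2 * (2 * \<mu>))" unfolding powr_add[symmetric] by simp
    finally show ?thesis using l by (simp add: powr_mult powr_square)
  qed
  finally have "r powr (2 * \<mu>) * r powr (2 * (\<gamma> - \<mu>)) \<le> (8 powr \<mu> * l powr (2 * \<mu>))\<^sup>2 * r powr (2 * (\<gamma> - \<mu>))"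
    by (intro mult_right_mono) auto
  moreover have "r powr (2 * \<mu>) * r powr (2 * (\<gamma> - \<mu>)) = r powr (2 * \<gamma>)"
    unfolding powr_add[symmetric] by (simp add: algebra_simps)
  moreover have "0 \<le> (1 / l)\<^sup>2 * (r - 1 - l\<^sup>2)\<^sup>2" by simp
  ultimately show ?thesis by linarith
next
  case False
  have l1: "1 \<le> l\<^sup>2" using l by (simp add: one_le_power)
  have "r powr (2 * \<gamma>) \<le> r powr 1" using r \<gamma> by (intro powr_mono) auto
  then have "r powr (2 * \<gamma>) \<le> r" using r by simp
  also have "r \<le> (1 / l)\<^sup>2 * (r - 1 - l\<^sup>2)\<^sup>2"
  proof -
    have "(r / 2)\<^sup>2 \<le> (r - 1 - l\<^sup>2)\<^sup>2" using False l1 r by (intro power_mono) linarith+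
    moreover have "l\<^sup>2 * r \<le> (r / 2)\<^sup>2"
    proof -
      have "l\<^sup>2 * r \<le> (r / 4) * r" using False r by (intro mult_right_mono) auto
      then show ?thesis by (simp add: power2_eq_square)
    qed
    ultimately have "l\<^sup>2 * r \<le> (r - 1 - l\<^sup>2)\<^sup>2" by linarith
    then show ?thesis using l by (simp add: field_simps)
  qed
  moreover have "0 \<le> (8 powr \<mu> * l powr (2 * \<mu>))\<^sup>2 * r powr (2 * (\<gamma> - \<mu>))" by simp
  ultimately show ?thesis by linarith
qed

text \<open>For r \<ge> R the decay r^(-N) is at most \<epsilon>. For r < R the frequency l \<ge> 2
  R is so far away that l^2 - (r - 1) \<ge> l^2/2, and the last term is at least l^2, hence at least
  R.\<close>

lemma multiplier_absorb:
  fixes \<epsilon> N \<gamma> \<mu> :: real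
  assumes \<epsilon>: "0 < \<epsilon>" and N: "0 < N" and \<gamma>: "\<gamma> \<le> 1/2" and \<mu>: "0 \<le> \<mu>"
  shows "\<exists>l1\<ge>1. \<forall>l\<ge>l1. \<forall>r\<ge>1. r powr (2 * (\<gamma> - \<mu> - N)) \<le> \<epsilon>\<^sup>2 * r powr (2 * (\<gamma> - \<mu>)) + (2 / l)\<^sup>2 * (r - 1 - l\<^sup>2)\<^sup>2"
proof -
  define R where "R = max 1 (\<epsilon> powr (- (1 / N)))"
  have R: "1 \<le> R" by (simp add: R_def)
  have "r powr (2 * (\<gamma> - \<mu> - N)) \<le> \<epsilon>\<^sup>2 * r powr (2 * (\<gamma> - \<mu>)) + (2 / l)\<^sup>2 * (r - 1 - l\<^sup>2)\<^sup>2"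
    if l: "2 * R \<le> l" and r: "1 \<le> r" for l r
  proof (cases "R \<le> r")
    case True
    have "r powr (- N) \<le> (\<epsilon> powr (- (1 / N))) powr (- N)"
      using True N \<epsilon> by (intro powr_mono2') (auto simp: R_def)
    also have "\<dots> = \<epsilon>" using N \<epsilon> by (simp add: powr_powr)
    finally have "(r powr (- N))\<^sup>2 * r powr (2 * (\<gamma> - \<mu>)) \<le> \<epsilon>\<^sup>2 * r powr (2 * (\<gamma> - \<mu>))"
      by (intro mult_right_mono power_mono) auto
    moreover have "(r powr (- N))\<^sup>2 * r powr (2 * (\<gamma> - \<mu>)) = r powr (2 * (\<gamma> - \<mu> - N))"
      unfolding power2_eq_square powr_add[symmetric] by (simp add: algebra_simps)
    moreover have "0 \<le> (2 / l)\<^sup>2 * (r - 1 - l\<^sup>2)\<^sup>2" by simp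
    ultimately show ?thesis by linarith
  next
    case False
    have "r powr (2 * (\<gamma> - \<mu> - N)) \<le> r powr 1" using r \<gamma> \<mu> N by (intro powr_mono) auto
    then have 1: "r powr (2 * (\<gamma> - \<mu> - N)) \<le> R" using r False by simp
    have "l * 2 \<le> l * l" using l R by (intro mult_left_mono) auto
    then have "4 * R \<le> l * l" using l by linarith
    then have "2 * R \<le> l\<^sup>2 / 2" by (simp add: power2_eq_square)
    then have "l\<^sup>2 / 2 \<le> l\<^sup>2 - (r - 1)" using False R by linarith
    then have "(l\<^sup>2 / 2)\<^sup>2 \<le> (l\<^sup>2 - (r - 1))\<^sup>2" by (intro power_mono) auto
    also have "\<dots> = (r - 1 - l\<^sup>2)\<^sup>2" by (simp add: power2_commute)
    finally have "(2 / l)\<^sup>2 * (l\<^sup>2 / 2)\<^sup>2 \<le> (2 / l)\<^sup>2 * (r - 1 - l\<^sup>2)\<^sup>2" by (intro mult_left_mono) auto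
    moreover have "(2 / l)\<^sup>2 * (l\<^sup>2 / 2)\<^sup>2 = l\<^sup>2" using l R by (simp add: power2_eq_square)
    moreover have "0 \<le> \<epsilon>\<^sup>2 * r powr (2 * (\<gamma> - \<mu>))" by simp
    ultimately show ?thesis using 1 \<open>2 * R \<le> l\<^sup>2 / 2\<close> R by linarith
  qed
  then show ?thesis using R by (intro exI[of _ "2 * R"]) auto
qed

text \<open>Splitting at r = L^2 gives the weights for which the two terms balance when L ||z|| and
  ||\<Lambda>^(1/2) z|| are of equal size.\<close>

lemma multiplier_interpolate:
  fixes r L \<gamma> :: real
  assumes r: "1 \<le> r" and L: "1 \<le> L" and \<gamma>: "0 \<le> \<gamma>" "\<gamma> \<le> 1/2"
  shows "r powr (2 * \<gamma>) \<le> (L powr (2 * \<gamma>))\<^sup>2 * r powr (2 * 0) + (L powr (2 * \<gamma> - 1))\<^sup>2 * r powr (2 * (1/2))"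
proof (cases "r \<le> L\<^sup>2")
  case True
  have "r powr (2 * \<gamma>) \<le> (L\<^sup>2) powr (2 * \<gamma>)" using True r \<gamma> by (intro powr_mono2) auto
  also have "\<dots> = (L powr (2 * \<gamma>))\<^sup>2"
    using L by (simp add: powr_square power2_eq_square[of "L powr _"] flip: powr_add)
  finally show ?thesis using r by (simp add: add_increasing2)
next
  case False
  have "r powr (2 * \<gamma> - 1) \<le> (L\<^sup>2) powr (2 * \<gamma> - 1)" using False L \<gamma> by (intro powr_mono2') auto
  also have "\<dots> = (L powr (2 * \<gamma> - 1))\<^sup>2"
    using L by (simp add: powr_square power2_eq_square[of "L powr _"] flip: powr_add)
  finally have "r powr (2 * \<gamma> - 1) * r powr 1 \<le> (L powr (2 * \<gamma> - 1))\<^sup>2 * r powr 1"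
    by (intro mult_right_mono) auto
  moreover have "r powr (2 * \<gamma> - 1) * r powr 1 = r powr (2 * \<gamma>)" unfolding powr_add[symmetric] by simp
  moreover have "2 * (1/2) = (1::real)" by simp
  ultimately have "r powr (2 * \<gamma>) \<le> (L powr (2 * \<gamma> - 1))\<^sup>2 * r powr (2 * (1/2))" by metis
  then show ?thesis by (rule add_increasing[rotated]) simp
qed

lemma japanese_ge: "1 \<le> japanese l" "\<bar>l\<bar> \<le> japanese l" and japanese_square: "(japanese l)\<^sup>2 = 1 + l\<^sup>2"
  unfolding japanese_def by (auto intro: real_le_rsqrt)

text \<open>For r \<ge> L^2/4 the factor r^(-2 \<mu>) has the right size. For smaller r, |r - 1 -
  l^2| \<ge> L^2/2. There, if \<mu> > \<gamma>, the left side can be as large as 1 at r = 1, and a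
  nonnegative exponent of L is needed on the right: this is the condition \<mu> \<le> 1/2 +
  \<gamma>.\<close>

lemma multiplier_shift:
  fixes r l \<gamma> \<mu> :: real
  assumes r: "1 \<le> r" and \<mu>: "0 \<le> \<mu>" "\<mu> \<le> 1/2 + \<gamma>"
  defines "L \<equiv> japanese l"
  shows "r powr (2 * (\<gamma> - \<mu>)) \<le> (2 * 4 powr \<mu> * L powr (- (2 * \<mu>)))\<^sup>2 * r powr (2 * \<gamma>)
    + (2 * L powr (2 * (\<gamma> - \<mu>) - 1))\<^sup>2 * (r - 1 - l\<^sup>2)\<^sup>2"
proof (cases "L\<^sup>2 / 4 \<le> r")
  case True
  have L: "1 \<le> L" unfolding L_def by (rule japanese_ge)
  have "r powr (- (2 * \<mu>)) \<le> (L\<^sup>2 / 4) powr (- (2 * \<mu>))" using True L \<mu> by (intro powr_mono2') auto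
  also have "\<dots> = (4 powr \<mu> * L powr (- (2 * \<mu>)))\<^sup>2"
  proof -
    have "(4 powr \<mu> * L powr (- (2 * \<mu>)))\<^sup>2 = (4 powr \<mu> * 4 powr \<mu>) * (L powr (- (2 * \<mu>)) * L powr (- (2 * \<mu>)))"
      by (simp add: power2_eq_square)
    also have "\<dots> = 4 powr (2 * \<mu>) * L powr (2 * (- (2 * \<mu>)))" unfolding powr_add[symmetric] by simp
    also have "\<dots> = (L\<^sup>2) powr (- (2 * \<mu>)) / 4 powr (- (2 * \<mu>))"
      using L by (simp add: powr_square powr_minus field_simps)
    finally show ?thesis by (simp add: powr_divide)
  qed
  also have "\<dots> \<le> (2 * 4 powr \<mu> * L powr (- (2 * \<mu>)))\<^sup>2" by (intro power_mono) auto
  finally have "r powr (- (2 * \<mu>)) * r powr (2 * \<gamma>) \<le> (2 * 4 powr \<mu> * L powr (- (2 * \<mu>)))\<^sup>2 * r powr (2 * \<gamma>)"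
    by (intro mult_right_mono) auto
  moreover have "r powr (- (2 * \<mu>)) * r powr (2 * \<gamma>) = r powr (2 * (\<gamma> - \<mu>))"
    unfolding powr_add[symmetric] by (simp add: algebra_simps)
  moreover have "0 \<le> (2 * L powr (2 * (\<gamma> - \<mu>) - 1))\<^sup>2 * (r - 1 - l\<^sup>2)\<^sup>2" by simp
  ultimately show ?thesis by linarith
next
  case False
  have L: "1 \<le> L" unfolding L_def by (rule japanese_ge)
  have "L\<^sup>2 / 2 \<le> l\<^sup>2 - (r - 1)" using False r japanese_square[of l] unfolding L_def by linarith
  then have "(L\<^sup>2 / 2)\<^sup>2 \<le> (l\<^sup>2 - (r - 1))\<^sup>2" by (intro power_mono) auto
  also have "\<dots> = (r - 1 - l\<^sup>2)\<^sup>2" by (simp add: power2_commute)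
  finally have "(2 * L powr (2 * (\<gamma> - \<mu>) - 1))\<^sup>2 * (L\<^sup>2 / 2)\<^sup>2 \<le> (2 * L powr (2 * (\<gamma> - \<mu>) - 1))\<^sup>2 * (r - 1 - l\<^sup>2)\<^sup>2"
    by (intro mult_left_mono) auto
  moreover have "(2 * L powr (2 * (\<gamma> - \<mu>) - 1))\<^sup>2 * (L\<^sup>2 / 2)\<^sup>2 = L powr (2 * (2 * (\<gamma> - \<mu>) + 1))"
  proof -
    have "L\<^sup>2 = L powr 2" using L by simp
    then have "2 * L powr (2 * (\<gamma> - \<mu>) - 1) * (L\<^sup>2 / 2) = L powr (2 * (\<gamma> - \<mu>) + 1)"
      by (simp add: add.commute flip: powr_add)
    then have "(2 * L powr (2 * (\<gamma> - \<mu>) - 1) * (L\<^sup>2 / 2))\<^sup>2 = L powr (2 * (2 * (\<gamma> - \<mu>) + 1))"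
      by (simp add: power2_eq_square algebra_simps flip: powr_add)
    then show ?thesis by (simp only: power_mult_distrib[symmetric])
  qed
  moreover have "r powr (2 * (\<gamma> - \<mu>)) \<le> L powr (2 * (2 * (\<gamma> - \<mu>) + 1))"
  proof (cases "\<mu> \<le> \<gamma>")
    case True
    have "r \<le> 4 * r" "4 * r < L\<^sup>2" using False r by simp_all
    then have "r \<le> L\<^sup>2" by (rule order_trans[OF _ less_imp_le])
    then have "r powr (2 * (\<gamma> - \<mu>)) \<le> (L\<^sup>2) powr (2 * (\<gamma> - \<mu>))"
      using True r by (intro powr_mono2) auto
    also have "\<dots> \<le> L powr (2 * (2 * (\<gamma> - \<mu>) + 1))"
      using L by (simp add: powr_square powr_mono)
    finally show ?thesis .
  next
    case False
    then have "r powr (2 * (\<gamma> - \<mu>)) \<le> 1" using r powr_mono[of "2 * (\<gamma> - \<mu>)" 0 r] by simp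
    also have "1 \<le> L powr (2 * (2 * (\<gamma> - \<mu>) + 1))" using L \<mu> by (intro ge_one_powr_ge_zero) auto
    finally show ?thesis .
  qed
  moreover have "0 \<le> (2 * 4 powr \<mu> * L powr (- (2 * \<mu>)))\<^sup>2 * r powr (2 * \<gamma>)" by simp
  ultimately show ?thesis by linarith
qed

text \<open>Here a is ||u||, \<phi> is ||F|| / |l|, q is ||Q u|| and t is |l|^(2 \<mu>). From q^2
  \<le> \<phi> a one gets 2 k q \<le> k^2 \<phi> + a, so half of a is absorbed. The lower bound c of
  M brings the linear term t M below t^2 M^2 / c.\<close>

lemma absorb_damping:
  fixes a \<phi> q t K M m c :: real
  assumes nonneg: "0 \<le> a" "0 \<le> \<phi>" "0 \<le> q" "0 \<le> K" "0 \<le> m" and t: "1 \<le> t" and c: "0 < c" "c \<le> M"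
    and le: "a \<le> K * t * (M * \<phi> + (M + m) * q)" and q: "q\<^sup>2 \<le> \<phi> * a"
  shows "a \<le> (2 * K / c + 2 * K\<^sup>2) * (t\<^sup>2 * (M\<^sup>2 + m\<^sup>2)) * \<phi>"
proof -
  define k where "k = K * t * (M + m)"
  have "2 * (k * q) \<le> k\<^sup>2 * \<phi> + a"
  proof (rule power2_le_imp_le)
    have "(2 * (k * q))\<^sup>2 = 4 * k\<^sup>2 * q\<^sup>2" by (simp add: power2_eq_square)
    also have "\<dots> \<le> 4 * k\<^sup>2 * (\<phi> * a)" using q by (intro mult_left_mono) auto
    also have "\<dots> \<le> (k\<^sup>2 * \<phi> + a)\<^sup>2"
      using zero_le_power2[of "k\<^sup>2 * \<phi> - a"] by (simp add: power2_eq_square algebra_simps)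
    finally show "(2 * (k * q))\<^sup>2 \<le> (k\<^sup>2 * \<phi> + a)\<^sup>2" .
    show "0 \<le> k\<^sup>2 * \<phi> + a" using nonneg by auto
  qed
  then have 1: "a \<le> 2 * K * (t * M) * \<phi> + k\<^sup>2 * \<phi>"
    using le unfolding k_def by (simp add: algebra_simps)
  have "t * M \<le> t\<^sup>2 * (M\<^sup>2 / c)"
  proof (rule mult_mono)
    show "t \<le> t\<^sup>2" using t by (simp add: power2_eq_square)
    show "M \<le> M\<^sup>2 / c" using c by (simp add: field_simps power2_eq_square)
  qed (use t c in auto)
  also have "\<dots> \<le> (t\<^sup>2 * (M\<^sup>2 + m\<^sup>2)) / c" using c by (simp add: divide_right_mono mult_left_mono)
  finally have 2: "2 * K * (t * M) * \<phi> \<le> 2 * K * ((t\<^sup>2 * (M\<^sup>2 + m\<^sup>2)) / c) * \<phi>"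
    using nonneg by (intro mult_right_mono mult_left_mono) auto
  have "(M + m)\<^sup>2 \<le> 2 * (M\<^sup>2 + m\<^sup>2)"
    using zero_le_power2[of "M - m"] by (simp add: power2_eq_square algebra_simps)
  then have "K\<^sup>2 * t\<^sup>2 * (M + m)\<^sup>2 \<le> K\<^sup>2 * t\<^sup>2 * (2 * (M\<^sup>2 + m\<^sup>2))" by (intro mult_left_mono) auto
  then have "k\<^sup>2 \<le> 2 * K\<^sup>2 * (t\<^sup>2 * (M\<^sup>2 + m\<^sup>2))" 
    by (simp only: k_def power_mult_distrib mult_ac)
  then have 3: "k\<^sup>2 * \<phi> \<le> 2 * K\<^sup>2 * (t\<^sup>2 * (M\<^sup>2 + m\<^sup>2)) * \<phi>" using nonneg by (intro mult_right_mono) auto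
  have "(2 * K / c + 2 * K\<^sup>2) * (t\<^sup>2 * (M\<^sup>2 + m\<^sup>2)) * \<phi>
      = 2 * K * ((t\<^sup>2 * (M\<^sup>2 + m\<^sup>2)) / c) * \<phi> + 2 * K\<^sup>2 * (t\<^sup>2 * (M\<^sup>2 + m\<^sup>2)) * \<phi>"
    by (simp add: algebra_simps add_divide_distrib)
  with 1 2 3 show ?thesis by linarith
qed

context damped
begin

section \<open>From the control estimate to the resolvent\<close>

lemma control_imp_weak_bound:
  assumes ctl: "control_estimate E P \<gamma> Q \<mu> l0 N C M m"
    and \<mu>: "0 \<le> \<mu>" and N: "0 < N" and C: "0 < C"
    and c0: "0 < c0" "\<And>x. 0 \<le> x \<Longrightarrow> c0 \<le> M x" and m: "\<And>x. 0 \<le> x \<Longrightarrow> 0 \<le> m x"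
  shows "\<exists>l1\<ge>1. \<exists>B>0. \<forall>l u F. l1 \<le> \<bar>l\<bar> \<longrightarrow> weak_sol l u (Lam (- (1/2)) F) \<longrightarrow>
    \<bar>l\<bar> * norm u \<le> B * (\<bar>l\<bar> powr (4 * \<mu>) * ((M \<bar>l\<bar>)\<^sup>2 + (m \<bar>l\<bar>)\<^sup>2)) * norm F"
proof -
  obtain T' c where c: "0 < c" and T': "\<And>u y. u \<in> dm \<gamma> \<Longrightarrow> cinner y (Q u) = cinner (T' y) (Lam \<gamma> u)"
    and T'_le: "\<And>y. norm (T' y) \<le> c * norm y"
    using Q_adjoint by blast
  \<comment> \<open>With \<epsilon> = 1/(2 C) the error term of the control estimate contributes at
    most half of the norm of w, besides a multiple of the norm of h.\<close>
  obtain l2 where l2: "1 \<le> l2" and absorb: "\<And>l r. l2 \<le> l \<Longrightarrow> 1 \<le> r \<Longrightarrow>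
      r powr (2 * (\<gamma> - \<mu> - N)) \<le> (1 / (2 * C))\<^sup>2 * r powr (2 * (\<gamma> - \<mu>)) + (2 / l)\<^sup>2 * (r - 1 - l\<^sup>2)\<^sup>2"
    using multiplier_absorb[of "1 / (2 * C)" N \<gamma> \<mu>] C N \<gamma>_le \<mu> by auto
  \<comment> \<open>Absorbing half of ||w|| doubles the main part X = M ||h|| / \<eta> + m q and
    leaves 4 C ||h|| / \<eta>, which is at most (4 C / c0) X.\<close>
  define K1 where "K1 = 2 + 4 * C / c0"
  define K where "K = (8 powr \<mu> * K1 + 1 / c0) * (1 + c)"
  define B where "B = 2 * K / c0 + 2 * K\<^sup>2"
  have K1: "0 < K1" unfolding K1_def using C c0 by (simp add: add_pos_nonneg)
  have K: "0 < K" unfolding K_def using K1 c0 c by (intro mult_pos_pos add_pos_pos) auto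
  have B: "0 < B" unfolding B_def using K c0 by (intro add_pos_nonneg) auto
  have main: "\<bar>l\<bar> * norm u \<le> B * (\<bar>l\<bar> powr (4 * \<mu>) * ((M \<bar>l\<bar>)\<^sup>2 + (m \<bar>l\<bar>)\<^sup>2)) * norm F"
    if l: "max l2 l0 \<le> \<bar>l\<bar>" and sol: "weak_sol l u (Lam (- (1/2)) F)" for l u F
  proof -
    define \<eta> where "\<eta> = \<bar>l\<bar>"
    have \<eta>: "1 \<le> \<eta>" "l2 \<le> \<eta>" "l0 \<le> \<eta>" "\<eta>\<^sup>2 = l\<^sup>2" using l l2 by (auto simp: \<eta>_def)
    obtain x where x: "x \<in> dm 1" and ux: "u = Lam \<gamma> x"
      and hx: "Lam 1 x - (1 + l\<^sup>2) *\<^sub>R x = Lam (- \<gamma>) F + (\<i> * l) *\<^sub>C T' (Q u)"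
      using weak_sol_regular[OF sol T'] by blast
    define h where "h = Lam 1 x - (1 + l\<^sup>2) *\<^sub>R x"
    define q where "q = norm (Q u)"
    define \<phi> where "\<phi> = norm F / \<eta>"
    define t where "t = \<eta> powr (2 * \<mu>)"
    \<comment> \<open>Equal to \<Lambda>^(-\<mu>) u; written through x, whose membership in H_1 puts
      w into the space where the control estimate applies.\<close>
    define w where "w = Lam (\<gamma> - \<mu>) x"
    have t: "1 \<le> t" unfolding t_def using \<eta> \<mu> by (intro ge_one_powr_ge_zero) auto
    have Mm: "c0 \<le> M \<eta>" "0 \<le> m \<eta>" using c0(2) m \<eta> by auto
    have M0: "0 < M \<eta>" using Mm c0 by linarith
    have pos: "0 \<le> q" "0 \<le> \<phi>" using \<eta> by (auto simp: q_def \<phi>_def)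
    have mem: "x \<in> dm s" if "s \<le> 1" for s using x that by (rule dm_mono)
    have exps: "\<gamma> - \<mu> \<le> 1" "\<gamma> \<le> 1" "\<gamma> - \<mu> - N \<le> 1" using \<gamma>_le \<mu> N by auto
    have h: "norm h / \<eta> \<le> \<phi> + c * q"
    proof -
      have "norm h \<le> norm (Lam (- \<gamma>) F) + \<eta> * norm (T' (Q u))"
        unfolding h_def hx using norm_triangle_ineq[of "Lam (- \<gamma>) F" "(\<i> * l) *\<^sub>C T' (Q u)"]
        by (simp add: norm_scaleC norm_mult \<eta>_def)
      also have "\<dots> \<le> norm F + \<eta> * (c * q)"
        using T'_le[of "Q u"] norm_Lam_nonpos[of "- \<gamma>" F] \<gamma>_nonneg \<eta>
        by (intro add_mono mult_left_mono) (auto simp: q_def)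
      finally show ?thesis using \<eta> by (simp add: \<phi>_def field_simps)
    qed
    have wmem: "w \<in> Hs E (1 + \<mu> - \<gamma>)"
      using \<mu> \<gamma>_le Hs_eq[of "1 + \<mu> - \<gamma>"] mem[OF exps(1)] x unfolding w_def by (auto intro: Lam_memI)
    have Lw: "Lam (\<mu> - \<gamma>) w = x" "Lam \<mu> w = u" "Lam (- N) w = Lam (\<gamma> - \<mu> - N) x"
      unfolding w_def ux using mem exps Lam_compI[of x "\<gamma> - \<mu>" 0 "\<mu> - \<gamma>"]
      by (auto intro!: Lam_compI)
    have Px: "P x - \<eta>\<^sup>2 *\<^sub>R x = h" unfolding P_eq[OF x] h_def \<eta>(4) by (simp add: algebra_simps)
    have jap: "M \<eta> * inverse (japanese \<eta>) * norm h \<le> M \<eta> * (norm h / \<eta>)"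
    proof -
      have "inverse (japanese \<eta>) \<le> inverse \<eta>" using japanese_ge(2)[of \<eta>] \<eta> by (intro le_imp_inverse_le) auto
      then have "M \<eta> * (inverse (japanese \<eta>) * norm h) \<le> M \<eta> * (inverse \<eta> * norm h)"
        using M0 by (intro mult_left_mono mult_right_mono) auto
      then show ?thesis by (simp add: divide_inverse mult_ac)
    qed
    have w1: "norm w \<le> M \<eta> * (norm h / \<eta>) + m \<eta> * q + C * norm (Lam (\<gamma> - \<mu> - N) x)"
    proof -
      have "norm w \<le> M \<eta> * inverse (japanese \<eta>) * norm h + m \<eta> * q + C * norm (Lam (\<gamma> - \<mu> - N) x)"
        using ctl[unfolded control_estimate_def, rule_format, OF wmem \<eta>(3)]
        unfolding Lw Px q_def .
      with jap show ?thesis by linarith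
    qed
    have s: "norm (Lam (\<gamma> - \<mu> - N) x) \<le> 1 / (2 * C) * norm w + 2 / \<eta> * norm h"
    proof (rule sqrt_sum_le)
      show "(norm (Lam (\<gamma> - \<mu> - N) x))\<^sup>2 \<le> (1 / (2 * C) * norm w)\<^sup>2 + (2 / \<eta> * norm h)\<^sup>2"
        unfolding power_mult_distrib w_def h_def
        by (rule Lam_shift_norm_le) (use mem exps absorb[OF \<eta>(2)] \<eta>(4) in auto)
    qed (use C \<eta> in auto)
    have Z0: "0 \<le> M \<eta> * (norm h / \<eta>) + m \<eta> * q" using M0 Mm pos \<eta> by (intro add_nonneg_nonneg mult_nonneg_nonneg) auto
    have hM: "norm h / \<eta> \<le> (M \<eta> * (norm h / \<eta>) + m \<eta> * q) / c0"
    proof -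
      have "c0 * (norm h / \<eta>) \<le> M \<eta> * (norm h / \<eta>)" using Mm \<eta> by (intro mult_right_mono) auto
      moreover have "0 \<le> m \<eta> * q" using Mm pos by simp
      ultimately have "c0 * (norm h / \<eta>) \<le> M \<eta> * (norm h / \<eta>) + m \<eta> * q" by linarith
      then show ?thesis using c0 by (simp add: le_divide_eq mult.commute)
    qed
    have w2: "norm w \<le> K1 * (M \<eta> * (norm h / \<eta>) + m \<eta> * q)"
    proof -
      have "C * norm (Lam (\<gamma> - \<mu> - N) x) \<le> C * (1 / (2 * C) * norm w + 2 / \<eta> * norm h)"
        using s C by (intro mult_left_mono) auto
      also have "\<dots> = norm w / 2 + 2 * (C * (norm h / \<eta>))" using C by (simp add: field_simps)
      finally have s': "C * norm (Lam (\<gamma> - \<mu> - N) x) \<le> norm w / 2 + 2 * (C * (norm h / \<eta>))" .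
      have "a \<le> 2 * X + 4 * Y" if "a \<le> X + s" "s \<le> a / 2 + 2 * Y" for a X s Y :: real
        using that by linarith
      from this[OF w1 s'] have "norm w \<le> 2 * (M \<eta> * (norm h / \<eta>) + m \<eta> * q) + 4 * C * (norm h / \<eta>)"
        by (simp only: mult.assoc)
      also have "4 * C * (norm h / \<eta>) \<le> 4 * C * ((M \<eta> * (norm h / \<eta>) + m \<eta> * q) / c0)"
        using hM C by (intro mult_left_mono) auto
      finally show ?thesis by (simp add: K1_def distrib_right)
    qed
    have "norm u \<le> 8 powr \<mu> * t * norm w + 1 / \<eta> * norm h"
    proof (rule sqrt_sum_le)
      show "(norm u)\<^sup>2 \<le> (8 powr \<mu> * t * norm w)\<^sup>2 + (1 / \<eta> * norm h)\<^sup>2"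
        unfolding power_mult_distrib[of _ "norm _"] w_def h_def t_def ux
        by (rule Lam_shift_norm_le)
          (use mem exps multiplier_high_low[OF _ \<eta>(1) \<gamma>_le \<mu>] \<eta>(4) in auto)
    qed (use t \<eta> in auto)
    also have "\<dots> \<le> t * (8 powr \<mu> * K1 + 1 / c0) * (M \<eta> * (norm h / \<eta>) + m \<eta> * q)"
    proof -
      have 1: "8 powr \<mu> * t * norm w \<le> 8 powr \<mu> * t * (K1 * (M \<eta> * (norm h / \<eta>) + m \<eta> * q))"
        using w2 t by (intro mult_left_mono) auto
      have "1 * (norm h / \<eta>) \<le> t * ((M \<eta> * (norm h / \<eta>) + m \<eta> * q) / c0)"
        using hM t \<eta> by (intro mult_mono) auto
      then have 2: "1 / \<eta> * norm h \<le> t * ((M \<eta> * (norm h / \<eta>) + m \<eta> * q) / c0)" by simp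
      have expand: "t * (e * K1 + 1 / c0) * Z = e * t * (K1 * Z) + t * (Z / c0)" for e Z
        by (simp add: algebra_simps)
      show ?thesis unfolding expand by (rule add_mono[OF 1 2])
    qed
    also have "\<dots> \<le> t * (8 powr \<mu> * K1 + 1 / c0) * ((1 + c) * (M \<eta> * \<phi> + (M \<eta> + m \<eta>) * q))"
    proof (rule mult_left_mono)
      have "M \<eta> * (norm h / \<eta>) \<le> M \<eta> * (\<phi> + c * q)" using h M0 by (intro mult_left_mono) auto
      moreover have "0 \<le> c * (M \<eta> * \<phi>)" "0 \<le> c * (m \<eta> * q)" "0 \<le> M \<eta> * q" using c M0 Mm pos by auto
      ultimately show "M \<eta> * (norm h / \<eta>) + m \<eta> * q \<le> (1 + c) * (M \<eta> * \<phi> + (M \<eta> + m \<eta>) * q)"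
        by (simp add: algebra_simps)
    qed (use t K1 c0 in auto)
    also have "\<dots> = K * t * (M \<eta> * \<phi> + (M \<eta> + m \<eta>) * q)" by (simp add: K_def)
    finally have u1: "norm u \<le> K * t * (M \<eta> * \<phi> + (M \<eta> + m \<eta>) * q)" .
    have "q\<^sup>2 \<le> \<phi> * norm u"
      using weak_sol_damping[OF sol] \<eta> by (simp add: q_def \<phi>_def \<eta>_def field_simps)
    then have "norm u \<le> (2 * K / c0 + 2 * K\<^sup>2) * (t\<^sup>2 * ((M \<eta>)\<^sup>2 + (m \<eta>)\<^sup>2)) * \<phi>"
      using u1 pos K Mm c0 t by (intro absorb_damping) auto
    then have "\<eta> * norm u \<le> \<eta> * (B * (t\<^sup>2 * ((M \<eta>)\<^sup>2 + (m \<eta>)\<^sup>2)) * \<phi>)"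
      unfolding B_def using \<eta> by (intro mult_left_mono) auto
    also have "\<dots> = B * (t\<^sup>2 * ((M \<eta>)\<^sup>2 + (m \<eta>)\<^sup>2)) * norm F" using \<eta> by (simp add: \<phi>_def)
    also have "t\<^sup>2 = \<eta> powr (4 * \<mu>)" by (simp add: t_def power2_eq_square flip: powr_add)
    finally show ?thesis unfolding \<eta>_def .
  qed
  show ?thesis
    using main B l2 by (intro exI[of _ "max l2 l0"] conjI exI[of _ B]) auto
qed

section \<open>From weak solutions to the resolvent in the energy norm\<close>

lemma energy_norm_le: "energy_norm E (a, b) \<le> norm (Lam (1/2) a) + norm b"
  unfolding energy_norm_def by (rule real_le_lsqrt) (auto simp: power2_sum)

lemma energy_norm_ge: "norm (Lam (1/2) a) \<le> energy_norm E (a, b)" "norm b \<le> energy_norm E (a, b)"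
  unfolding energy_norm_def by (auto intro: real_le_rsqrt)

text \<open>In terms of the reduced unknown y the preimage of (f, g) is (y - (i/l) f, - i l y);
  unique solvability for y gives the bijection, and a bound for this pair gives the operator
  norm.\<close>

lemma resolvent_bound:
  assumes l: "l \<noteq> 0" and ex: "\<And>\<phi>. \<exists>y. weak_sol l y \<phi>" and uniq: "\<And>y. weak_sol l y 0 \<Longrightarrow> y = 0"
    and bound: "\<And>y f g. f \<in> V \<Longrightarrow> weak_sol l y (reduced_rhs l f g) \<Longrightarrow>
      energy_norm E (y - (\<i> / l) *\<^sub>C f, - ((\<i> * l) *\<^sub>C y)) \<le> B * energy_norm E (f, g)"
    and B: "0 \<le> B"
  shows "gen_invertible E P \<gamma> Q l" and "energy_opnorm E (gen_resolvent E P \<gamma> Q l) \<le> B"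
proof -
  let ?A = "gen_shift E P \<gamma> Q l" and ?D = "gen_dom E P \<gamma> Q"
  have inj: "inj_on ?A ?D"
  proof (rule inj_onI)
    fix x x' assume x: "x \<in> ?D" "x' \<in> ?D" and eq: "?A x = ?A x'"
    obtain u w u' w' f g where xx: "x = (u, w)" "x' = (u', w')" "?A x = (f, g)" by (metis prod.collapse)
    then have A: "(u, w) \<in> ?D \<and> ?A (u, w) = (f, g)" "(u', w') \<in> ?D \<and> ?A (u', w') = (f, g)"
      using x eq by auto
    then have f: "f \<in> V" unfolding gen_shift_iff by (auto intro: dm_add dm_scaleC)
    define y y' where yy: "y = u + (\<i> / l) *\<^sub>C f" "y' = u' + (\<i> / l) *\<^sub>C f"
    have "weak_sol l y (reduced_rhs l f g)" "weak_sol l y' (reduced_rhs l f g)"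
      and w: "w = - ((\<i> * l) *\<^sub>C y)" "w' = - ((\<i> * l) *\<^sub>C y')"
      using A unfolding gen_shift_reduced[OF f l] yy by auto
    then have "weak_sol l (y - y') 0"
      by (auto simp: weak_sol_def dm_diff form_diff_left)
    then have "y = y'" using uniq[of "y - y'"] by simp
    then show "x = x'" using w by (simp add: xx yy)
  qed
  have sub: "?A ` ?D \<subseteq> energy_space E"
  proof
    fix z assume "z \<in> ?A ` ?D"
    then obtain u w where uw: "(u, w) \<in> ?D" "z = ?A (u, w)" by auto
    obtain f g where fg: "?A (u, w) = (f, g)" by (metis prod.collapse)
    have "f \<in> V" using gen_shift_iff[of u w l f g] uw(1) fg by (auto intro: dm_add dm_scaleC)
    then show "z \<in> energy_space E" using uw fg by (simp add: energy_space_def Hs_V)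
  qed
  have sol: "\<exists>x\<in>?D. ?A x = (f, g) \<and> energy_norm E x \<le> B * energy_norm E (f, g)" if f: "f \<in> V" for f g
  proof -
    obtain y where y: "weak_sol l y (reduced_rhs l f g)" using ex by blast
    have "(y - (\<i> / l) *\<^sub>C f, - ((\<i> * l) *\<^sub>C y)) \<in> ?D \<and> ?A (y - (\<i> / l) *\<^sub>C f, - ((\<i> * l) *\<^sub>C y)) = (f, g)"
      unfolding gen_shift_reduced[OF f l] using y by simp
    then show ?thesis using bound[OF f y] by blast
  qed
  have bij: "bij_betw ?A ?D (energy_space E)"
  proof (rule bij_betw_imageI[OF inj])
    have "z \<in> ?A ` ?D" if "z \<in> energy_space E" for z
    proof -
      obtain f g where z: "z = (f, g)" by (cases z)
      then have f: "f \<in> V" using that by (simp add: energy_space_def Hs_V)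
      from sol[OF f, of g] obtain x where "x \<in> ?D" "?A x = z" unfolding z by blast
      then show ?thesis by blast
    qed
    then show "?A ` ?D = energy_space E" using sub by blast
  qed
  have res: "energy_norm E (gen_resolvent E P \<gamma> Q l z) \<le> B * energy_norm E z" if "z \<in> energy_space E" for z
  proof -
    obtain f g where z: "z = (f, g)" by (cases z)
    then have "f \<in> V" using that by (simp add: energy_space_def Hs_V)
    from sol[OF this, of g] obtain x where x: "x \<in> ?D" "?A x = z" "energy_norm E x \<le> B * energy_norm E z"
      unfolding z by blast
    have "gen_resolvent E P \<gamma> Q l z = x"
      unfolding gen_resolvent_def using inv_into_f_f[OF inj x(1)] x(2) by simp
    then show ?thesis using x(3) by simp
  qed
  show "gen_invertible E P \<gamma> Q l" unfolding gen_invertible_def using bij res by blast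
  show "energy_opnorm E (gen_resolvent E P \<gamma> Q l) \<le> B"
    unfolding energy_opnorm_def
  proof (rule cSup_least)
    have "(0, 0) \<in> energy_space E" by (simp add: energy_space_def Hs_V dm_zero)
    moreover have "energy_norm E (0, 0) \<le> 1" using energy_norm_le[of 0 0] by (simp add: Lam_zero)
    ultimately show "{energy_norm E (gen_resolvent E P \<gamma> Q l x) |x. x \<in> energy_space E \<and> energy_norm E x \<le> 1} \<noteq> {}"
      by blast
    fix z assume "z \<in> {energy_norm E (gen_resolvent E P \<gamma> Q l x) |x. x \<in> energy_space E \<and> energy_norm E x \<le> 1}"
    then obtain x where x: "z = energy_norm E (gen_resolvent E P \<gamma> Q l x)" "x \<in> energy_space E" "energy_norm E x \<le> 1"
      by blast
    have "B * energy_norm E x \<le> B * 1" using x B by (intro mult_left_mono) auto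
    then show "z \<le> B" using res[OF x(2)] x(1) by simp
  qed
qed

text \<open>The hypothesis covers k = l and k = -l, because existence and the dual bound for l rest
  on the problem at -l. The lower bound c of \<kappa> turns additive constants into multiples of
  \<kappa>.\<close>

lemma weak_bound_imp_resolvent:
  assumes l: "1 \<le> \<bar>l\<bar>" and C: "0 < C" and c: "0 < c" "c \<le> \<kappa>"
    and lb: "\<And>k u F. \<bar>k\<bar> = \<bar>l\<bar> \<Longrightarrow> weak_sol k u (Lam (- (1/2)) F) \<Longrightarrow> \<bar>l\<bar> * norm u \<le> C * \<kappa> * norm F"
  shows "gen_invertible E P \<gamma> Q l"
    and "energy_opnorm E (gen_resolvent E P \<gamma> Q l) \<le> (15 * C + 12 / c) * \<kappa>"
proof -
  \<comment> \<open>The constant of the bound from H to H_(1/2): 2 C from 2 |l| ||u||, and 1/c from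
    ||F|| \<le> (\<kappa> / c) ||F||.\<close>
  define C2 where "C2 = 2 * C + 1 / c"
  have \<kappa>: "0 < \<kappa>" "1 \<le> \<kappa> / c" using c by auto
  have C2: "0 < C2" using C c by (simp add: C2_def add_pos_pos)
  have l2: "l\<^sup>2 = \<bar>l\<bar>\<^sup>2" "1 + l\<^sup>2 \<le> 2 * \<bar>l\<bar>\<^sup>2" using l one_le_power[OF l, of 2] by auto
  have energy: "norm (Lam (1/2) u) \<le> 2 * (\<bar>l\<bar> * norm u) + norm \<phi>" if k: "\<bar>k\<bar> = \<bar>l\<bar>" and sol: "weak_sol k u \<phi>" for k u \<phi>
  proof (rule sqrt_sum_le)
    have "k\<^sup>2 = l\<^sup>2" using k by (metis power2_abs)
    then have "(norm (Lam (1/2) u))\<^sup>2 \<le> 2 * (1 + l\<^sup>2) * (norm u)\<^sup>2 + (norm \<phi>)\<^sup>2"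
      using weak_sol_energy[OF sol] by simp
    also have "2 * (1 + l\<^sup>2) * (norm u)\<^sup>2 \<le> 2 * (2 * \<bar>l\<bar>\<^sup>2) * (norm u)\<^sup>2"
      using l2 by (intro mult_right_mono mult_left_mono) auto
    finally show "(norm (Lam (1/2) u))\<^sup>2 \<le> (2 * (\<bar>l\<bar> * norm u))\<^sup>2 + (norm \<phi>)\<^sup>2"
      by (simp add: power_mult_distrib)
  qed auto
  have lb': "norm u \<le> C * \<kappa> * norm F" if "\<bar>k\<bar> = \<bar>l\<bar>" "weak_sol k u (Lam (- (1/2)) F)" for k u F
    using lb[OF that] mult_right_mono[OF l, of "norm u"] by simp
  have ex: "\<exists>u. weak_sol k u \<phi>" if "\<bar>k\<bar> = \<bar>l\<bar>" for k \<phi>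
  proof (rule weak_sol_exists[where c = "C * \<kappa>"])
    show "norm u \<le> C * \<kappa> * norm F" if "weak_sol (- k) u (Lam (- (1/2)) F)" for u F
      using lb'[OF _ that] \<open>\<bar>k\<bar> = \<bar>l\<bar>\<close> by simp
  qed (use C \<kappa> in simp)
  have half: "norm (Lam (1/2) u) \<le> (C2 * \<kappa>) * norm F"
    if k: "\<bar>k\<bar> = \<bar>l\<bar>" "weak_sol k u (Lam (- (1/2)) F)" for k u F
  proof -
    have "norm (Lam (- (1/2)) F) \<le> norm F" by (rule norm_Lam_nonpos) simp
    then have "norm (Lam (1/2) u) \<le> 2 * (C * \<kappa> * norm F) + norm F" using energy[OF k] lb[OF k] by linarith
    moreover have "1 * norm F \<le> \<kappa> / c * norm F" using \<kappa> by (intro mult_right_mono) auto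
    ultimately show ?thesis unfolding C2_def by (simp add: algebra_simps)
  qed
  have dual: "norm u \<le> (C2 * \<kappa>) * norm \<phi>" if "weak_sol l u \<phi>" for u \<phi>
    using that
  proof (rule weak_sol_dual_bound)
    show "norm (Lam (1/2) z) \<le> C2 * \<kappa> * norm F" if "weak_sol (- l) z (Lam (- (1/2)) F)" for z F
      using that by (rule half[rotated]) simp
    show "\<exists>z. weak_sol (- l) z \<psi>" for \<psi> by (rule ex) simp
  qed
  have bound: "energy_norm E (y - (\<i> / l) *\<^sub>C f, - ((\<i> * l) *\<^sub>C y)) \<le> (15 * C + 12 / c) * \<kappa> * energy_norm E (f, g)"
    if f: "f \<in> V" and y: "weak_sol l y (reduced_rhs l f g)" for y f g
  proof -
    define a b where ab: "a = norm (Lam (1/2) f)" "b = norm g"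
    have ab0: "0 \<le> a" "0 \<le> b" by (simp_all add: ab)
    have il: "cmod (\<i> / l) = 1 / \<bar>l\<bar>" by (simp add: norm_divide)
    \<comment> \<open>The data are split: y2 takes the part - g in H, for which \<open>lb\<close>
      gains the factor |l|. The rest lies only in H_(-1/2), where \<open>dual\<close> gains nothing
      but the data carry 1/|l|.\<close>
    obtain y2 where y2: "weak_sol l y2 (Lam (- (1/2)) (- g))" using ex by blast
    have np: "- g \<in> dm (- (1/2))" "g \<in> dm (- (1/2))" by (simp_all add: dm_nonpos)
    have Lg: "Lam (- (1/2)) (- g) = - Lam (- (1/2)) g"
      using Lam_scaleR[OF np(2), of "- 1"] by simp
    have "weak_sol l (y - y2) ((\<i> / l) *\<^sub>C (Lam (1/2) f - Lam (- (1/2)) f))"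
      using y y2 unfolding weak_sol_def reduced_rhs_def Lg
      by (auto simp: dm_diff form_diff_left cinner_diff_left cinner_minus_left)
    then have "norm (y - y2) \<le> (C2 * \<kappa>) * norm ((\<i> / l) *\<^sub>C (Lam (1/2) f - Lam (- (1/2)) f))" by (rule dual)
    also have "\<dots> \<le> (C2 * \<kappa>) * (1 / \<bar>l\<bar> * (2 * a))"
    proof (rule mult_left_mono)
      have "norm (Lam (1/2) f - Lam (- (1/2)) f) \<le> 2 * a"
        using norm_triangle_ineq4[of "Lam (1/2) f" "Lam (- (1/2)) f"] norm_Lam_mono[OF f, of "- (1/2)"]
        by (simp add: ab)
      then show "norm ((\<i> / l) *\<^sub>C (Lam (1/2) f - Lam (- (1/2)) f)) \<le> 1 / \<bar>l\<bar> * (2 * a)"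
        unfolding norm_scaleC il by (intro mult_left_mono) auto
    qed (use C2 \<kappa> in auto)
    finally have "\<bar>l\<bar> * norm (y - y2) \<le> \<bar>l\<bar> * ((C2 * \<kappa>) * (1 / \<bar>l\<bar> * (2 * a)))"
      by (intro mult_left_mono) auto
    also have "\<dots> = 2 * (C2 * \<kappa>) * a" using l by simp
    finally have 1: "\<bar>l\<bar> * norm (y - y2) \<le> 2 * (C2 * \<kappa>) * a" .
    have 2: "\<bar>l\<bar> * norm y2 \<le> C * \<kappa> * b" using lb[OF refl y2] by (simp add: ab)
    have "\<bar>l\<bar> * norm y \<le> \<bar>l\<bar> * (norm y2 + norm (y - y2))" using norm_triangle_sub[of y y2] by (intro mult_left_mono) auto
    then have 3: "\<bar>l\<bar> * norm y \<le> 2 * (C2 * \<kappa>) * a + C * \<kappa> * b" using 1 2 by (simp add: distrib_left)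
    have 4: "norm (Lam (1/2) y) \<le> 2 * (\<bar>l\<bar> * norm y) + (2 * a + b)"
      using energy[OF refl y] norm_reduced_rhs[OF f l, of g] by (simp add: ab)
    have yV: "y \<in> V" using y by (simp add: weak_sol_def)
    have "norm (Lam (1/2) (y - (\<i> / l) *\<^sub>C f)) \<le> norm (Lam (1/2) y) + 1 / \<bar>l\<bar> * a"
      using norm_triangle_ineq4[of "Lam (1/2) y" "(\<i> / l) *\<^sub>C Lam (1/2) f"]
      by (simp add: Lam_diff yV dm_scaleC f Lam_scaleC norm_scaleC il ab)
    moreover have "1 / \<bar>l\<bar> * a \<le> 1 * a" using l ab0 by (intro mult_right_mono) auto
    moreover have "norm (- ((\<i> * l) *\<^sub>C y)) = \<bar>l\<bar> * norm y" by (simp add: norm_scaleC norm_mult)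
    ultimately have "energy_norm E (y - (\<i> / l) *\<^sub>C f, - ((\<i> * l) *\<^sub>C y)) \<le> 3 * (\<bar>l\<bar> * norm y) + (3 * a + b)"
      using energy_norm_le[of "y - (\<i> / l) *\<^sub>C f" "- ((\<i> * l) *\<^sub>C y)"] 4 by linarith
    also have "\<dots> \<le> 3 * (2 * (C2 * \<kappa>) * a + C * \<kappa> * b) + 3 * (\<kappa> / c) * (a + b)"
    proof -
      have "1 * (a + b) \<le> \<kappa> / c * (a + b)" using \<kappa> ab0 by (intro mult_right_mono) auto
      then have "3 * (a + b) \<le> 3 * (\<kappa> / c * (a + b))" by simp
      moreover have "3 * a + b \<le> 3 * (a + b)" using ab0 by simp
      ultimately have "3 * a + b \<le> 3 * (\<kappa> / c * (a + b))" by (rule order_trans[rotated])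
      moreover have "3 * (\<bar>l\<bar> * norm y) \<le> 3 * (2 * (C2 * \<kappa>) * a + C * \<kappa> * b)" using 3 by simp
      ultimately show ?thesis unfolding mult.assoc[of 3 "\<kappa> / c"] by (rule add_mono[rotated])
    qed
    \<comment> \<open>The term 6 * C2 is 12 * C + 6 / c. The final constant is the sum of the two
      coefficients, since a and b are each at most the energy norm of (f, g).\<close>
    also have "\<dots> = (12 * C + 9 / c) * \<kappa> * a + (3 * C + 3 / c) * \<kappa> * b"
      by (simp add: C2_def algebra_simps add_divide_distrib)
    also have "\<dots> \<le> (12 * C + 9 / c) * \<kappa> * energy_norm E (f, g) + (3 * C + 3 / c) * \<kappa> * energy_norm E (f, g)"
      using energy_norm_ge(1)[of f g] energy_norm_ge(2)[of g f] C c \<kappa> unfolding ab by (intro add_mono mult_left_mono) auto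
    also have "\<dots> = (15 * C + 12 / c) * \<kappa> * energy_norm E (f, g)" by (simp add: algebra_simps add_divide_distrib)
    finally show ?thesis .
  qed
  have l0: "l \<noteq> 0" using l by auto
  have uniq: "y = 0" if "weak_sol l y 0" for y using dual[OF that] by simp
  have pos: "0 \<le> (15 * C + 12 / c) * \<kappa>" using C c \<kappa> by (intro mult_nonneg_nonneg add_nonneg_nonneg) auto
  note r = resolvent_bound[OF l0 ex[OF refl] uniq bound pos]
  show "gen_invertible E P \<gamma> Q l" by (rule r(1))
  show "energy_opnorm E (gen_resolvent E P \<gamma> Q l) \<le> (15 * C + 12 / c) * \<kappa>" by (rule r(2))
qed

lemma control_imp_resolvent:
  assumes "control_estimate E P \<gamma> Q \<mu> l0 N C M m" and \<mu>: "0 \<le> \<mu>" and "0 < N" and "0 < C"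
    and M: "gain_function M" and m: "gain_function m"
  shows "\<exists>l1>0. \<exists>C'>0. \<forall>l. l1 \<le> \<bar>l\<bar> \<longrightarrow> gen_invertible E P \<gamma> Q l \<and>
    energy_opnorm E (gen_resolvent E P \<gamma> Q l) \<le> C' * \<bar>l\<bar> powr (4 * \<mu>) * ((M \<bar>l\<bar>)\<^sup>2 + (m \<bar>l\<bar>)\<^sup>2)"
proof -
  obtain c0 where c0: "0 < c0" "\<And>x. 0 \<le> x \<Longrightarrow> c0 \<le> M x" using M by (auto simp: gain_function_def)
  have m0: "0 \<le> m x" if "0 \<le> x" for x using m that by (auto simp: gain_function_def intro: less_imp_le)
  obtain l1 B where l1: "1 \<le> l1" and B: "0 < B" and lb: "\<And>l u F. l1 \<le> \<bar>l\<bar> \<Longrightarrow> weak_sol l u (Lam (- (1/2)) F) \<Longrightarrow>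
    \<bar>l\<bar> * norm u \<le> B * (\<bar>l\<bar> powr (4 * \<mu>) * ((M \<bar>l\<bar>)\<^sup>2 + (m \<bar>l\<bar>)\<^sup>2)) * norm F"
    using control_imp_weak_bound[OF assms(1-4) c0 m0] by blast
  let ?C = "15 * B + 12 / c0\<^sup>2"
  have "gen_invertible E P \<gamma> Q l \<and> energy_opnorm E (gen_resolvent E P \<gamma> Q l)
      \<le> ?C * \<bar>l\<bar> powr (4 * \<mu>) * ((M \<bar>l\<bar>)\<^sup>2 + (m \<bar>l\<bar>)\<^sup>2)" if l: "l1 \<le> \<bar>l\<bar>" for l
  proof -
    let ?\<kappa> = "\<bar>l\<bar> powr (4 * \<mu>) * ((M \<bar>l\<bar>)\<^sup>2 + (m \<bar>l\<bar>)\<^sup>2)"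
    have "c0\<^sup>2 \<le> (M \<bar>l\<bar>)\<^sup>2" using c0 by (intro power_mono) auto
    then have "1 * c0\<^sup>2 \<le> ?\<kappa>"
      using l l1 \<mu> by (intro mult_mono ge_one_powr_ge_zero add_increasing2) auto
    then have \<kappa>: "c0\<^sup>2 \<le> ?\<kappa>" by simp
    have lb': "\<bar>l\<bar> * norm u \<le> B * ?\<kappa> * norm F" if "\<bar>k\<bar> = \<bar>l\<bar>" "weak_sol k u (Lam (- (1/2)) F)" for k u F
      using lb[of k u F] that l by simp
    have l': "1 \<le> \<bar>l\<bar>" and c0': "0 < c0\<^sup>2" using l l1 c0 by auto
    have "gen_invertible E P \<gamma> Q l"
      by (rule weak_bound_imp_resolvent(1)[OF l' B c0' \<kappa>]) (rule lb')
    moreover have "energy_opnorm E (gen_resolvent E P \<gamma> Q l) \<le> ?C * ?\<kappa>"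
      by (rule weak_bound_imp_resolvent(2)[OF l' B c0' \<kappa>]) (rule lb')
    ultimately show ?thesis by (simp only: mult.assoc)
  qed
  moreover have "0 < ?C" using B c0 by (intro add_pos_pos) auto
  ultimately show ?thesis using l1 by (intro exI[of _ l1] conjI exI[of _ ?C]) auto
qed

section \<open>From the resolvent to the control estimate\<close>

text \<open>The bound by K concerns a real supremum; \<open>gen_invertible\<close> supplies the
  upper bound that makes it apply to each vector. Taking (0, g) as data, both components (z, - i l
  z) of the preimage are read off.\<close>

lemma resolvent_weak_sol:
  assumes inv: "gen_invertible E P \<gamma> Q l" and K: "energy_opnorm E (gen_resolvent E P \<gamma> Q l) \<le> K"
    and g: "norm g = 1"
  obtains z where "weak_sol l z (- Lam (- (1/2)) g)" "norm (Lam (1/2) z) \<le> K" "\<bar>l\<bar> * norm z \<le> K"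
proof -
  have x: "(0, g) \<in> energy_space E" "energy_norm E (0, g) = 1"
    using g by (simp_all add: energy_space_def Hs_V dm_zero energy_norm_def Lam_zero)
  obtain B where B: "\<And>x. x \<in> energy_space E \<Longrightarrow> energy_norm E (gen_resolvent E P \<gamma> Q l x) \<le> B * energy_norm E x"
    and bij: "bij_betw (gen_shift E P \<gamma> Q l) (gen_dom E P \<gamma> Q) (energy_space E)"
    using inv by (auto simp: gen_invertible_def)
  have bd: "bdd_above {energy_norm E (gen_resolvent E P \<gamma> Q l x) |x. x \<in> energy_space E \<and> energy_norm E x \<le> 1}"
  proof (rule bdd_aboveI[of _ "\<bar>B\<bar>"])
    fix s assume "s \<in> {energy_norm E (gen_resolvent E P \<gamma> Q l x) |x. x \<in> energy_space E \<and> energy_norm E x \<le> 1}"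
    then obtain y where y: "s = energy_norm E (gen_resolvent E P \<gamma> Q l y)" "y \<in> energy_space E" "energy_norm E y \<le> 1"
      by blast
    have "0 \<le> energy_norm E y" by (simp add: energy_norm_def)
    then have "B * energy_norm E y \<le> \<bar>B\<bar> * 1" using y by (intro mult_mono) auto
    then show "s \<le> \<bar>B\<bar>" using B[OF y(2)] y(1) by simp
  qed
  define r where "r = gen_resolvent E P \<gamma> Q l (0, g)"
  have "energy_norm E r \<in> {energy_norm E (gen_resolvent E P \<gamma> Q l x) |x. x \<in> energy_space E \<and> energy_norm E x \<le> 1}"
    unfolding r_def using x by (intro CollectI exI[of _ "(0, g)"]) simp
  then have "energy_norm E r \<le> energy_opnorm E (gen_resolvent E P \<gamma> Q l)"
    unfolding energy_opnorm_def using bd by (rule cSup_upper)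
  then have rK: "energy_norm E r \<le> K" using K by simp
  have mem: "(0, g) \<in> gen_shift E P \<gamma> Q l ` gen_dom E P \<gamma> Q" using x bij by (simp add: bij_betw_imp_surj_on)
  obtain z w where zw: "r = (z, w)" by (metis prod.collapse)
  have "(z, w) \<in> gen_dom E P \<gamma> Q \<and> gen_shift E P \<gamma> Q l (z, w) = (0, g)"
    using inv_into_into[OF mem] f_inv_into_f[OF mem] unfolding zw[symmetric] r_def gen_resolvent_def by simp
  then have sol: "weak_sol l z (- Lam (- (1/2)) g)" and w: "w = - ((\<i> * l) *\<^sub>C z)"
    unfolding gen_shift_zero_iff by auto
  show thesis
  proof (rule that[OF sol])
    show "norm (Lam (1/2) z) \<le> K" using energy_norm_ge(1)[of z w] rK zw by simp
    show "\<bar>l\<bar> * norm z \<le> K"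
      using energy_norm_ge(2)[of w z] rK unfolding zw w by (simp add: norm_scaleC norm_mult)
  qed
qed

text \<open>Elliptic regularity: if (P - l^2) x is in H, then \<Lambda>^(1/2) x = \<Lambda>^(-1/2)
  h', so x = \<Lambda>^(-1) h' lies in the domain of P.\<close>

lemma P_ext_shift_regular:
  assumes x: "x \<in> V" and h: "P_ext_shift E P l x = embed_dual E (1/2) h"
  shows "x \<in> dm 1" and "h = Lam 1 x - (1 + l\<^sup>2) *\<^sub>R x"
proof -
  define h' where "h' = h + (1 + l\<^sup>2) *\<^sub>R x"
  have np [simp]: "y \<in> dm (- (1/2))" "y \<in> dm (- 1)" for y by (simp_all add: dm_nonpos)
  have "Lam (1/2) x = Lam (- (1/2)) h'"
  proof (rule cinner_eqI)
    fix Y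
    define w where "w = Lam (- (1/2)) Y"
    have w: "w \<in> V" "Lam (1/2) w = Y" by (simp_all add: w_def Lam_V)
    have "energy_form x w - complex_of_real (l\<^sup>2) * cinner x w = cinner h w"
      using fun_cong[OF h, of w] w(1) by (simp add: P_ext_shift_def P_ext_eq[OF x] embed_dual_def Hs_V)
    then have "cinner (Lam (1/2) x) Y = cinner h' w"
      unfolding energy_form_def w(2) h'_def
      by (simp add: cinner_add_left scaleR_scaleC cinner_scaleC_left algebra_simps)
    also have "\<dots> = cinner (Lam (- (1/2)) h') Y" unfolding w_def by (rule Lam_sym[symmetric]) simp_all
    finally show "cinner (Lam (1/2) x) Y = cinner (Lam (- (1/2)) h') Y" .
  qed
  then have "x = Lam (- (1/2)) (Lam (- (1/2)) h')" using Lam_inverse[OF x] by simp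
  also have "\<dots> = Lam (- 1) h'" by (rule Lam_compI) simp_all
  finally have xh: "x = Lam (- 1) h'" .
  show "x \<in> dm 1" unfolding xh by (rule Lam_mem_inverse) simp
  have "Lam 1 x = h'" unfolding xh by (rule Lam_inverse') simp
  then show "h = Lam 1 x - (1 + l\<^sup>2) *\<^sub>R x" by (simp add: h'_def)
qed

text \<open>Testing the solution \<open>z\<close> of \<open>(P - l\<^sup>2 - i l Q\<^sup>*Q) z = - v / \<parallel>v\<parallel>\<close> against \<open>v = \<Lambda>\<^sup>\<gamma> x\<close> moves the operator
  from \<open>z\<close> to \<open>v\<close>, where it becomes \<open>\<Lambda>\<^sup>\<gamma> h\<close> up to the damping term.\<close>

lemma resolvent_imp_bound:
  assumes inv: "gen_invertible E P \<gamma> Q l" and K: "energy_opnorm E (gen_resolvent E P \<gamma> Q l) \<le> K" "0 < K"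
    and c: "0 < c" "\<And>u. u \<in> dm \<gamma> \<Longrightarrow> norm (Q u) \<le> c * norm (Lam \<gamma> u)"
    and x: "x \<in> dm 1"
  defines "h \<equiv> Lam 1 x - (1 + l\<^sup>2) *\<^sub>R x" and "L \<equiv> japanese l"
  shows "norm (Lam \<gamma> x) \<le> 3 * (1 + c) * K * L powr (2 * \<gamma>) * (norm h / L + norm (Q (Lam \<gamma> x)))"
proof (cases "Lam \<gamma> x = 0")
  case True
  have "1 \<le> L" unfolding L_def by (rule japanese_ge)
  then have "0 \<le> 3 * (1 + c) * K * L powr (2 * \<gamma>) * (norm h / L + norm (Q (Lam \<gamma> x)))"
    using K c by (intro mult_nonneg_nonneg add_nonneg_nonneg) auto
  then show ?thesis using True by simp
next
  case False
  define v where "v = Lam \<gamma> x"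
  define q where "q = norm (Q v)"
  define g where "g = (1 / norm v) *\<^sub>R v"
  have L: "1 \<le> L" "\<bar>l\<bar> \<le> L" unfolding L_def by (rule japanese_ge)+
  have L1: "L \<le> 1 + \<bar>l\<bar>"
    unfolding L_def japanese_def by (rule real_le_lsqrt) (auto simp: power2_sum)
  have v0: "norm v \<noteq> 0" using False by (simp add: v_def)
  have g: "norm g = 1" using v0 by (simp add: g_def)
  have mem: "x \<in> dm s" if "s \<le> 1" for s using x that by (rule dm_mono)
  have vV: "v \<in> V" unfolding v_def
    by (rule Lam_memI[of _ _ "1/2 + \<gamma>"]) (use mem \<gamma>_le in auto)
  obtain z where z: "weak_sol l z (- Lam (- (1/2)) g)" "norm (Lam (1/2) z) \<le> K" "\<bar>l\<bar> * norm z \<le> K"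
    using resolvent_weak_sol[OF inv K(1) g] by blast
  have zV: "z \<in> V" using z by (simp add: weak_sol_def)
  have z\<gamma>: "z \<in> dm \<gamma>" by (rule V_subset[OF zV])
  have "form l z v = - cinner g v"
    using z(1) vV by (simp add: weak_sol_def cinner_minus_left cinner_half)
  moreover have "cinner g v = complex_of_real (norm v)"
    unfolding g_def cinner_scaleR_left cinner_self using v0 by (simp add: scaleR_conv_of_real power2_eq_square)
  ultimately have nv: "norm v = cmod (form l z v)" by simp
  \<comment> \<open>The total order 1 + \<gamma> is redistributed, \<gamma> on z and 1 on x; z has
    only the regularity of H_(1/2), so P itself cannot act on it.\<close>
  have "energy_form z v - complex_of_real (l\<^sup>2) * cinner z v = cinner (Lam \<gamma> z) h"
  proof -
    have "Lam (1/2) v = Lam (1/2 + \<gamma>) x" unfolding v_def by (rule Lam_compI) (use mem \<gamma>_le in auto)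
    then have "cinner (Lam (1/2) z) (Lam (1/2) v) = cinner (Lam \<gamma> z) (Lam 1 x)"
      using zV z\<gamma> mem \<gamma>_le by (simp only:) (intro Lam_cinner_split, auto)
    moreover have "cinner (Lam 0 z) (Lam \<gamma> x) = cinner (Lam \<gamma> z) (Lam 0 x)"
      using z\<gamma> mem \<gamma>_le by (intro Lam_cinner_split) (auto intro: dm_nonpos)
    ultimately show ?thesis
      unfolding energy_form_def h_def
      by (simp add: cinner_diff_right scaleR_scaleC cinner_scaleC_right v_def[symmetric] algebra_simps)
  qed
  then have "form l z v = cinner (Lam \<gamma> z) h - (\<i> * l) * cinner (Q z) (Q v)" unfolding form_def by simp
  then have "norm v \<le> cmod (cinner (Lam \<gamma> z) h) + \<bar>l\<bar> * cmod (cinner (Q z) (Q v))"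
    unfolding nv using norm_triangle_ineq4[of "cinner (Lam \<gamma> z) h" "(\<i> * l) * cinner (Q z) (Q v)"]
    by (simp add: norm_mult)
  also have "\<dots> \<le> norm (Lam \<gamma> z) * norm h + L * (c * norm (Lam \<gamma> z) * q)"
  proof (intro add_mono norm_cinner_le mult_mono)
    show "cmod (cinner (Q z) (Q v)) \<le> c * norm (Lam \<gamma> z) * q"
      unfolding q_def by (rule order_trans[OF norm_cinner_le]) (intro mult_right_mono c z\<gamma>, simp)
  qed (use L in auto)
  finally have v1: "norm v \<le> norm (Lam \<gamma> z) * (norm h + c * (L * q))" by (simp add: algebra_simps)
  \<comment> \<open>The bound of |l| ||z|| says little for small l; ||z|| \<le> ||\<Lambda>^(1/2)
    z|| \<le> K fills this in through L \<le> 1 + |l|.\<close>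
  have zL: "L * norm z \<le> 2 * K"
  proof -
    have "L * norm z \<le> (1 + \<bar>l\<bar>) * norm z" using L1 by (intro mult_right_mono) auto
    also have "\<dots> \<le> 2 * K" using z norm_V_le[OF zV] by (simp add: algebra_simps)
    finally show ?thesis .
  qed
  have "norm (Lam \<gamma> z) \<le> L powr (2 * \<gamma>) * norm z + L powr (2 * \<gamma> - 1) * norm (Lam (1/2) z)"
  proof (rule sqrt_sum_le)
    have "(norm (Lam \<gamma> z))\<^sup>2 \<le> (L powr (2 * \<gamma>))\<^sup>2 * (norm (Lam 0 z))\<^sup>2 + (L powr (2 * \<gamma> - 1))\<^sup>2 * (norm (Lam (1/2) z))\<^sup>2"
      by (rule Lam_norm_le) (use z\<gamma> zV multiplier_interpolate[OF _ L(1) \<gamma>_nonneg \<gamma>_le] in \<open>auto simp: dm_nonpos\<close>)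
    then show "(norm (Lam \<gamma> z))\<^sup>2 \<le> (L powr (2 * \<gamma>) * norm z)\<^sup>2 + (L powr (2 * \<gamma> - 1) * norm (Lam (1/2) z))\<^sup>2"
      by (simp add: power_mult_distrib)
  qed auto
  also have "L powr (2 * \<gamma>) = L powr (2 * \<gamma> - 1) * L" using L by (simp add: powr_diff)
  also have "L powr (2 * \<gamma> - 1) * L * norm z + L powr (2 * \<gamma> - 1) * norm (Lam (1/2) z)
      = L powr (2 * \<gamma> - 1) * (L * norm z + norm (Lam (1/2) z))" by (simp add: algebra_simps)
  also have "\<dots> \<le> L powr (2 * \<gamma> - 1) * (3 * K)" using zL z(2) by (intro mult_left_mono) auto
  finally have z1: "norm (Lam \<gamma> z) \<le> L powr (2 * \<gamma> - 1) * (3 * K)" .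
  have "norm v \<le> L powr (2 * \<gamma> - 1) * (3 * K) * ((1 + c) * (norm h + L * q))"
  proof (rule order_trans[OF v1], rule mult_mono[OF z1])
    show "norm h + c * (L * q) \<le> (1 + c) * (norm h + L * q)"
      using c L by (simp add: q_def algebra_simps)
  qed (use c K L in \<open>auto simp: q_def\<close>)
  also have "\<dots> = 3 * (1 + c) * K * L powr (2 * \<gamma>) * (norm h / L + q)"
    using L by (simp add: powr_diff field_simps)
  finally show ?thesis unfolding v_def q_def .
qed

text \<open>With x = \<Lambda>^(\<mu>-\<gamma>) u, the resolvent bounds \<Lambda>^\<gamma> x =
  \<Lambda>^\<mu> u with the factor L^(2 \<gamma>), and \<open>multiplier_shift\<close> returns to u
  = \<Lambda>^(\<gamma>-\<mu>) x, gaining L^(-2 \<mu>).\<close>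

lemma resolvent_imp_control:
  assumes C': "0 < C'" and res: "\<And>l. l0 \<le> \<bar>l\<bar> \<Longrightarrow> C' \<le> K \<bar>l\<bar> \<and> gen_invertible E P \<gamma> Q l \<and>
      energy_opnorm E (gen_resolvent E P \<gamma> Q l) \<le> K \<bar>l\<bar>"
    and \<mu>: "0 \<le> \<mu>" "\<mu> \<le> 1/2 + \<gamma>"
  shows "\<exists>C>0. \<forall>l\<ge>l0. \<forall>u\<in>Hs E (1/2 + \<mu>).
    ennreal (norm u) \<le> ennreal (C * japanese l powr (2 * (\<gamma> - \<mu>)) * K \<bar>l\<bar>) *
      (ennreal (inverse (japanese l)) * dual_H_norm E (1/2) (P_ext_shift E P l (Lam (\<mu> - \<gamma>) u))
        + ennreal (norm (Q (Lam \<mu> u))))"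
proof -
  obtain c where c: "0 < c" "\<And>u. u \<in> dm \<gamma> \<Longrightarrow> norm (Q u) \<le> c * norm (Lam \<gamma> u)" using Q_bound by blast
  define A where "A = 2 * 4 powr \<mu>"
  \<comment> \<open>The second summand serves the term 2 ||h|| / L, which comes without a factor K
    and acquires one from 1 \<le> K / C'.\<close>
  define C where "C = A * (3 * (1 + c)) + 2 / C'"
  have A: "0 < A" by (simp add: A_def)
  have C: "0 < C" unfolding C_def using A c C' by (intro add_pos_pos mult_pos_pos) auto
  have "ennreal (norm u) \<le> ennreal (C * japanese l powr (2 * (\<gamma> - \<mu>)) * K \<bar>l\<bar>) *
      (ennreal (inverse (japanese l)) * dual_H_norm E (1/2) (P_ext_shift E P l (Lam (\<mu> - \<gamma>) u))
        + ennreal (norm (Q (Lam \<mu> u))))"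
    if l: "l0 \<le> l" and u: "u \<in> Hs E (1/2 + \<mu>)" for l u
  proof -
    define L where "L = japanese l"
    define x where "x = Lam (\<mu> - \<gamma>) u"
    define \<kappa> where "\<kappa> = K \<bar>l\<bar>"
    have "l0 \<le> \<bar>l\<bar>" using l by linarith
    then have \<kappa>: "C' \<le> \<kappa>" using res by (simp add: \<kappa>_def)
    then have \<kappa>0: "0 < \<kappa>" using C' by linarith
    have L: "1 \<le> L" unfolding L_def by (rule japanese_ge)
    have u': "u \<in> dm (1/2 + \<mu>)" using u Hs_eq[of "1/2 + \<mu>"] \<mu> by simp
    have um: "u \<in> dm s" if "s \<le> 1/2 + \<mu>" for s using u' that by (rule dm_mono)
    have xV: "x \<in> V" unfolding x_def
      by (rule Lam_memI[of _ _ "1/2 + \<mu> - \<gamma>"]) (use um \<gamma>_nonneg in auto)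
    have pos: "0 < C * L powr (2 * (\<gamma> - \<mu>)) * \<kappa>" using C L \<kappa>0 by (intro mult_pos_pos) auto
    show ?thesis
    proof (cases "dual_in_H E (1/2) (P_ext_shift E P l x)")
      \<comment> \<open>The norm of (P - l^2) x is infinite here, and so is the right-hand side,
        since all prefactors are positive.\<close>
      case False
      have "0 < inverse L" using L by simp
      then have "ennreal (inverse L) * dual_H_norm E (1/2) (P_ext_shift E P l x) = \<infinity>"
        using False by (simp add: dual_H_norm_def ennreal_mult_eq_top_iff infinity_ennreal_def)
      moreover have "ennreal k * (\<infinity> + a) = top" if "0 < k" for k a
        using that by (simp add: ennreal_mult_eq_top_iff)
      ultimately have "ennreal (C * L powr (2 * (\<gamma> - \<mu>)) * \<kappa>) *
        (ennreal (inverse L) * dual_H_norm E (1/2) (P_ext_shift E P l x) + ennreal (norm (Q (Lam \<mu> u)))) = top"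
        using pos by (simp only:)
      then show ?thesis unfolding L_def x_def \<kappa>_def by (simp only: top_greatest)
    next
      case True
      then obtain h where h: "P_ext_shift E P l x = embed_dual E (1/2) h" by (auto simp: dual_in_H_def)
      have x1: "x \<in> dm 1" and hx: "h = Lam 1 x - (1 + l\<^sup>2) *\<^sub>R x"
        using P_ext_shift_regular[OF xV h] by auto
      have dn: "dual_H_norm E (1/2) (P_ext_shift E P l x) = ennreal (norm h)"
        using True unfolding dual_H_norm_def h dual_to_H_embed by simp
      have ux: "Lam (\<gamma> - \<mu>) x = u" "Lam \<gamma> x = Lam \<mu> u"
        unfolding x_def using um \<mu> \<gamma>_nonneg Lam_compI[of u "\<mu> - \<gamma>" 0 "\<gamma> - \<mu>"] by (auto intro!: Lam_compI)
      define q where "q = norm (Q (Lam \<mu> u))"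
      have v: "norm (Lam \<gamma> x) \<le> 3 * (1 + c) * \<kappa> * L powr (2 * \<gamma>) * (norm h / L + q)"
        using resolvent_imp_bound[OF _ _ \<kappa>0 c x1, of l] res[of l] l
        unfolding L_def q_def \<kappa>_def hx ux(2) by simp
      have "norm (Lam (\<gamma> - \<mu>) x) \<le> (A * L powr (- (2 * \<mu>))) * norm (Lam \<gamma> x) + (2 * L powr (2 * (\<gamma> - \<mu>) - 1)) * norm h"
      proof (rule sqrt_sum_le)
        show "(norm (Lam (\<gamma> - \<mu>) x))\<^sup>2 \<le> ((A * L powr (- (2 * \<mu>))) * norm (Lam \<gamma> x))\<^sup>2 + ((2 * L powr (2 * (\<gamma> - \<mu>) - 1)) * norm h)\<^sup>2"
          unfolding power_mult_distrib[of _ "norm _"] hx A_def L_def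
          by (rule Lam_shift_norm_le) (use x1 \<gamma>_le \<mu> multiplier_shift[OF _ \<mu>, of _ l] in \<open>auto intro: dm_mono\<close>)
      qed (use A in auto)
      also have "\<dots> \<le> (A * L powr (- (2 * \<mu>))) * (3 * (1 + c) * \<kappa> * L powr (2 * \<gamma>) * (norm h / L + q))
          + (2 * L powr (2 * (\<gamma> - \<mu>) - 1)) * norm h"
        using v A by (intro add_right_mono mult_left_mono) auto
      also have "\<dots> = (A * (3 * (1 + c)) * \<kappa> * (norm h / L + q) + 2 * (norm h / L)) * L powr (2 * (\<gamma> - \<mu>))"
      proof -
        have "L powr (- (2 * \<mu>)) * L powr (2 * \<gamma>) = L powr (2 * (\<gamma> - \<mu>))"
          unfolding powr_add[symmetric] by (simp add: algebra_simps)
        moreover have "L powr (2 * (\<gamma> - \<mu>) - 1) = L powr (2 * (\<gamma> - \<mu>)) / L" using L by (simp add: powr_diff)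
        moreover have "A * p * (k * \<kappa> * g * Z) + 2 * (e / L) * y = (A * k * \<kappa> * Z + 2 * (y / L)) * e"
          if "p * g = e" for p g e k Z y :: real
          unfolding that[symmetric] by (simp add: algebra_simps)
        ultimately show ?thesis by metis
      qed
      also have "\<dots> \<le> (C * \<kappa> * (norm h / L + q)) * L powr (2 * (\<gamma> - \<mu>))"
      proof (rule mult_right_mono)
        have "norm h / L * 1 \<le> (norm h / L + q) * (\<kappa> / C')"
          using C' \<kappa> \<kappa>0 L by (intro mult_mono) (auto simp: q_def)
        then have "2 * (norm h / L) \<le> 2 * ((norm h / L + q) * (\<kappa> / C'))" by simp
        also have "\<dots> = 2 / C' * \<kappa> * (norm h / L + q)" by simp
        finally have "2 * (norm h / L) \<le> 2 / C' * \<kappa> * (norm h / L + q)" .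
        then show "A * (3 * (1 + c)) * \<kappa> * (norm h / L + q) + 2 * (norm h / L) \<le> C * \<kappa> * (norm h / L + q)"
          unfolding C_def distrib_right by linarith
      qed simp
      finally have "norm u \<le> C * L powr (2 * (\<gamma> - \<mu>)) * \<kappa> * (inverse L * norm h + q)"
        unfolding ux by (simp add: divide_inverse mult_ac)
      then have "ennreal (norm u) \<le> ennreal (C * L powr (2 * (\<gamma> - \<mu>)) * \<kappa> * (inverse L * norm h + q))"
        by (rule ennreal_leI)
      also have "\<dots> = ennreal (C * L powr (2 * (\<gamma> - \<mu>)) * \<kappa>) * (ennreal (inverse L) * ennreal (norm h) + ennreal q)"
      proof -
        have "ennreal (inverse L) * ennreal (norm h) + ennreal q = ennreal (inverse L * norm h + q)"
          using L by (subst ennreal_plus) (auto simp: ennreal_mult q_def)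
        then show ?thesis using pos L by (simp add: ennreal_mult q_def)
      qed
      finally show ?thesis unfolding dn[symmetric] unfolding L_def x_def \<kappa>_def q_def .
    qed
  qed
  then show ?thesis using C by (intro exI[of _ C]) auto
qed

end

theorem theorem2:
  fixes D :: "'h::complex_hilbert set"
    and P :: "'h \<Rightarrow> 'h"
    and E :: "real \<Rightarrow> 'h \<Rightarrow> 'h"
    and Q :: "'h \<Rightarrow> 'y::complex_hilbert"
    and \<gamma> :: real
  assumes "selfadjoint D P"
    and "nonnegative_op D P"
    and "compact_resolvent D P"
    and "spectral_resolution D P E"
    and "0 \<le> \<gamma>" and "\<gamma> \<le> 1/2"
    and "bounded_Hs E \<gamma> Q"
  shows "(\<forall>\<mu> l0 N C M m.
            0 \<le> \<mu> \<longrightarrow> 0 \<le> l0 \<longrightarrow> 0 < N \<longrightarrow> 0 < C \<longrightarrow> gain_function M \<longrightarrow> gain_function m \<longrightarrow>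
            control_estimate E P \<gamma> Q \<mu> l0 N C M m \<longrightarrow>
            (\<exists>l1>0. \<exists>C'>0. \<forall>l::real. l1 \<le> \<bar>l\<bar> \<longrightarrow>
               gen_invertible E P \<gamma> Q l \<and>
               energy_opnorm E (gen_resolvent E P \<gamma> Q l)
                 \<le> C' * \<bar>l\<bar> powr (4 * \<mu>) * ((M \<bar>l\<bar>)\<^sup>2 + (m \<bar>l\<bar>)\<^sup>2)))
       \<and> (\<forall>l0 C' (K :: real \<Rightarrow> real).
            0 \<le> l0 \<longrightarrow> 0 < C' \<longrightarrow>
            (\<forall>l::real. l0 \<le> \<bar>l\<bar> \<longrightarrow>
               C' \<le> K \<bar>l\<bar> \<and> gen_invertible E P \<gamma> Q l \<and>
               energy_opnorm E (gen_resolvent E P \<gamma> Q l) \<le> K \<bar>l\<bar>) \<longrightarrow>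
            (\<forall>\<mu>. 0 \<le> \<mu> \<longrightarrow> \<mu> \<le> 1/2 + \<gamma> \<longrightarrow>
               (\<exists>C>0. \<forall>l\<ge>l0. \<forall>u\<in>Hs E (1/2 + \<mu>).
                  ennreal (norm u)
                    \<le> ennreal (C * japanese l powr (2 * (\<gamma> - \<mu>)) * K \<bar>l\<bar>) *
                        (ennreal (inverse (japanese l)) *
                           dual_H_norm E (1/2) (P_ext_shift E P l (Lambda_pow E (\<mu> - \<gamma>) u))
                         + ennreal (norm (Q (Lambda_pow E \<mu> u)))))))"
proof -
  interpret damped E D P Q \<gamma>
    using assms by unfold_locales (auto simp: spectral_resolution_def)
  show ?thesis
    using control_imp_resolvent resolvent_imp_control by blast
qed

end
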